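(* Let the standing assumptions listed in the context hold, let $\rho>0$, $(k,p)\in(0,\infty)^2$, $\eta_0>0$, and for each $\eta\in(0,\eta_0]$ let $a_\eta(\zeta):=\eta a(\zeta)$, let $y_\eta\ge0$, and for $\alpha\in\mathcal A_H(k,p,y_\eta)$ let $X^{H,\eta}=(K^{H,\eta},P^{H,\eta},Y^\eta)$ be the controlled Hawkes state process with excitation function $a_\eta$ started from $(k,p,y_\eta)$, so that $$dY^\eta_t=-bY^\eta_t\,dt+\int_{\mathcal Z}\eta a(\zeta)\,N^\eta(dt,d\zeta),\qquad Y^\eta_0=y_\eta,$$ where $N^\eta$ has predictable compensator $(\mu(P^{H,\eta}_{t-})+Y^\eta_{t-})\,\nu(d\zeta)\,dt$. Set $\bar a_1:=\int_{\mathcal Z}a\,d\nu<\infty$ and $\bar a_2:=\int_{\mathcal Z}a^2\,d\nu<\infty$. Assume: 1. there is $c_y>0$, independent of $\eta$, with $0\le y_\eta\le c_y\eta$ for $0<\eta\le\eta_0$; 2. $\eta_0\bar a_1<b$; 3. there is $B_\mu<\infty$ such that $$\sup_{0<\eta\le\eta_0}\ \sup_{\alpha\in\mathcal A_H(k,p,y_\eta)}\mathbb E^\alpha_{k,p,y_\eta}\left[\int_0^\infty e^{-\rho t}\mu(P^{H,\eta}_t)^2\,dt\right]\le B_\mu;$$ 4. for some $q\ge0$ there is $B_q<\infty$ such that $$\sup_{0<\eta\le\eta_0}\ \sup_{\alpha\in\mathcal A_H(k,p,y_\eta)}\mathbb E^\alpha_{k,p,y_\eta}\left[\int_0^\infty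 e^{-\rho t}\bigl(1+(K^{H,\eta}_t)^{2q}+(P^{H,\eta}_t)^{2q}\bigr)dt\right]\le B_q.$$ Then there exists a constant $A_*>0$, independent of $\eta\in(0,\eta_0]$ and of the admissible control, such that for every $\eta\in(0,\eta_0]$ $$\sup_{\alpha\in\mathcal A_H(k,p,y_\eta)}\mathbb E^\alpha_{k,p,y_\eta}\left[\int_0^\infty e^{-\rho t}\,Y^\eta_t\bigl(1+(K^{H,\eta}_t)^q+(P^{H,\eta}_t)^q\bigr)dt\right]\le A_*\eta .$$ In particular, the left-hand side tends to $0$ as $\eta\downarrow0$.
   Context: Standing assumptions. Stochastic basis: $(\mathcal Z,\mathfrak Z)$ is a measurable mark space with a probability measure $\nu$. $(\Omega,\mathcal F,\mathbb F,\mathbb P)$ is a filtered probability space carrying an $\mathbb F$-Brownian motion $W$ and an independent $\mathbb F$-Poisson random measure $M$ on $\mathbb R_{\ge0}\times\mathcal Z\times\mathbb R_{\ge0}$ with intensity measure $dt\otimes\nu(d\zeta)\otimes dr$; $\mathbb F$ is the complete right-continuous augmentation of the filtration generated by $W$ and $M$. $\mathcal S_H=(0,\infty)\times(0,\infty)\times[0,\infty)$. Coefficients: $\sigma>0$, $b>0$ are constants. (a) $\mu:\mathbb R_{>0}\to\mathbb R_{\ge0}$ is locally Lipschitz with $\mu(p)\le L_\mu(1+p)$ for all $p>0$, for some $L_\mu>0$. (b) $a:\mathcal Z\to\mathbb R_{\ge0}$ is measurable with $\int_{\mathcal Z}a\,d\nu<\infty$ and $\int_{\mathcal Z}a^2\,d\nu<\infty$.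 (c) $b^{\mathrm{cap}}$ and $b^{\mathrm{pol}}$ are real-valued functions of $(k,p,\alpha)=(k,p,c,\theta)$, locally Lipschitz in $(k,p)$, uniformly with respect to the control on bounded sets, and $|b^{\mathrm{cap}}(k,p,c,\theta)|+|b^{\mathrm{pol}}(k,p,c,\theta)|\le L(1+k+p+c)$ for some $L>0$. (d) $\omega:\mathbb R_{>0}\times\mathbb R_{>0}\times\mathcal Z\to(0,1]$ is measurable and locally Lipschitz in $(k,p)$ uniformly in $\zeta$. (e) Starting from positive initial values, the continuous dynamics (the equations for $(K,P)$ below without the jump term) do not attain the boundary of $\mathbb R_{>0}^2$ in finite time. Admissible controls: $\mathfrak a\subseteq\mathbb R_{\ge0}\times[0,1]$ is a given set of actions. $\mathcal A_H(k,p,y)$ is the set of $\mathbb F$-predictable $\mathfrak a$-valued processes $\alpha=(C_t,\theta_t)_{t\ge0}$ with $\mathbb E[\int_0^\infty\|\alpha_t\|^2dt]<\infty$, for the system started from $(k,p,y)\in\mathcal S_H$. State process: for $\alpha\in\mathcal A_H(k,p,y_\eta)$, $(K^{H,\eta},P^{H,\eta},Y^\eta)$ is the unique $\mathcal S_H$-valued strong solution on $[0,\infty)$ of $dK_t=b^{\mathrm{cap}}(K_t,P_t,\alpha_t)\,dt-\int_{\mathcal Z}(1-\omega(K_{t-},P_{t-},\zeta))K_{t-}\,N^\eta(dt,d\zeta)$, $dP_t=b^{\mathrm{pol}}(K_t,P_t,\alpha_t)\,dt+\sigma P_t\,dW_t$, $dY_t=-bY_t\,dt+\int_{\mathcal Z}\eta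 a(\zeta)\,N^\eta(dt,d\zeta)$, started from $(k,p,y_\eta)$, where $N^\eta(dt,d\zeta)=\int_{\mathbb R_{\ge0}}\mathbf 1_{\{r\le\mu(P_{t-})+Y_{t-}\}}M(dt,d\zeta,dr)$. This solution exists globally, $N^\eta((0,T]\times\mathcal Z)<\infty$ a.s. and $\mathbb E[\sup_{t\le T}(K_t^2+P_t^2+Y_t^2)]<\infty$ for all $T<\infty$. $\mathbb E^\alpha_{k,p,y}$ denotes expectation when the initial state is $(k,p,y)$ and the control is $\alpha$. *)

theory Defs
  imports "HOL-Probability.Probability"
begin

text \<open>
  Time is \<open>real\<close>; only times \<open>t \<ge> 0\<close> matter. A process is a function \<open>time \<Rightarrow> sample point \<Rightarrow> value\<close>.
\<close>


section \<open>Paths\<close>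

definition cadlag :: "(real \<Rightarrow> real) \<Rightarrow> bool" where
  "cadlag f \<longleftrightarrow>
     (\<forall>t\<ge>0. (f \<longlongrightarrow> f t) (at_right t)) \<and> (\<forall>t>0. \<exists>l. (f \<longlongrightarrow> l) (at_left t))"

text \<open>The left limit \<open>f(t-)\<close>, with the convention \<open>f(0-) = f(0)\<close>.\<close>

definition left_lim :: "(real \<Rightarrow> real) \<Rightarrow> real \<Rightarrow> real" where
  "left_lim f t = (if t \<le> 0 then f 0 else Lim (at_left t) f)"


section \<open>Stochastic basis\<close>

definition mark_intensity :: "'z measure \<Rightarrow> (real \<times> 'z \<times> real) measure" where
  "mark_intensity \<nu> =
     restrict_space lborel {0..} \<Otimes>\<^sub>M (\<nu> \<Otimes>\<^sub>M restrict_space lborel {0..})"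

definition W_events :: "'o measure \<Rightarrow> (real \<Rightarrow> 'o \<Rightarrow> real) \<Rightarrow> real set \<Rightarrow> 'o set set" where
  "W_events \<PP> W S = {W u -` A \<inter> space \<PP> | u A. u \<in> S \<and> A \<in> sets borel}"

definition M_events ::
  "'o measure \<Rightarrow> 'z measure \<Rightarrow> ('o \<Rightarrow> (real \<times> 'z \<times> real) measure) \<Rightarrow> real set \<Rightarrow> 'o set set" where
  "M_events \<PP> \<nu> M S =
     {(\<lambda>\<omega>. emeasure (M \<omega>) B) -` A \<inter> space \<PP> | B A.
        B \<in> sets (mark_intensity \<nu>) \<and> B \<subseteq> S \<times> UNIV \<and> A \<in> sets borel}"

text \<open>
  The complete right-continuous augmentation of the filtration generated by \<open>W\<close> and \<open>M\<close>. For
  \<open>t < 0\<close> it consists of the events of probability 0 or 1 generated by the null sets.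
\<close>

definition augmented_filtration ::
  "'o measure \<Rightarrow> 'z measure \<Rightarrow> (real \<Rightarrow> 'o \<Rightarrow> real) \<Rightarrow> ('o \<Rightarrow> (real \<times> 'z \<times> real) measure)
     \<Rightarrow> real \<Rightarrow> 'o measure" where
  "augmented_filtration \<PP> \<nu> W M t =
     sigma (space \<PP>)
       (\<Inter>s\<in>{t<..}. sigma_sets (space \<PP>)
          (W_events \<PP> W {0..s} \<union> M_events \<PP> \<nu> M {0..s} \<union> {A. \<exists>N\<in>null_sets \<PP>. A \<subseteq> N}))"

definition brownian_motion ::
  "'o measure \<Rightarrow> (real \<Rightarrow> 'o measure) \<Rightarrow> (real \<Rightarrow> 'o \<Rightarrow> real) \<Rightarrow> bool" where
  "brownian_motion \<PP> F W \<longleftrightarrow>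
     (\<forall>\<omega>\<in>space \<PP>. W 0 \<omega> = 0 \<and> continuous_on {0..} (\<lambda>t. W t \<omega>)) \<and>
     (\<forall>t\<ge>0. W t \<in> borel_measurable (F t)) \<and>
     (\<forall>s t. 0 \<le> s \<and> s < t \<longrightarrow>
        distributed \<PP> lborel (\<lambda>\<omega>. W t \<omega> - W s \<omega>) (normal_density 0 (sqrt (t - s))) \<and>
        prob_space.indep_set \<PP> (sets (F s))
          {(\<lambda>\<omega>. W t \<omega> - W s \<omega>) -` A \<inter> space \<PP> | A. A \<in> sets borel})"

definition poisson_random_measure ::
  "'o measure \<Rightarrow> (real \<Rightarrow> 'o measure) \<Rightarrow> 'z measure \<Rightarrow> ('o \<Rightarrow> (real \<times> 'z \<times> real) measure)
     \<Rightarrow> bool" where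
  "poisson_random_measure \<PP> F \<nu> M \<longleftrightarrow>
     (\<forall>\<omega>\<in>space \<PP>. sets (M \<omega>) = sets (mark_intensity \<nu>)) \<and>
     (\<forall>\<omega>\<in>space \<PP>. \<forall>B\<in>sets (mark_intensity \<nu>).
        emeasure (M \<omega>) B = \<infinity> \<or> (\<exists>n::nat. emeasure (M \<omega>) B = of_nat n)) \<and>
     (\<forall>B\<in>sets (mark_intensity \<nu>). (\<lambda>\<omega>. emeasure (M \<omega>) B) \<in> borel_measurable \<PP>) \<and>
     (\<forall>B\<in>sets (mark_intensity \<nu>). emeasure (mark_intensity \<nu>) B < \<infinity> \<longrightarrow>
        (\<forall>n::nat. measure \<PP> {\<omega>\<in>space \<PP>. emeasure (M \<omega>) B = of_nat n} =
           exp (- measure (mark_intensity \<nu>) B) * measure (mark_intensity \<nu>) B ^ n / fact n)) \<and>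
     (\<forall>(n::nat) B. (\<forall>i<n. B i \<in> sets (mark_intensity \<nu>)) \<and> disjoint_family_on B {..<n} \<longrightarrow>
        prob_space.indep_vars \<PP> (\<lambda>_. borel) (\<lambda>i \<omega>. emeasure (M \<omega>) (B i)) {..<n}) \<and>
     (\<forall>t\<ge>0. \<forall>B\<in>sets (mark_intensity \<nu>). B \<subseteq> {0..t} \<times> UNIV \<longrightarrow>
        (\<lambda>\<omega>. emeasure (M \<omega>) B) \<in> borel_measurable (F t)) \<and>
     (\<forall>s\<ge>0. prob_space.indep_set \<PP> (sets (F s))
        (sigma_sets (space \<PP>) (M_events \<PP> \<nu> M {s<..})))"

text \<open>
  Completeness of \<open>\<PP>\<close> is what makes the augmentation consist of events of \<open>\<PP>\<close>.
\<close>

definition stochastic_basis ::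
  "'o measure \<Rightarrow> (real \<Rightarrow> 'o measure) \<Rightarrow> 'z measure \<Rightarrow> (real \<Rightarrow> 'o \<Rightarrow> real)
     \<Rightarrow> ('o \<Rightarrow> (real \<times> 'z \<times> real) measure) \<Rightarrow> bool" where
  "stochastic_basis \<PP> F \<nu> W M \<longleftrightarrow>
     prob_space \<PP> \<and> complete_measure \<PP> \<and> prob_space \<nu> \<and>
     F = augmented_filtration \<PP> \<nu> W M \<and>
     brownian_motion \<PP> F W \<and>
     poisson_random_measure \<PP> F \<nu> M \<and>
     prob_space.indep_set \<PP> (sigma_sets (space \<PP>) (W_events \<PP> W {0..}))
       (sigma_sets (space \<PP>) (M_events \<PP> \<nu> M {0..}))"


section \<open>Ito integral\<close>

definition progressive ::
  "(real \<Rightarrow> 'o measure) \<Rightarrow> (real \<Rightarrow> 'o \<Rightarrow> real) \<Rightarrow> bool" where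
  "progressive F H \<longleftrightarrow>
     (\<forall>T\<ge>0. (\<lambda>(t, \<omega>). H t \<omega>) \<in> borel_measurable (restrict_space borel {0..T} \<Otimes>\<^sub>M F T))"

text \<open>
  \<open>(n, \<tau>, \<xi>)\<close> encodes the integrand \<open>\<Sum>i<n. \<xi> i * indicator {\<tau> i<..\<tau> (Suc i)}\<close> with bounded
  coefficients \<open>\<xi> i\<close> that are measurable with respect to \<open>F (\<tau> i)\<close>.
\<close>

definition simple_integrand ::
  "'o measure \<Rightarrow> (real \<Rightarrow> 'o measure) \<Rightarrow> nat \<times> (nat \<Rightarrow> real) \<times> (nat \<Rightarrow> 'o \<Rightarrow> real) \<Rightarrow> bool" where
  "simple_integrand \<PP> F = (\<lambda>(n, \<tau>, \<xi>).
     0 \<le> \<tau> 0 \<and> (\<forall>i<n. \<tau> i \<le> \<tau> (Suc i)) \<and>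
     (\<forall>i<n. \<xi> i \<in> borel_measurable (F (\<tau> i)) \<and> (\<exists>C. \<forall>\<omega>\<in>space \<PP>. \<bar>\<xi> i \<omega>\<bar> \<le> C)))"

definition simple_process ::
  "nat \<times> (nat \<Rightarrow> real) \<times> (nat \<Rightarrow> 'o \<Rightarrow> real) \<Rightarrow> real \<Rightarrow> 'o \<Rightarrow> real" where
  "simple_process = (\<lambda>(n, \<tau>, \<xi>) t \<omega>. \<Sum>i<n. \<xi> i \<omega> * indicator {\<tau> i<..\<tau> (Suc i)} t)"

definition simple_integral ::
  "(real \<Rightarrow> 'o \<Rightarrow> real) \<Rightarrow> nat \<times> (nat \<Rightarrow> real) \<times> (nat \<Rightarrow> 'o \<Rightarrow> real) \<Rightarrow> real \<Rightarrow> 'o \<Rightarrow> real" where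
  "simple_integral W = (\<lambda>(n, \<tau>, \<xi>) t \<omega>.
     \<Sum>i<n. \<xi> i \<omega> * (W (min t (\<tau> (Suc i))) \<omega> - W (min t (\<tau> i)) \<omega>))"

text \<open>
  \<open>I\<close> is a continuous version of \<open>\<integral> H dW\<close>: the limit, uniformly on compacts in probability, of the
  integrals of simple integrands that converge to \<open>H\<close> in \<open>L\<^sup>2[0,T]\<close> in probability for every \<open>T\<close>.
  This determines \<open>I\<close> up to indistinguishability.
\<close>

definition ito_integral ::
  "'o measure \<Rightarrow> (real \<Rightarrow> 'o measure) \<Rightarrow> (real \<Rightarrow> 'o \<Rightarrow> real) \<Rightarrow> (real \<Rightarrow> 'o \<Rightarrow> real)
     \<Rightarrow> (real \<Rightarrow> 'o \<Rightarrow> real) \<Rightarrow> bool" where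
  "ito_integral \<PP> F W H I \<longleftrightarrow>
     progressive F H \<and>
     (\<forall>T\<ge>0. AE \<omega> in \<PP>. (\<integral>\<^sup>+s\<in>{0..T}. ennreal ((H s \<omega>)\<^sup>2) \<partial>lborel) < \<infinity>) \<and>
     (\<forall>t\<ge>0. I t \<in> borel_measurable (F t)) \<and>
     (\<forall>\<omega>\<in>space \<PP>. continuous_on {0..} (\<lambda>t. I t \<omega>)) \<and>
     (\<exists>S :: nat \<Rightarrow> nat \<times> (nat \<Rightarrow> real) \<times> (nat \<Rightarrow> 'o \<Rightarrow> real).
        (\<forall>m. simple_integrand \<PP> F (S m)) \<and>
        (\<forall>T\<ge>0. \<forall>\<epsilon>>0.
           (\<lambda>m. measure \<PP> {\<omega>\<in>space \<PP>.
              ennreal \<epsilon> < (\<integral>\<^sup>+s\<in>{0..T}. ennreal ((simple_process (S m) s \<omega> - H s \<omega>)\<^sup>2) \<partial>lborel)})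
             \<longlonglongrightarrow> 0 \<and>
           (\<lambda>m. measure \<PP> {\<omega>\<in>space \<PP>.
              \<exists>t\<in>{0..T}. \<epsilon> < \<bar>simple_integral W (S m) t \<omega> - I t \<omega>\<bar>}) \<longlonglongrightarrow> 0))"


section \<open>Controls and coefficients\<close>

definition predictable_sigma :: "'o measure \<Rightarrow> (real \<Rightarrow> 'o measure) \<Rightarrow> (real \<times> 'o) measure" where
  "predictable_sigma \<PP> F =
     sigma ({0..} \<times> space \<PP>)
       ({{0} \<times> A | A. A \<in> sets (F 0)} \<union> {{s<..t} \<times> A | s t A. 0 \<le> s \<and> s < t \<and> A \<in> sets (F s)})"

text \<open>
  The constraints on a control do not involve the initial state, so the same set serves as
  \<open>\<A>\<^sub>H(k, p, y)\<close> for every starting point; the state enters only through the solution driven by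
  the control.
\<close>

definition admissible_controls ::
  "'o measure \<Rightarrow> (real \<Rightarrow> 'o measure) \<Rightarrow> (real \<times> real) set \<Rightarrow> (real \<Rightarrow> 'o \<Rightarrow> real \<times> real) set" where
  "admissible_controls \<PP> F act =
     {\<alpha>. (\<lambda>(t, \<omega>). \<alpha> t \<omega>) \<in> borel_measurable (predictable_sigma \<PP> F) \<and>
          (\<forall>t\<ge>0. \<forall>\<omega>\<in>space \<PP>. \<alpha> t \<omega> \<in> act) \<and>
          (\<integral>\<^sup>+\<omega>. (\<integral>\<^sup>+t\<in>{0..}. ennreal ((norm (\<alpha> t \<omega>))\<^sup>2) \<partial>lborel) \<partial>\<PP>) < \<infinity>}"

text \<open>Local Lipschitz continuity on \<open>X\<close>, with constants common to all members of the family \<open>\<F>\<close>.\<close>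

definition locally_lipschitz_family ::
  "'a::metric_space set \<Rightarrow> ('a \<Rightarrow> 'b::metric_space) set \<Rightarrow> bool" where
  "locally_lipschitz_family X \<F> \<longleftrightarrow>
     (\<forall>x\<in>X. \<exists>u>0. \<exists>L. \<forall>f\<in>\<F>. L-lipschitz_on (cball x u \<inter> X) f)"

definition intensity_coefficient :: "(real \<Rightarrow> real) \<Rightarrow> bool" where
  "intensity_coefficient \<mu> \<longleftrightarrow>
     (\<forall>p>0. 0 \<le> \<mu> p) \<and> locally_lipschitz_family {0<..} {\<mu>} \<and>
     (\<exists>L>0. \<forall>p>0. \<mu> p \<le> L * (1 + p))"

definition excitation_coefficient :: "'z measure \<Rightarrow> ('z \<Rightarrow> real) \<Rightarrow> bool" where
  "excitation_coefficient \<nu> a \<longleftrightarrow>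
     a \<in> borel_measurable \<nu> \<and> (\<forall>\<zeta>\<in>space \<nu>. 0 \<le> a \<zeta>) \<and>
     integrable \<nu> a \<and> integrable \<nu> (\<lambda>\<zeta>. (a \<zeta>)\<^sup>2)"

definition drift_coefficients ::
  "(real \<times> real) set \<Rightarrow> (real \<Rightarrow> real \<Rightarrow> real \<times> real \<Rightarrow> real)
     \<Rightarrow> (real \<Rightarrow> real \<Rightarrow> real \<times> real \<Rightarrow> real) \<Rightarrow> bool" where
  "drift_coefficients act bcap bpol \<longleftrightarrow>
     (\<forall>R>0. locally_lipschitz_family ({0<..} \<times> {0<..})
              {\<lambda>(k, p). bcap k p v | v. v \<in> act \<and> norm v \<le> R} \<and>
            locally_lipschitz_family ({0<..} \<times> {0<..})
              {\<lambda>(k, p). bpol k p v | v. v \<in> act \<and> norm v \<le> R}) \<and>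
     (\<exists>L>0. \<forall>k>0. \<forall>p>0. \<forall>(c, \<theta>)\<in>act.
        \<bar>bcap k p (c, \<theta>)\<bar> + \<bar>bpol k p (c, \<theta>)\<bar> \<le> L * (1 + k + p + c))"

definition damage_coefficient :: "'z measure \<Rightarrow> (real \<Rightarrow> real \<Rightarrow> 'z \<Rightarrow> real) \<Rightarrow> bool" where
  "damage_coefficient \<nu> om \<longleftrightarrow>
     (\<lambda>(k, p, \<zeta>). om k p \<zeta>) \<in> borel_measurable
        (restrict_space borel {0<..} \<Otimes>\<^sub>M (restrict_space borel {0<..} \<Otimes>\<^sub>M \<nu>)) \<and>
     (\<forall>k>0. \<forall>p>0. \<forall>\<zeta>\<in>space \<nu>. 0 < om k p \<zeta> \<and> om k p \<zeta> \<le> 1) \<and>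
     locally_lipschitz_family ({0<..} \<times> {0<..}) {\<lambda>(k, p). om k p \<zeta> | \<zeta>. \<zeta> \<in> space \<nu>}"

text \<open>
  The dynamics without jumps do not attain the boundary of the open quadrant in finite time: any
  continuous solution up to a finite stopping time \<open>\<tau>\<close> that stays in the open quadrant before
  \<open>\<tau>\<close> is almost surely still in it at \<open>\<tau>\<close>. Possibly infinite stopping times are covered by
  truncation at deterministic times.
\<close>

definition boundary_not_attained ::
  "'o measure \<Rightarrow> (real \<Rightarrow> 'o measure) \<Rightarrow> (real \<Rightarrow> 'o \<Rightarrow> real) \<Rightarrow> (real \<times> real) set
     \<Rightarrow> (real \<Rightarrow> real \<Rightarrow> real \<times> real \<Rightarrow> real) \<Rightarrow> (real \<Rightarrow> real \<Rightarrow> real \<times> real \<Rightarrow> real) \<Rightarrow> real \<Rightarrow> bool"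
  where
  "boundary_not_attained \<PP> F W act bcap bpol \<sigma> \<longleftrightarrow>
     (\<forall>k>0. \<forall>p>0. \<forall>\<alpha>\<in>admissible_controls \<PP> F act. \<forall>\<tau> K P I.
        stopping_time F \<tau> \<and> (\<forall>\<omega>\<in>space \<PP>. 0 \<le> \<tau> \<omega>) \<and>
        (\<forall>t\<ge>0. K t \<in> borel_measurable (F t) \<and> P t \<in> borel_measurable (F t)) \<and>
        (\<forall>\<omega>\<in>space \<PP>. continuous_on {0..} (\<lambda>t. K t \<omega>) \<and> continuous_on {0..} (\<lambda>t. P t \<omega>)) \<and>
        ito_integral \<PP> F W (\<lambda>t \<omega>. indicator {..\<tau> \<omega>} t * (\<sigma> * P t \<omega>)) I \<and>
        (AE \<omega> in \<PP>. (\<forall>t. 0 \<le> t \<and> t < \<tau> \<omega> \<longrightarrow> 0 < K t \<omega> \<and> 0 < P t \<omega>) \<and>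
           (\<forall>t\<in>{0..\<tau> \<omega>}.
              set_integrable lborel {0..t} (\<lambda>s. bcap (K s \<omega>) (P s \<omega>) (\<alpha> s \<omega>)) \<and>
              set_integrable lborel {0..t} (\<lambda>s. bpol (K s \<omega>) (P s \<omega>) (\<alpha> s \<omega>)) \<and>
              K t \<omega> = k + (LBINT s:{0..t}. bcap (K s \<omega>) (P s \<omega>) (\<alpha> s \<omega>)) \<and>
              P t \<omega> = p + (LBINT s:{0..t}. bpol (K s \<omega>) (P s \<omega>) (\<alpha> s \<omega>)) + I t \<omega>))
        \<longrightarrow> (AE \<omega> in \<PP>. 0 < K (\<tau> \<omega>) \<omega> \<and> 0 < P (\<tau> \<omega>) \<omega>))"


section \<open>Controlled Hawkes system\<close>

text \<open>
  The jump measure \<open>N(dt, d\<zeta>)\<close> for the sample point \<open>\<omega>\<close>: keep the atoms of \<open>M\<close> whose third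
  coordinate lies below \<open>\<mu>(P(t-)) + Y(t-)\<close>, then forget that coordinate.
\<close>

definition hawkes_jumps ::
  "'z measure \<Rightarrow> ('o \<Rightarrow> (real \<times> 'z \<times> real) measure) \<Rightarrow> (real \<Rightarrow> real)
     \<Rightarrow> (real \<Rightarrow> 'o \<Rightarrow> real) \<Rightarrow> (real \<Rightarrow> 'o \<Rightarrow> real) \<Rightarrow> 'o \<Rightarrow> (real \<times> 'z) measure" where
  "hawkes_jumps \<nu> M \<mu> P Y \<omega> =
     distr
       (density (M \<omega>) (\<lambda>(t, \<zeta>, r).
          indicator {..\<mu> (left_lim (\<lambda>s. P s \<omega>) t) + left_lim (\<lambda>s. Y s \<omega>) t} r))
       (restrict_space borel {0..} \<Otimes>\<^sub>M \<nu>)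
       (\<lambda>(t, \<zeta>, r). (t, \<zeta>))"

text \<open>
  \<open>e\<close> is the excitation function, i.e. the mark-dependent jump of \<open>Y\<close>. The equations at \<open>t = 0\<close>
  give the initial condition.
\<close>

definition strong_solution ::
  "'o measure \<Rightarrow> (real \<Rightarrow> 'o measure) \<Rightarrow> 'z measure \<Rightarrow> (real \<Rightarrow> 'o \<Rightarrow> real)
     \<Rightarrow> ('o \<Rightarrow> (real \<times> 'z \<times> real) measure)
     \<Rightarrow> (real \<Rightarrow> real \<Rightarrow> real \<times> real \<Rightarrow> real) \<Rightarrow> (real \<Rightarrow> real \<Rightarrow> real \<times> real \<Rightarrow> real)
     \<Rightarrow> (real \<Rightarrow> real \<Rightarrow> 'z \<Rightarrow> real) \<Rightarrow> real \<Rightarrow> real \<Rightarrow> (real \<Rightarrow> real) \<Rightarrow> ('z \<Rightarrow> real)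
     \<Rightarrow> (real \<Rightarrow> 'o \<Rightarrow> real \<times> real) \<Rightarrow> real \<Rightarrow> real \<Rightarrow> real
     \<Rightarrow> (real \<Rightarrow> 'o \<Rightarrow> real) \<Rightarrow> (real \<Rightarrow> 'o \<Rightarrow> real) \<Rightarrow> (real \<Rightarrow> 'o \<Rightarrow> real) \<Rightarrow> bool" where
  "strong_solution \<PP> F \<nu> W M bcap bpol om \<sigma> b \<mu> e \<alpha> k p y K P Y \<longleftrightarrow>
     (\<forall>t\<ge>0. K t \<in> borel_measurable (F t) \<and> P t \<in> borel_measurable (F t) \<and>
            Y t \<in> borel_measurable (F t)) \<and>
     (\<forall>\<omega>\<in>space \<PP>. cadlag (\<lambda>t. K t \<omega>) \<and> cadlag (\<lambda>t. P t \<omega>) \<and> cadlag (\<lambda>t. Y t \<omega>) \<and>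
        (\<forall>t\<ge>0. 0 < K t \<omega> \<and> 0 < P t \<omega> \<and> 0 \<le> Y t \<omega>)) \<and>
     (\<exists>I. ito_integral \<PP> F W (\<lambda>t \<omega>. \<sigma> * P t \<omega>) I \<and>
        (AE \<omega> in \<PP>. \<forall>t\<ge>0.
           (let N = hawkes_jumps \<nu> M \<mu> P Y \<omega>;
                J = (\<lambda>(s, \<zeta>). (1 - om (left_lim (\<lambda>u. K u \<omega>) s) (left_lim (\<lambda>u. P u \<omega>) s) \<zeta>)
                              * left_lim (\<lambda>u. K u \<omega>) s)
            in set_integrable lborel {0..t} (\<lambda>s. bcap (K s \<omega>) (P s \<omega>) (\<alpha> s \<omega>)) \<and>
               set_integrable lborel {0..t} (\<lambda>s. bpol (K s \<omega>) (P s \<omega>) (\<alpha> s \<omega>)) \<and>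
               set_integrable N ({0<..t} \<times> space \<nu>) J \<and>
               set_integrable N ({0<..t} \<times> space \<nu>) (\<lambda>(s, \<zeta>). e \<zeta>) \<and>
               K t \<omega> = k + (LBINT s:{0..t}. bcap (K s \<omega>) (P s \<omega>) (\<alpha> s \<omega>))
                         - (LINT x:({0<..t} \<times> space \<nu>)|N. J x) \<and>
               P t \<omega> = p + (LBINT s:{0..t}. bpol (K s \<omega>) (P s \<omega>) (\<alpha> s \<omega>)) + I t \<omega> \<and>
               Y t \<omega> = y - (LBINT s:{0..t}. b * Y s \<omega>)
                         + (LINT (s, \<zeta>):({0<..t} \<times> space \<nu>)|N. e \<zeta>))))"

definition unique_strong_solution where
  "unique_strong_solution \<PP> F \<nu> W M bcap bpol om \<sigma> b \<mu> e \<alpha> k p y K P Y \<longleftrightarrow>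
     strong_solution \<PP> F \<nu> W M bcap bpol om \<sigma> b \<mu> e \<alpha> k p y K P Y \<and>
     (\<forall>K' P' Y'. strong_solution \<PP> F \<nu> W M bcap bpol om \<sigma> b \<mu> e \<alpha> k p y K' P' Y' \<longrightarrow>
        (AE \<omega> in \<PP>. \<forall>t\<ge>0. K' t \<omega> = K t \<omega> \<and> P' t \<omega> = P t \<omega> \<and> Y' t \<omega> = Y t \<omega>))"

text \<open>\<open>\<EE>[\<integral>\<^sub>0\<^sup>\<infinity> exp (- \<rho> t) G\<^sub>t dt]\<close> in \<open>[0, \<infinity>]\<close>, for nonnegative \<open>G\<close>.\<close>

definition discounted_expectation :: "'o measure \<Rightarrow> real \<Rightarrow> (real \<Rightarrow> 'o \<Rightarrow> real) \<Rightarrow> ennreal" where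
  "discounted_expectation \<PP> \<rho> G =
     (\<integral>\<^sup>+\<omega>. (\<integral>\<^sup>+t\<in>{0..}. ennreal (exp (- \<rho> * t) * G t \<omega>) \<partial>lborel) \<partial>\<PP>)"

end

theory Submission
  imports Defs
begin

text \<open>
  The point is that \<open>\<EE>[Y\<^sub>t\<^sup>2]\<close> is of order \<open>\<eta>\<^sup>2\<close>; the claim then follows from
  \<open>Y G \<le> Y\<^sup>2 / (2 \<eta>) + \<eta> G\<^sup>2 / 2\<close> with \<open>G = 1 + K\<^sup>q + P\<^sup>q\<close>. Along almost every path the jump
  measure is finite and has at most one atom at each time, whence
  \<open>Y\<^sub>T\<^sup>2 + 2 b \<integral>\<^sub>0\<^sup>T Y\<^sup>2 dt \<le> y\<^sup>2 + \<integral> (2 Y\<^sub>t\<^sub>- \<eta> a + \<eta>\<^sup>2 a\<^sup>2) dN\<close>. Only an upper bound for the expectation of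
  the right-hand side is needed, so a full compensator formula can be avoided: replacing the
  predictable integrand and the intensity by their values at the left end point of a grid cell, the
  expectation factorises by the independence of the increments of \<open>M\<close>, and Fatou's lemma passes to the
  limit. Since \<open>\<eta>\<^sub>0 \<integral> a d\<nu> < b\<close>, the term \<open>2 b \<integral> Y\<^sup>2\<close> absorbs everything quadratic in \<open>Y\<close>, leaving
  \<open>\<EE>[Y\<^sub>T\<^sup>2] \<le> y\<^sup>2 + \<eta>\<^sup>2 C \<EE>[\<integral>\<^sub>0\<^sup>T (1 + \<mu>(P)\<^sup>2) dt]\<close>, and a Laplace transform in \<open>T\<close> gives the
  discounted estimate.
\<close>

section \<open>Poisson random measures\<close>

text \<open>Two obstacles shape the argument. The threshold below which atoms of \<open>M\<close>
  are kept is itself random, whereas independence only concerns sets fixed in advance; the intensity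
  is therefore rounded to an integer level, and splitting by that integer leaves countably many
  deterministic thresholds. The rounding goes upwards, because Fatou's lemma gives the right
  inequality only if the grid integrand eventually retains every atom of the true one. Secondly,
  \<mu> is controlled on the open half-line only, while a positive cadlag path may well have left
  limit 0. The almost sure continuity of \<open>P\<close> excludes this, so that the intensities at
  the grid points converge to the intensity just before s. The limit on the right stays finite
  because \<mu> grows linearly: the compensator of the square is then at most quadratic in P and Y,
  and the moments of the running supremum provide a majorant. The same moments make the expected
  integral of the square of Y finite, and only then may the absorbed term be subtracted from both
  sides.\<close>

lemma space_mark_intensity [simp]:
  "space (mark_intensity \<nu>) = {0..} \<times> (space \<nu> \<times> {0..})"
  by (simp add: mark_intensity_def space_pair_measure)

text \<open>Working in \<open>ennreal\<close> avoids integrability conditions on the two factors.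
  The past enters as a measure \<open>N\<close> with \<open>sets N \<subseteq> A\<close>, so that a
  member of the filtration can be inserted directly, while \<open>Z\<close> is tied to
  \<open>B\<close> through its preimages.\<close>

lemma indep_set_nn_integral_mult:
  fixes X Z :: "'a \<Rightarrow> ennreal"
  assumes M: "prob_space M" and ind: "prob_space.indep_set M A B"
    and spA: "space N = space M" "sets N \<subseteq> A" and X: "X \<in> borel_measurable N"
    and Z: "Z \<in> borel_measurable M" "\<And>C. C \<in> sets borel \<Longrightarrow> Z -` C \<inter> space M \<in> B"
    and B: "sigma_algebra (space M) B"
  shows "(\<integral>\<^sup>+\<omega>. X \<omega> * Z \<omega> \<partial>M) = (\<integral>\<^sup>+\<omega>. X \<omega> \<partial>M) * (\<integral>\<^sup>+\<omega>. Z \<omega> \<partial>M)"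
proof -
  interpret prob_space M by fact
  have NM: "sets N \<subseteq> sets M" using indep_setD_ev1[OF ind] spA by auto
  have XM: "X \<in> borel_measurable M"
    using measurable_mono[OF order_refl refl NM spA(1)] X by auto
  have "sigma_sets (space M) {X -` A \<inter> space M |A. A \<in> sets borel} \<subseteq> sets N"
    using sets.sigma_sets_subset[of "{X -` A \<inter> space M |A. A \<in> sets borel}" N] X spA
    by (auto simp: measurable_def)
  then have s1: "sigma_sets (space M) {X -` A \<inter> space M |A. A \<in> sets borel} \<subseteq> A" using spA by auto
  have s2: "sigma_sets (space M) {Z -` A \<inter> space M |A. A \<in> sets borel} \<subseteq> B"
    using sigma_algebra.sigma_sets_subset[OF B, of "{Z -` A \<inter> space M |A. A \<in> sets borel}"] Z by auto
  have "indep_set (sigma_sets (space M) {X -` A \<inter> space M |A. A \<in> sets borel})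
     (sigma_sets (space M) {Z -` A \<inter> space M |A. A \<in> sets borel})"
    unfolding indep_set_def
    by (rule indep_sets_mono_sets[OF ind[unfolded indep_set_def]]) (use s1 s2 in \<open>auto split: bool.split\<close>)
  then have "indep_var borel X borel Z" unfolding indep_var_eq using XM Z by auto
  then have iv: "indep_vars (\<lambda>_. borel) (case_bool X Z) UNIV"
    unfolding indep_var_def by (rule indep_vars_cong[THEN iffD1, rotated -1]) (auto split: bool.split)
  show ?thesis
    using indep_vars_nn_integral[OF _ iv] by (simp add: UNIV_bool mult.commute)
qed

text \<open>The given point masses already sum to 1, so \<open>N\<close> is almost surely a natural
  number and the value infinity carries no mass; the expectation is then the usual series.\<close>

lemma nn_integral_poisson:
  assumes M: "prob_space M" and N: "N \<in> borel_measurable M" and c: "0 \<le> c"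
    and p: "\<And>n::nat. measure M {\<omega>\<in>space M. N \<omega> = of_nat n} = exp (- c) * c ^ n / fact n"
  shows "(\<integral>\<^sup>+\<omega>. N \<omega> \<partial>M) = ennreal c"
proof -
  interpret prob_space M by fact
  let ?E = "\<lambda>n::nat. {\<omega>\<in>space M. N \<omega> = of_nat n}"
  have E: "?E n \<in> events" for n using N by measurable
  have dis: "disjoint_family ?E" by (auto simp: disjoint_family_on_def)
  have s1: "(\<lambda>n. prob (?E n)) sums prob (\<Union>n. ?E n)"
    using finite_measure_UNION[OF _ dis] E by auto
  have s2: "(\<lambda>n. prob (?E n)) sums (exp (-c) * exp c)"
    using sums_mult[OF exp_converges[of c], of "exp (-c)"] unfolding p
    by (simp add: field_simps scaleR_conv_of_real)
  have "prob (\<Union>n. ?E n) = 1" using sums_unique2[OF s1 s2] by (simp add: exp_minus)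
  then have "AE \<omega> in M. \<omega> \<in> (\<Union>n. ?E n)" using E by (subst (asm) prob_eq_1) auto
  then have "AE \<omega> in M. N \<omega> = (\<Sum>n. of_nat n * indicator (?E n) \<omega>)"
  proof eventually_elim
    case (elim \<omega>)
    then obtain m where m: "\<omega> \<in> ?E m" by auto
    have "(\<lambda>n. of_nat n * indicator (?E n) \<omega>) = (\<lambda>n. if n = m then of_nat m else (0::ennreal))"
      using m by (auto simp: fun_eq_iff)
    then show ?case using m sums_unique[OF sums_single[of m "\<lambda>_. of_nat m :: ennreal"]] by simp
  qed
  then have "(\<integral>\<^sup>+\<omega>. N \<omega> \<partial>M) = (\<integral>\<^sup>+\<omega>. (\<Sum>n. of_nat n * indicator (?E n) \<omega>) \<partial>M)"
    by (rule nn_integral_cong_AE)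
  also have "\<dots> = (\<Sum>n. \<integral>\<^sup>+\<omega>. of_nat n * indicator (?E n) \<omega> \<partial>M)"
    using E by (intro nn_integral_suminf) auto
  also have "\<dots> = (\<Sum>n. ennreal (real n * (exp (-c) * c ^ n / fact n)))"
  proof (intro suminf_cong)
    fix n
    have "(\<integral>\<^sup>+\<omega>. of_nat n * indicator (?E n) \<omega> \<partial>M) = of_nat n * ennreal (exp (-c) * c ^ n / fact n)"
      by (simp only: nn_integral_cmult_indicator[OF E] emeasure_eq_measure p)
    also have "\<dots> = ennreal (real n * (exp (-c) * c ^ n / fact n))"
      unfolding ennreal_of_nat_eq_real_of_nat using c by (intro ennreal_mult[symmetric]) auto
    finally show "(\<integral>\<^sup>+\<omega>. of_nat n * indicator (?E n) \<omega> \<partial>M)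
        = ennreal (real n * (exp (-c) * c ^ n / fact n))" .
  qed
  also have "\<dots> = ennreal c"
  proof -
    \<comment> \<open>Index shift: \<open>n * c ^ n / fact n\<close> is \<open>c\<close> times the
      preceding term of the exponential series, and the term at 0 vanishes.\<close>
    have "(\<lambda>n. c * exp (-c) * (c ^ n /\<^sub>R fact n)) sums (c * exp (-c) * exp c)"
      by (intro sums_mult exp_converges)
    also have "(\<lambda>n. c * exp (-c) * (c ^ n /\<^sub>R fact n)) =
        (\<lambda>n. real (Suc n) * (exp (-c) * c ^ Suc n / fact (Suc n)))"
    proof
      fix n
      have "real (Suc n) / fact (Suc n) = (1 / fact n :: real)"
        unfolding fact_Suc of_nat_mult by (simp del: of_nat_Suc)
      then have "exp (-c) * c ^ Suc n * (real (Suc n) / fact (Suc n)) = exp (-c) * c ^ Suc n * (1 / fact n)"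
        by (simp only:)
      then show "c * exp (-c) * (c ^ n /\<^sub>R fact n) = real (Suc n) * (exp (-c) * c ^ Suc n / fact (Suc n))"
        by (simp only: power_Suc divide_inverse real_scaleR_def mult_ac mult_1)
    qed
    also have "c * exp (-c) * exp c = c" by (simp add: exp_minus)
    finally have "(\<lambda>n. real (Suc n) * (exp (-c) * c ^ Suc n / fact (Suc n))) sums c" .
    then have "(\<lambda>n. real n * (exp (-c) * c ^ n / fact n)) sums c"
      by (subst (asm) sums_Suc_iff) simp
    then show ?thesis using c by (intro suminf_ennreal_eq) auto
  qed
  finally show ?thesis .
qed

text \<open>The bound follows from \<open>exp (-c) \<ge> 1 - c\<close>. It is quadratic in
  \<open>c\<close>, so that among n cells of mass c/n the probability that some cell holds two
  points is only of order 1/n.\<close>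

lemma (in prob_space) poisson_ge_2_prob_le:
  assumes N: "N \<in> borel_measurable M" and c: "0 \<le> c"
    and vals: "\<And>\<omega>. \<omega> \<in> space M \<Longrightarrow> N \<omega> = \<infinity> \<or> (\<exists>n::nat. N \<omega> = of_nat n)"
    and p: "\<And>n::nat. prob {\<omega>\<in>space M. N \<omega> = of_nat n} = exp (- c) * c ^ n / fact n"
  shows "prob {\<omega>\<in>space M. (1::ennreal) < N \<omega>} \<le> c\<^sup>2"
proof -
  let ?E = "\<lambda>n::nat. {\<omega>\<in>space M. N \<omega> = of_nat n}"
  have E: "?E n \<in> events" for n using N by measurable
  \<comment> \<open>Values are integers or infinity, hence exceeding 1 means missing both 0 and
    1.\<close>
  have "{\<omega>\<in>space M. (1::ennreal) < N \<omega>} = space M - (?E 0 \<union> ?E 1)"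
  proof (intro set_eqI iffI)
    fix \<omega> assume "\<omega> \<in> space M - (?E 0 \<union> ?E 1)"
    then show "\<omega> \<in> {\<omega>\<in>space M. (1::ennreal) < N \<omega>}" using vals[of \<omega>]
      by (auto simp: ennreal_of_nat_eq_real_of_nat one_less_numeral_iff)
  qed auto
  then have "prob {\<omega>\<in>space M. (1::ennreal) < N \<omega>} = 1 - prob (?E 0 \<union> ?E 1)"
    using E[of 0] E[of 1] by (simp add: prob_compl)
  also have "prob (?E 0 \<union> ?E 1) = prob (?E 0) + prob (?E 1)"
    using E[of 0] E[of 1] by (intro finite_measure_Union) auto
  also have "1 - \<dots> = 1 - exp (-c) * (1 + c)" using p[of 0] p[of 1] by (simp add: algebra_simps)
  also have "\<dots> \<le> 1 - (1 - c) * (1 + c)"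
    using exp_ge_add_one_self[of "-c"] c by (intro diff_left_mono mult_right_mono) auto
  finally show ?thesis by (simp add: power2_eq_square algebra_simps)
qed

text \<open>The threshold contributes the length of \<open>{0..R}\<close>, the third coordinate
  being nonnegative: thinning below level \<open>R\<close> multiplies the rate by
  \<open>R\<close>.\<close>

lemma nn_integral_mark_intensity:
  assumes \<nu>: "prob_space \<nu>" and S: "S \<in> sets borel" "S \<subseteq> {0..}"
    and g: "g \<in> borel_measurable \<nu>" and R: "0 \<le> R"
  shows "(\<integral>\<^sup>+(u,\<zeta>,r). indicator S u * g \<zeta> * indicator {..R} r \<partial>mark_intensity \<nu>)
    = emeasure lborel S * (\<integral>\<^sup>+\<zeta>. g \<zeta> \<partial>\<nu>) * ennreal R"
proof -
  let ?L = "restrict_space lborel {0::real..}"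
  interpret \<nu>: prob_space \<nu> by fact
  have sfL: "sigma_finite_measure ?L"
    by (rule sigma_finite_measure_restrict_space) (auto intro: lborel.sigma_finite_measure_axioms)
  interpret L: sigma_finite_measure ?L by (rule sfL)
  interpret VL: pair_sigma_finite \<nu> ?L ..
  have VLs: "sigma_finite_measure (\<nu> \<Otimes>\<^sub>M ?L)" ..
  interpret LVL: sigma_finite_measure "\<nu> \<Otimes>\<^sub>M ?L" by (rule VLs)
  have mS: "(\<lambda>u. indicator S u :: ennreal) \<in> borel_measurable ?L"
    using S by (intro measurable_restrict_space1) auto
  have mR: "(\<lambda>u. indicator {..R} u :: ennreal) \<in> borel_measurable ?L"
    by (intro measurable_restrict_space1) auto
  have "(\<integral>\<^sup>+(u,\<zeta>,r). indicator S u * g \<zeta> * indicator {..R} r \<partial>mark_intensity \<nu>)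
     = (\<integral>\<^sup>+u. \<integral>\<^sup>+(\<zeta>,r). indicator S u * g \<zeta> * indicator {..R} r \<partial>(\<nu> \<Otimes>\<^sub>M ?L) \<partial>?L)"
    unfolding mark_intensity_def using g mS mR
    by (subst sigma_finite_measure.nn_integral_fst[OF VLs, symmetric]) (auto simp: split_beta')
  also have "\<dots> = (\<integral>\<^sup>+u. \<integral>\<^sup>+\<zeta>. \<integral>\<^sup>+r. indicator S u * g \<zeta> * indicator {..R} r \<partial>?L \<partial>\<nu> \<partial>?L)"
    using g mS mR
    by (subst sigma_finite_measure.nn_integral_fst[OF sfL, symmetric]) (auto simp: split_beta')
  also have "\<dots> = (\<integral>\<^sup>+u. indicator S u \<partial>?L) * (\<integral>\<^sup>+\<zeta>. g \<zeta> \<partial>\<nu>) * (\<integral>\<^sup>+r. indicator {..R} r \<partial>?L)"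
    using g mS mR by (simp add: nn_integral_cmult nn_integral_multc mult.assoc)
  also have "(\<integral>\<^sup>+u. indicator S u \<partial>?L) = emeasure lborel S"
    using S by (subst nn_integral_restrict_space) (auto simp: indicator_inter_arith[symmetric] Int_absorb2)
  also have "(\<integral>\<^sup>+r. indicator {..R} r \<partial>?L) = ennreal R"
  proof -
    have "{..R} \<inter> {0..} = {0..R}" by auto
    then show ?thesis using R
      by (subst nn_integral_restrict_space) (auto simp: indicator_inter_arith[symmetric])
  qed
  finally show ?thesis .
qed

section \<open>Expectations of integrals over the future of the random measure\<close>

lemma sets_poisson:
  assumes "poisson_random_measure \<PP> F \<nu> M" "\<omega> \<in> space \<PP>"
  shows "sets (M \<omega>) = sets (mark_intensity \<nu>)" "space (M \<omega>) = {0..} \<times> (space \<nu> \<times> {0..})"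
  using assms sets_eq_imp_space_eq[of "M \<omega>" "mark_intensity \<nu>"]
  by (auto simp: poisson_random_measure_def)

text \<open>The definition of a Poisson random measure gives measurability in the sample point for
  the values on sets; induction over integrands carries it to integrals. All
  \<open>M \<omega>\<close> share the sigma-algebra of the intensity, so one \<open>f\<close> can be
  integrated against each of them.\<close>

lemma measurable_nn_integral_poisson:
  assumes prm: "poisson_random_measure \<PP> F \<nu> M"
    and f: "f \<in> borel_measurable (mark_intensity \<nu>)"
  shows "(\<lambda>\<omega>. \<integral>\<^sup>+x. f x \<partial>M \<omega>) \<in> borel_measurable \<PP>"
  using f
proof (induction rule: borel_measurable_induct)
  case (cong f g)
  have "(\<integral>\<^sup>+x. f x \<partial>M \<omega>) = (\<integral>\<^sup>+x. g x \<partial>M \<omega>)" if "\<omega> \<in> space \<PP>" for \<omega>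
    using cong(3) sets_poisson[OF prm that] by (intro nn_integral_cong) auto
  then show ?case using cong(4) by (simp cong: measurable_cong)
next
  case (set A)
  have "(\<integral>\<^sup>+x. indicator A x \<partial>M \<omega>) = emeasure (M \<omega>) A" if "\<omega> \<in> space \<PP>" for \<omega>
    using sets_poisson[OF prm that] set by simp
  then show ?case using prm set by (auto simp: poisson_random_measure_def cong: measurable_cong)
next
  case (mult u c)
  have "(\<integral>\<^sup>+x. c * u x \<partial>M \<omega>) = c * (\<integral>\<^sup>+x. u x \<partial>M \<omega>)" if "\<omega> \<in> space \<PP>" for \<omega>
    using sets_poisson[OF prm that] mult by (intro nn_integral_cmult) (simp cong: measurable_cong_sets)
  then show ?case using mult by (simp cong: measurable_cong)
next
  case (add u v)
  have "(\<integral>\<^sup>+x. v x + u x \<partial>M \<omega>) = (\<integral>\<^sup>+x. v x \<partial>M \<omega>) + (\<integral>\<^sup>+x. u x \<partial>M \<omega>)" if "\<omega> \<in> space \<PP>" for \<omega>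
    using sets_poisson[OF prm that] add by (intro nn_integral_add) (simp_all cong: measurable_cong_sets)
  then show ?case using add by (simp cong: measurable_cong)
next
  case (seq U)
  have "(\<integral>\<^sup>+x. (SUP i. U i) x \<partial>M \<omega>) = (SUP i. \<integral>\<^sup>+x. U i x \<partial>M \<omega>)" if "\<omega> \<in> space \<PP>" for \<omega>
    using sets_poisson[OF prm that] seq
    by (simp add: image_comp SUP_apply) (intro nn_integral_monotone_convergence_SUP, auto cong: measurable_cong_sets)
  then show ?case using seq by (simp cong: measurable_cong)
qed

text \<open>The Poisson law is specified for sets of finite mass, hence \<open>fin\<close>;
  independence of the past from the marks after \<open>s\<close> does the rest.\<close>

lemma nn_integral_poisson_future_emeasure:
  assumes prob: "prob_space \<PP>" and prm: "poisson_random_measure \<PP> F \<nu> M"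
    and spF: "space (F s) = space \<PP>" and s: "0 \<le> s"
    and X: "X \<in> borel_measurable (F s)"
    and B: "B \<in> sets (mark_intensity \<nu>)" "B \<subseteq> {s<..} \<times> UNIV" and fin: "emeasure (mark_intensity \<nu>) B < \<infinity>"
  shows "(\<integral>\<^sup>+\<omega>. X \<omega> * emeasure (M \<omega>) B \<partial>\<PP>) = (\<integral>\<^sup>+\<omega>. X \<omega> \<partial>\<PP>) * emeasure (mark_intensity \<nu>) B"
proof -
  have MB: "(\<lambda>\<omega>. emeasure (M \<omega>) B) \<in> borel_measurable \<PP>"
    using prm B by (auto simp: poisson_random_measure_def)
  have ev: "M_events \<PP> \<nu> M {s<..} \<subseteq> Pow (space \<PP>)" by (auto simp: M_events_def)
  have "(\<integral>\<^sup>+\<omega>. X \<omega> * emeasure (M \<omega>) B \<partial>\<PP>) = (\<integral>\<^sup>+\<omega>. X \<omega> \<partial>\<PP>) * (\<integral>\<^sup>+\<omega>. emeasure (M \<omega>) B \<partial>\<PP>)"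
  proof (rule indep_set_nn_integral_mult[OF prob _ spF order_refl X MB])
    show "prob_space.indep_set \<PP> (sets (F s)) (sigma_sets (space \<PP>) (M_events \<PP> \<nu> M {s<..}))"
      using prm s by (auto simp: poisson_random_measure_def)
    show "sigma_algebra (space \<PP>) (sigma_sets (space \<PP>) (M_events \<PP> \<nu> M {s<..}))"
      by (rule sigma_algebra_sigma_sets[OF ev])
    fix C :: "ennreal set" assume "C \<in> sets borel"
    then show "(\<lambda>\<omega>. emeasure (M \<omega>) B) -` C \<inter> space \<PP> \<in> sigma_sets (space \<PP>) (M_events \<PP> \<nu> M {s<..})"
      using B by (intro sigma_sets.Basic) (auto simp: M_events_def)
  qed
  also have "(\<integral>\<^sup>+\<omega>. emeasure (M \<omega>) B \<partial>\<PP>) = ennreal (measure (mark_intensity \<nu>) B)"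
    using prm B fin by (intro nn_integral_poisson[OF prob MB]) (auto simp: poisson_random_measure_def)
  also have "\<dots> = emeasure (mark_intensity \<nu>) B"
    using fin by (intro emeasure_eq_ennreal_measure[symmetric]) auto
  finally show ?thesis .
qed

text \<open>That \<open>F s\<close> consists of events of \<open>\<PP>\<close> is read off from the
  independence clause, since independent families are by definition families of events.\<close>

lemma measurable_from_filtration:
  assumes "prob_space \<PP>" "poisson_random_measure \<PP> F \<nu> M" "space (F s) = space \<PP>" "0 \<le> s"
    and "X \<in> measurable (F s) N"
  shows "X \<in> measurable \<PP> N"
proof -
  have "prob_space.indep_set \<PP> (sets (F s)) (sigma_sets (space \<PP>) (M_events \<PP> \<nu> M {s<..}))"
    using assms by (auto simp: poisson_random_measure_def)
  from prob_space.indep_setD_ev1[OF assms(1) this] have "sets (F s) \<subseteq> sets \<PP>" .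
  then show ?thesis using measurable_mono[OF order_refl refl _ assms(3)] assms(5) by auto
qed

text \<open>\<open>{s<..} \<times> UNIV\<close> sticks out of the space of the intensity; its trace
  on that space is the set whose indicator is measurable.\<close>

lemma future_strip_sets:
  "{0..} \<times> (space \<nu> \<times> {0..}) \<inter> {s<..} \<times> UNIV \<in> sets (mark_intensity \<nu>)"
proof -
  have "{0..} \<times> (space \<nu> \<times> {0..}) \<inter> {s<..} \<times> UNIV = ({0..} \<inter> {s<..}) \<times> space (\<nu> \<Otimes>\<^sub>M restrict_space lborel {0::real..})"
    by (auto simp: space_pair_measure)
  also have "\<dots> \<in> sets (mark_intensity \<nu>)" unfolding mark_intensity_def
    by (intro pair_measureI sets.top) (auto simp: sets_restrict_space)
  finally show ?thesis .
qed

text \<open>Exhaustion by boxes bounded in time and in level, which have finite intensity because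
  \<nu> is a probability measure.\<close>

lemma nn_integral_poisson_future_sets:
  assumes prob: "prob_space \<PP>" and \<nu>: "prob_space \<nu>" and prm: "poisson_random_measure \<PP> F \<nu> M"
    and spF: "space (F s) = space \<PP>" and s: "0 \<le> s"
    and X: "X \<in> borel_measurable (F s)"
    and B: "B \<in> sets (mark_intensity \<nu>)" "B \<subseteq> {s<..} \<times> UNIV"
  shows "(\<integral>\<^sup>+\<omega>. X \<omega> * emeasure (M \<omega>) B \<partial>\<PP>) = (\<integral>\<^sup>+\<omega>. X \<omega> \<partial>\<PP>) * emeasure (mark_intensity \<nu>) B"
proof -
  let ?box = "\<lambda>n::nat. {0..real n} \<times> (space \<nu> \<times> {0..real n})"
  have X': "X \<in> borel_measurable \<PP>" by (rule measurable_from_filtration[OF prob prm spF s X])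
  have box: "?box n \<in> sets (mark_intensity \<nu>)" for n
    unfolding mark_intensity_def by (intro pair_measureI sets.top) (auto simp: sets_restrict_space)
  have fin: "emeasure (mark_intensity \<nu>) (?box n) < \<infinity>" for n
  proof -
    have "emeasure (mark_intensity \<nu>) (?box n) = (\<integral>\<^sup>+x. indicator (?box n) x \<partial>mark_intensity \<nu>)"
      using box by simp
    also have "\<dots> = (\<integral>\<^sup>+(u,\<zeta>,r). indicator {0..real n} u * 1 * indicator {..real n} r \<partial>mark_intensity \<nu>)"
      by (intro nn_integral_cong) (auto simp: indicator_def split: if_splits)
    also have "\<dots> < \<infinity>" using \<nu>
      by (subst nn_integral_mark_intensity) (auto simp: prob_space.emeasure_space_1 ennreal_mult_less_top)
    finally show ?thesis .
  qed
  have inc: "incseq (\<lambda>n. B \<inter> ?box n)" by (auto simp: incseq_def)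
  have Bsub: "B \<subseteq> {0..} \<times> (space \<nu> \<times> {0..})" using sets.sets_into_space[OF B(1)] by simp
  have un: "(\<Union>n. B \<inter> ?box n) = B"
  proof (intro equalityI subsetI)
    fix x assume x: "x \<in> B"
    obtain u \<zeta> r where [simp]: "x = (u,\<zeta>,r)" by (cases x)
    obtain n :: nat where "max u r \<le> real n" using real_arch_simple by blast
    with x Bsub show "x \<in> (\<Union>n. B \<inter> ?box n)" by auto
  qed auto
  have Bn: "B \<inter> ?box n \<in> sets (mark_intensity \<nu>)" for n using B box by auto
  \<comment> \<open>Stated for any measure with the right sigma-algebra, as it is applied to each
    \<open>M \<omega>\<close> and to the intensity.\<close>
  have SM: "emeasure N B = (SUP n. emeasure N (B \<inter> ?box n))" if "sets N = sets (mark_intensity \<nu>)" for N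
    using SUP_emeasure_incseq[of "\<lambda>n. B \<inter> ?box n" N] inc Bn un that by (auto simp: image_subset_iff)
  have "(\<integral>\<^sup>+\<omega>. X \<omega> * emeasure (M \<omega>) B \<partial>\<PP>) = (\<integral>\<^sup>+\<omega>. (SUP n. X \<omega> * emeasure (M \<omega>) (B \<inter> ?box n)) \<partial>\<PP>)"
    using SM sets_poisson(1)[OF prm] by (intro nn_integral_cong) (simp add: SUP_mult_left_ennreal)
  also have "\<dots> = (SUP n. \<integral>\<^sup>+\<omega>. X \<omega> * emeasure (M \<omega>) (B \<inter> ?box n) \<partial>\<PP>)"
  proof (rule nn_integral_monotone_convergence_SUP_AE)
    show "AE x in \<PP>. X x * emeasure (M x) (B \<inter> ?box i) \<le> X x * emeasure (M x) (B \<inter> ?box (Suc i))" for i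
      using incseqD[OF inc, of i "Suc i"] Bn[of "Suc i"] sets_poisson(1)[OF prm]
      by (intro AE_I2 mult_left_mono emeasure_mono) (auto simp del: of_nat_Suc)
    show "(\<lambda>\<omega>. X \<omega> * emeasure (M \<omega>) (B \<inter> ?box i)) \<in> borel_measurable \<PP>" for i
      using prm Bn[of i] X' by (auto simp: poisson_random_measure_def)
  qed
  also have "\<dots> = (SUP n. (\<integral>\<^sup>+\<omega>. X \<omega> \<partial>\<PP>) * emeasure (mark_intensity \<nu>) (B \<inter> ?box n))"
  proof (intro SUP_cong refl nn_integral_poisson_future_emeasure[OF prob prm spF s X Bn])
    fix n show "B \<inter> ?box n \<subseteq> {s<..} \<times> UNIV" using B by auto
    have "emeasure (mark_intensity \<nu>) (B \<inter> ?box n) \<le> emeasure (mark_intensity \<nu>) (?box n)"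
      using box by (intro emeasure_mono) auto
    then show "emeasure (mark_intensity \<nu>) (B \<inter> ?box n) < \<infinity>" using fin[of n] by (rule le_less_trans)
  qed
  also have "\<dots> = (\<integral>\<^sup>+\<omega>. X \<omega> \<partial>\<PP>) * emeasure (mark_intensity \<nu>) B"
    using SM[of "mark_intensity \<nu>"] by (simp add: SUP_mult_left_ennreal)
  finally show ?thesis .
qed

text \<open>This is the compensator formula for an integrand frozen at time \<open>s\<close>: a
  factor known at \<open>s\<close> times a deterministic function of the later marks.\<close>

lemma nn_integral_poisson_future:
  assumes prob: "prob_space \<PP>" and \<nu>: "prob_space \<nu>" and prm: "poisson_random_measure \<PP> F \<nu> M"
    and spF: "space (F s) = space \<PP>" and s: "0 \<le> s"
    and X: "X \<in> borel_measurable (F s)"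
    and f: "f \<in> borel_measurable (mark_intensity \<nu>)"
  shows "(\<integral>\<^sup>+\<omega>. X \<omega> * (\<integral>\<^sup>+x. f x * indicator ({s<..} \<times> UNIV) x \<partial>M \<omega>) \<partial>\<PP>)
    = (\<integral>\<^sup>+\<omega>. X \<omega> \<partial>\<PP>) * (\<integral>\<^sup>+x. f x * indicator ({s<..} \<times> UNIV) x \<partial>mark_intensity \<nu>)"
proof -
  let ?S = "{0..} \<times> (space \<nu> \<times> {0..}) \<inter> {s<..} \<times> UNIV"
  have X'[measurable]: "X \<in> borel_measurable \<PP>" by (rule measurable_from_filtration[OF prob prm spF s X])
  have cM: "(\<integral>\<^sup>+x. f x * indicator ({s<..} \<times> UNIV) x \<partial>N) = (\<integral>\<^sup>+x. f x * indicator ?S x \<partial>N)"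
    if "sets N = sets (mark_intensity \<nu>)" for N f
    using sets_eq_imp_space_eq[OF that] by (intro nn_integral_cong) (auto split: split_indicator)
  let ?J = "\<lambda>f N. \<integral>\<^sup>+x. f x * indicator ?S x \<partial>N"
  note iS = borel_measurable_indicator[OF future_strip_sets, where ?'b = ennreal]
  have mN: "g \<in> borel_measurable N" if "sets N = sets (mark_intensity \<nu>)" "g \<in> borel_measurable (mark_intensity \<nu>)"
    for N and g :: "_ \<Rightarrow> ennreal"
    using that by (simp cong: measurable_cong_sets)
  note sM = sets_poisson(1)[OF prm]
  have ms: "(\<lambda>\<omega>. \<integral>\<^sup>+x. f x * indicator ?S x \<partial>M \<omega>) \<in> borel_measurable \<PP>"
    if "f \<in> borel_measurable (mark_intensity \<nu>)" for f
    by (intro measurable_nn_integral_poisson[OF prm] borel_measurable_times_ennreal that iS)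
  have "(\<integral>\<^sup>+\<omega>. X \<omega> * (?J f (M \<omega>)) \<partial>\<PP>)
    = (\<integral>\<^sup>+\<omega>. X \<omega> \<partial>\<PP>) * (?J f (mark_intensity \<nu>))"
    using f
  proof (induction rule: borel_measurable_induct)
    case (cong f g)
    have "(?J f N) = (\<integral>\<^sup>+x. g x * indicator ?S x \<partial>N)"
      if "sets N = sets (mark_intensity \<nu>)" for N
      using cong(3) sets_eq_imp_space_eq[OF that] by (intro nn_integral_cong) auto
    then show ?case using cong(4) sM by (simp cong: nn_integral_cong)
  next
    case (set A)
    have "(\<integral>\<^sup>+x. indicator A x * indicator ?S x \<partial>N) = emeasure N (A \<inter> ?S)"
      if "sets N = sets (mark_intensity \<nu>)" for N
      using sets.Int[OF set future_strip_sets] that by (simp only: indicator_inter_arith[symmetric] nn_integral_indicator)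
    moreover have "A \<inter> ?S \<in> sets (mark_intensity \<nu>)" using set future_strip_sets by (rule sets.Int)
    moreover have "A \<inter> ?S \<subseteq> {s<..} \<times> UNIV" by auto
    ultimately show ?case using sM nn_integral_poisson_future_sets[OF prob \<nu> prm spF s X, of "A \<inter> ?S"]
      by (simp cong: nn_integral_cong)
  next
    case (mult u c)
    have *: "(\<integral>\<^sup>+x. c * u x * indicator ?S x \<partial>N) = c * (?J u N)"
      if "sets N = sets (mark_intensity \<nu>)" for N
      unfolding mult.assoc using mult by (intro nn_integral_cmult mN[OF that] borel_measurable_times_ennreal iS)
    then have "(\<integral>\<^sup>+\<omega>. X \<omega> * (\<integral>\<^sup>+x. c * u x * indicator ?S x \<partial>M \<omega>) \<partial>\<PP>)
      = (\<integral>\<^sup>+\<omega>. c * (X \<omega> * (?J u (M \<omega>))) \<partial>\<PP>)"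
      using sM by (intro nn_integral_cong) (simp add: mult_ac)
    also have "\<dots> = c * (\<integral>\<^sup>+\<omega>. X \<omega> * (?J u (M \<omega>)) \<partial>\<PP>)"
      using ms[OF mult(2)] by (intro nn_integral_cmult borel_measurable_times_ennreal X')
    finally show ?case unfolding mult.IH *[OF refl] by (simp only: mult_ac)
  next
    case (add u v)
    have "(\<integral>\<^sup>+x. (v x + u x) * indicator ?S x \<partial>N) = (?J v N) + (?J u N)"
      if "sets N = sets (mark_intensity \<nu>)" for N
      unfolding distrib_right using add by (intro nn_integral_add mN[OF that] borel_measurable_times_ennreal iS)
    note * = this
    from * have "(\<integral>\<^sup>+\<omega>. X \<omega> * (\<integral>\<^sup>+x. (v x + u x) * indicator ?S x \<partial>M \<omega>) \<partial>\<PP>)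
      = (\<integral>\<^sup>+\<omega>. X \<omega> * (?J v (M \<omega>)) + X \<omega> * (?J u (M \<omega>)) \<partial>\<PP>)"
      using sM by (intro nn_integral_cong) (simp add: distrib_left)
    also have "\<dots> = (\<integral>\<^sup>+\<omega>. X \<omega> * (?J v (M \<omega>)) \<partial>\<PP>)
        + (\<integral>\<^sup>+\<omega>. X \<omega> * (?J u (M \<omega>)) \<partial>\<PP>)"
      using ms[OF \<open>u \<in> borel_measurable _\<close>] ms[OF \<open>v \<in> borel_measurable _\<close>] by (intro nn_integral_add borel_measurable_times_ennreal X')
    finally show ?case unfolding add.IH *[OF refl] distrib_left .
  next
    case (seq U)
    have *: "(\<integral>\<^sup>+x. (SUP i. U i) x * indicator ?S x \<partial>N) = (SUP i. \<integral>\<^sup>+x. U i x * indicator ?S x \<partial>N)"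
      if "sets N = sets (mark_intensity \<nu>)" for N
    proof -
      have "(\<integral>\<^sup>+x. (SUP i. U i) x * indicator ?S x \<partial>N) = (\<integral>\<^sup>+x. (SUP i. U i x * indicator ?S x) \<partial>N)"
        by (intro nn_integral_cong) (simp add: SUP_mult_right_ennreal image_comp)
      also have "\<dots> = (SUP i. \<integral>\<^sup>+x. U i x * indicator ?S x \<partial>N)"
      proof (intro nn_integral_monotone_convergence_SUP mN[OF that])
        show "incseq (\<lambda>i x. U i x * indicator ?S x)"
          using seq(3) by (auto simp: incseq_def le_fun_def intro!: mult_right_mono)
        show "(\<lambda>x. U i x * indicator ?S x) \<in> borel_measurable (mark_intensity \<nu>)" for i
          using seq(1)[of i] by (intro borel_measurable_times_ennreal iS)
      qed
      finally show ?thesis .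
    qed
    then have "(\<integral>\<^sup>+\<omega>. X \<omega> * (\<integral>\<^sup>+x. (SUP i. U i) x * indicator ?S x \<partial>M \<omega>) \<partial>\<PP>)
      = (\<integral>\<^sup>+\<omega>. (SUP i. X \<omega> * (?J (U i) (M \<omega>))) \<partial>\<PP>)"
      using sM by (intro nn_integral_cong) (simp add: SUP_mult_left_ennreal)
    also have "\<dots> = (SUP i. \<integral>\<^sup>+\<omega>. X \<omega> * (?J (U i) (M \<omega>)) \<partial>\<PP>)"
    proof (rule nn_integral_monotone_convergence_SUP)
      show "incseq (\<lambda>i \<omega>. X \<omega> * (?J (U i) (M \<omega>)))"
        using seq(3) by (auto simp: incseq_def le_fun_def intro!: mult_left_mono mult_right_mono nn_integral_mono)
      show "(\<lambda>\<omega>. X \<omega> * (?J (U i) (M \<omega>))) \<in> borel_measurable \<PP>" for i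
        using ms[OF seq(1)] by measurable
    qed
    finally show ?case unfolding *[OF refl] seq.IH SUP_mult_left_ennreal .
  qed
  then show ?thesis using cM sM by (simp cong: nn_integral_cong)
qed

lemma poisson_random_measureD:
  assumes "poisson_random_measure \<PP> F \<nu> M" "B \<in> sets (mark_intensity \<nu>)"
  shows "(\<lambda>\<omega>. emeasure (M \<omega>) B) \<in> borel_measurable \<PP>"
    and "\<omega> \<in> space \<PP> \<Longrightarrow> emeasure (M \<omega>) B = \<infinity> \<or> (\<exists>n::nat. emeasure (M \<omega>) B = of_nat n)"
    and "emeasure (mark_intensity \<nu>) B < \<infinity> \<Longrightarrow>
      measure \<PP> {\<omega>\<in>space \<PP>. emeasure (M \<omega>) B = of_nat m} =
        exp (- measure (mark_intensity \<nu>) B) * measure (mark_intensity \<nu>) B ^ m / fact m"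
proof -
  note * = assms(1)[unfolded poisson_random_measure_def]
  show "(\<lambda>\<omega>. emeasure (M \<omega>) B) \<in> borel_measurable \<PP>"
    using *[THEN conjunct2, THEN conjunct2, THEN conjunct1] assms(2) by blast
  show "emeasure (M \<omega>) B = \<infinity> \<or> (\<exists>n::nat. emeasure (M \<omega>) B = of_nat n)" if "\<omega> \<in> space \<PP>"
    using *[THEN conjunct2, THEN conjunct1] assms(2) that by blast
  show "measure \<PP> {\<omega>\<in>space \<PP>. emeasure (M \<omega>) B = of_nat m} =
        exp (- measure (mark_intensity \<nu>) B) * measure (mark_intensity \<nu>) B ^ m / fact m"
    if "emeasure (mark_intensity \<nu>) B < \<infinity>"
    using *[THEN conjunct2, THEN conjunct2, THEN conjunct2, THEN conjunct1] assms(2) that by blast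
qed

lemma mark_box_sets:
  assumes "S \<in> sets borel" "S \<subseteq> {0..}"
  shows "S \<times> (space \<nu> \<times> {0..R}) \<in> sets (mark_intensity \<nu>)"
  unfolding mark_intensity_def using assms
  by (intro pair_measureI sets.top) (auto simp: sets_restrict_space_iff)

lemma measurable_mark_box:
  assumes "S \<in> sets borel" "S \<subseteq> {0..}" "g \<in> borel_measurable \<nu>"
  shows "(\<lambda>(u,\<zeta>,r). indicator S u * g \<zeta> * indicator {..R} r :: ennreal) \<in> borel_measurable (mark_intensity \<nu>)"
proof -
  have "(\<lambda>u. indicator S u :: ennreal) \<in> borel_measurable (restrict_space lborel {0..})"
    using assms by (intro measurable_restrict_space1) auto
  moreover have "(\<lambda>r. indicator {..R} r :: ennreal) \<in> borel_measurable (restrict_space lborel {0..})"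
    by (intro measurable_restrict_space1) auto
  ultimately show ?thesis using assms(3) unfolding mark_intensity_def split_beta' by measurable
qed

text \<open>Here the level \<open>J\<close> may be random, provided it is known at time
  \<open>s\<close>. On the event \<open>J = j\<close> the threshold is the number \<open>j\<close>,
  and the indicator of this event joins the factor \<open>X\<close>, so the deterministic case
  applies to each of countably many \<open>j\<close>. This is the reason for integer levels.\<close>

lemma nn_integral_poisson_level:
  assumes prob: "prob_space \<PP>" and \<nu>: "prob_space \<nu>" and prm: "poisson_random_measure \<PP> F \<nu> M"
    and spF: "space (F s) = space \<PP>" and s: "0 \<le> s"
    and X: "X \<in> borel_measurable (F s)" and J: "J \<in> measurable (F s) (count_space (UNIV :: nat set))"
    and S: "S \<in> sets borel" "S \<subseteq> {s<..}" and g: "g \<in> borel_measurable \<nu>"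
  shows "(\<lambda>\<omega>. X \<omega> * (\<integral>\<^sup>+(u,\<zeta>,r). indicator S u * g \<zeta> * indicator {..real (J \<omega>)} r \<partial>M \<omega>)) \<in> borel_measurable \<PP>"
      (is "?meas")
    and "(\<integral>\<^sup>+\<omega>. X \<omega> * (\<integral>\<^sup>+(u,\<zeta>,r). indicator S u * g \<zeta> * indicator {..real (J \<omega>)} r \<partial>M \<omega>) \<partial>\<PP>)
      = (\<integral>\<^sup>+\<omega>. X \<omega> * of_nat (J \<omega>) \<partial>\<PP>) * emeasure lborel S * (\<integral>\<^sup>+\<zeta>. g \<zeta> \<partial>\<nu>)" (is "?eq")
proof -
  note [measurable] = X J
  have X'[measurable]: "X \<in> borel_measurable \<PP>" by (rule measurable_from_filtration[OF prob prm spF s X])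
  have J'[measurable]: "J \<in> measurable \<PP> (count_space UNIV)" by (rule measurable_from_filtration[OF prob prm spF s J])
  have S0: "S \<subseteq> {0..}" using S s by auto
  let ?f = "\<lambda>j::nat. \<lambda>(u,\<zeta>,r). indicator S u * g \<zeta> * indicator {..real j} r :: ennreal"
  note mf = measurable_mark_box[OF S(1) S0 g]
  have I[measurable]: "(\<lambda>\<omega>. \<integral>\<^sup>+x. ?f j x \<partial>M \<omega>) \<in> borel_measurable \<PP>" for j
    by (rule measurable_nn_integral_poisson[OF prm mf])
  have Ij[measurable]: "(\<lambda>\<omega>. \<integral>\<^sup>+x. ?f (J \<omega>) x \<partial>M \<omega>) \<in> borel_measurable \<PP>"
    by (rule measurable_compose_countable[OF I J'])
  show ?meas by measurable
  let ?X = "\<lambda>j \<omega>. X \<omega> * indicator {\<omega>. J \<omega> = j} \<omega>" and ?I = "\<lambda>j \<omega>. \<integral>\<^sup>+x. ?f j x \<partial>M \<omega>"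
  have "(\<integral>\<^sup>+\<omega>. X \<omega> * (\<integral>\<^sup>+x. ?f (J \<omega>) x \<partial>M \<omega>) \<partial>\<PP>)
      = (\<integral>\<^sup>+\<omega>. (\<Sum>j. ?X j \<omega> * ?I j \<omega>) \<partial>\<PP>)"
  proof (intro nn_integral_cong)
    fix \<omega>
    have "(\<lambda>j. ?X j \<omega> * ?I j \<omega>)
      = (\<lambda>j. if j = J \<omega> then X \<omega> * ?I j \<omega> else 0)" by (auto simp: fun_eq_iff)
    then show "X \<omega> * (\<integral>\<^sup>+x. ?f (J \<omega>) x \<partial>M \<omega>)
      = (\<Sum>j. ?X j \<omega> * ?I j \<omega>)"
      using sums_unique[OF sums_single[of "J \<omega>" "\<lambda>j. X \<omega> * ?I j \<omega>"]] by simp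
  qed
  also have "\<dots> = (\<Sum>j. \<integral>\<^sup>+\<omega>. ?X j \<omega> * ?I j \<omega> \<partial>\<PP>)"
    by (intro nn_integral_suminf) (use J' in measurable)
  also have "\<dots> = (\<Sum>j. (\<integral>\<^sup>+\<omega>. ?X j \<omega> \<partial>\<PP>) * (emeasure lborel S * (\<integral>\<^sup>+\<zeta>. g \<zeta> \<partial>\<nu>) * of_nat j))"
  proof (intro suminf_cong)
    fix j
    have eq: "?f j x = ?f j x * indicator ({s<..} \<times> UNIV) x" for x
      using S by (cases x) (auto simp: indicator_def)
    then have eqI: "(\<integral>\<^sup>+x. ?f j x \<partial>N) = (\<integral>\<^sup>+x. ?f j x * indicator ({s<..} \<times> UNIV) x \<partial>N)" for N
      by (rule nn_integral_cong)
    have "(\<integral>\<^sup>+\<omega>. ?X j \<omega> * ?I j \<omega> \<partial>\<PP>)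
      = (\<integral>\<^sup>+\<omega>. ?X j \<omega> * (\<integral>\<^sup>+x. ?f j x * indicator ({s<..} \<times> UNIV) x \<partial>M \<omega>) \<partial>\<PP>)"
      by (intro nn_integral_cong arg_cong2[where f="(*)"] refl eqI)
    also have "\<dots> = (\<integral>\<^sup>+\<omega>. ?X j \<omega> \<partial>\<PP>) * (\<integral>\<^sup>+x. ?f j x * indicator ({s<..} \<times> UNIV) x \<partial>mark_intensity \<nu>)"
      by (rule nn_integral_poisson_future[OF prob \<nu> prm spF s _ mf]) measurable
    also have "(\<integral>\<^sup>+x. ?f j x * indicator ({s<..} \<times> UNIV) x \<partial>mark_intensity \<nu>) = (\<integral>\<^sup>+x. ?f j x \<partial>mark_intensity \<nu>)"
      by (rule eqI[symmetric])
    also have "\<dots> = emeasure lborel S * (\<integral>\<^sup>+\<zeta>. g \<zeta> \<partial>\<nu>) * of_nat j"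
      using nn_integral_mark_intensity[OF \<nu> S(1) S0 g, of "real j"] by (simp add: ennreal_of_nat_eq_real_of_nat)
    finally show "(\<integral>\<^sup>+\<omega>. ?X j \<omega> * ?I j \<omega> \<partial>\<PP>)
      = (\<integral>\<^sup>+\<omega>. ?X j \<omega> \<partial>\<PP>) * (emeasure lborel S * (\<integral>\<^sup>+\<zeta>. g \<zeta> \<partial>\<nu>) * of_nat j)" .
  qed
  also have "\<dots> = (\<Sum>j. (\<integral>\<^sup>+\<omega>. ?X j \<omega> * of_nat j \<partial>\<PP>)) * (emeasure lborel S * (\<integral>\<^sup>+\<zeta>. g \<zeta> \<partial>\<nu>))"
  proof -
    have "(\<integral>\<^sup>+\<omega>. ?X j \<omega> * of_nat j \<partial>\<PP>) = (\<integral>\<^sup>+\<omega>. ?X j \<omega> \<partial>\<PP>) * of_nat j" for j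
      by (rule nn_integral_multc) measurable
    then show ?thesis by (simp only: ennreal_suminf_multc[symmetric]) (simp only: mult_ac)
  qed
  also have "(\<Sum>j. (\<integral>\<^sup>+\<omega>. ?X j \<omega> * of_nat j \<partial>\<PP>)) = (\<integral>\<^sup>+\<omega>. (\<Sum>j. ?X j \<omega> * of_nat j) \<partial>\<PP>)"
    by (intro nn_integral_suminf[symmetric]) measurable
  also have "\<dots> = (\<integral>\<^sup>+\<omega>. X \<omega> * of_nat (J \<omega>) \<partial>\<PP>)"
  proof (intro nn_integral_cong)
    fix \<omega>
    have "(\<lambda>j. ?X j \<omega> * of_nat j) = (\<lambda>j. if j = J \<omega> then X \<omega> * of_nat j else 0)"
      by (auto simp: fun_eq_iff)
    then show "(\<Sum>j. ?X j \<omega> * of_nat j) = X \<omega> * of_nat (J \<omega>)"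
      using sums_unique[OF sums_single[of "J \<omega>" "\<lambda>j. X \<omega> * of_nat j"]] by simp
  qed
  finally show ?eq by (simp only: mult.assoc)
qed

text \<open>Cut (0,T] into n + 1 equal cells. Two atoms at one time force some cell to hold two, an
  event of probability at most (n + 1) (T R / (n + 1))^2, which tends to 0. Measurability of the
  union over uncountably many \<open>s\<close> is never at issue, since that union lies in the null
  set \<open>\<Inter>n. ?E n\<close>.\<close>

lemma AE_poisson_no_simultaneous_atoms_bounded:
  assumes prob: "prob_space \<PP>" and \<nu>: "prob_space \<nu>" and prm: "poisson_random_measure \<PP> F \<nu> M"
    and T: "0 \<le> T" and R: "0 \<le> R"
  shows "AE \<omega> in \<PP>. \<forall>s. 0 < s \<and> s \<le> T \<longrightarrow> emeasure (M \<omega>) ({s} \<times> (space \<nu> \<times> {0..R})) \<le> 1"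
proof -
  interpret prob_space \<PP> by fact
  let ?I = "\<lambda>n i. {real i * T / real (Suc n)<..real (Suc i) * T / real (Suc n)}"
  let ?B = "\<lambda>n i. ?I n i \<times> (space \<nu> \<times> {0..R})"
  define A where "A n i = {\<omega>\<in>space \<PP>. (1::ennreal) < emeasure (M \<omega>) (?B n i)}" for n i
  let ?E = "\<lambda>n. \<Union>i\<le>n. A n i"
  have sub: "(?I n i) \<subseteq> {0..}" for n i
  proof -
    have "0 \<le> real i * T / real (Suc n)" using T by simp
    then show ?thesis by (meson atLeast_iff greaterThanAtMost_iff less_imp_le order_trans subsetI)
  qed
  have bs: "?B n i \<in> sets (mark_intensity \<nu>)" for n i
    using sub by (intro mark_box_sets) auto
  have em: "emeasure (mark_intensity \<nu>) (?B n i) = ennreal (T * R / real (Suc n))" for n i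
  proof -
    have "real i * T / real (Suc n) \<le> real (Suc i) * T / real (Suc n)"
      using T by (intro divide_right_mono mult_right_mono) auto
    then have len: "emeasure lborel (?I n i) = ennreal (T / real (Suc n))"
      by (simp add: diff_divide_distrib[symmetric] algebra_simps)
    have "emeasure (mark_intensity \<nu>) (?B n i) = (\<integral>\<^sup>+x. indicator (?B n i) x \<partial>mark_intensity \<nu>)"
      using bs by simp
    also have "\<dots> = (\<integral>\<^sup>+(u,\<zeta>,r). indicator (?I n i) u * 1 * indicator {..R} r \<partial>mark_intensity \<nu>)"
      by (intro nn_integral_cong) (auto simp: indicator_def split: if_splits)
    also have "\<dots> = ennreal (T / real (Suc n)) * (\<integral>\<^sup>+\<zeta>. 1 \<partial>\<nu>) * ennreal R"
      unfolding len[symmetric] using R by (intro nn_integral_mark_intensity[OF \<nu> _ sub]) auto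
    also have "\<dots> = ennreal (T * R / real (Suc n))"
      using \<nu> T R by (simp add: prob_space.emeasure_space_1 ennreal_mult[symmetric])
    finally show ?thesis .
  qed
  have mE: "A n i \<in> events" for n i
  proof -
    have "(\<lambda>\<omega>. emeasure (M \<omega>) (?B n i)) \<in> borel_measurable \<PP>"
      by (rule poisson_random_measureD(1)[OF prm bs])
    then show ?thesis unfolding A_def by measurable
  qed
  have pE: "prob (A n i) \<le> (T * R / real (Suc n))\<^sup>2" for n i
  unfolding A_def
  proof (rule poisson_ge_2_prob_le)
    have me: "measure (mark_intensity \<nu>) (?B n i) = T * R / real (Suc n)"
      unfolding measure_def em using T R by (intro enn2real_ennreal) simp
    show "(\<lambda>\<omega>. emeasure (M \<omega>) (?B n i)) \<in> borel_measurable \<PP>"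
      by (rule poisson_random_measureD(1)[OF prm bs])
    show "emeasure (M \<omega>) (?B n i) = \<infinity> \<or> (\<exists>m::nat. emeasure (M \<omega>) (?B n i) = of_nat m)" if "\<omega> \<in> space \<PP>" for \<omega>
      by (rule poisson_random_measureD(2)[OF prm bs that])
    have "emeasure (mark_intensity \<nu>) (?B n i) < \<infinity>" unfolding em by simp
    then have "prob {\<omega> \<in> space \<PP>. emeasure (M \<omega>) (?B n i) = of_nat m}
       = exp (- measure (mark_intensity \<nu>) (?B n i)) * measure (mark_intensity \<nu>) (?B n i) ^ m / fact m" for m
      by (rule poisson_random_measureD(3)[OF prm bs])
    then show "prob {\<omega> \<in> space \<PP>. emeasure (M \<omega>) (?B n i) = of_nat m}
       = exp (- (T * R / real (Suc n))) * (T * R / real (Suc n)) ^ m / fact m" for m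
      unfolding me .
  qed (use T R in auto)
  have E: "?E n \<in> events" for n using mE by auto
  have le: "prob (\<Inter>n. ?E n) \<le> (T * R)\<^sup>2 / real (Suc n)" for n
  proof -
    have "prob (\<Inter>n. ?E n) \<le> prob (?E n)" using E by (intro finite_measure_mono) auto
    also have "\<dots> \<le> (\<Sum>i\<le>n. prob (A n i))"
      by (intro finite_measure_subadditive_finite image_subsetI mE) simp
    also have "\<dots> \<le> (\<Sum>i\<le>n. (T * R / real (Suc n))\<^sup>2)" by (intro sum_mono pE)
    also have "\<dots> = (T * R)\<^sup>2 / real (Suc n)"
      by (simp add: power_divide power2_eq_square)
    finally show ?thesis .
  qed
  have "(\<lambda>n. (T * R)\<^sup>2 / real (Suc n)) \<longlonglongrightarrow> 0"
    using LIMSEQ_Suc[OF lim_const_over_n[of "(T * R)\<^sup>2"]] .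
  then have "prob (\<Inter>n. ?E n) \<le> 0" by (rule LIMSEQ_le_const) (use le in blast)
  then have "prob (\<Inter>n. ?E n) = 0" using measure_nonneg by (rule order_antisym)
  then have "emeasure \<PP> (\<Inter>n. ?E n) = 0" by (simp add: emeasure_eq_measure)
  then have null: "(\<Inter>n. ?E n) \<in> null_sets \<PP>" using E by (intro null_setsI) auto
  show ?thesis
  proof (rule AE_I'[OF null], intro subsetI)
    fix \<omega> assume "\<omega> \<in> {\<omega>\<in>space \<PP>. \<not> (\<forall>s. 0 < s \<and> s \<le> T \<longrightarrow> emeasure (M \<omega>) ({s} \<times> (space \<nu> \<times> {0..R})) \<le> 1)}"
    then obtain s where \<omega>: "\<omega> \<in> space \<PP>" and s: "0 < s" "s \<le> T"
      and gt: "1 < emeasure (M \<omega>) ({s} \<times> (space \<nu> \<times> {0..R}))" by (auto simp: not_le)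
    show "\<omega> \<in> (\<Inter>n. ?E n)"
    proof
      fix n
      have T': "0 < T" using s by simp
      \<comment> \<open>Cells are open on the left and closed on the right, so the one containing
        \<open>s\<close> has the ceiling minus 1 as its index.\<close>
      define i where "i = nat (\<lceil>s * real (Suc n) / T\<rceil> - 1)"
      have x: "0 < s * real (Suc n) / T" "s * real (Suc n) / T \<le> real (Suc n)"
        using s T' by (auto simp: divide_simps mult_right_mono)
      have ii: "real i < s * real (Suc n) / T" "s * real (Suc n) / T \<le> real (Suc i)"
        using x unfolding i_def by linarith+
      have "i \<le> n" using ii(1) x(2) by linarith
      moreover have "{s} \<times> (space \<nu> \<times> {0..R}) \<subseteq> ?B n i"
      proof -
        have "real i * T / real (Suc n) < s" "s \<le> real (Suc i) * T / real (Suc n)"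
          using ii T' by (simp_all add: pos_less_divide_eq pos_divide_less_eq pos_le_divide_eq pos_divide_le_eq del: of_nat_Suc)
        then show ?thesis by auto
      qed
      then have "emeasure (M \<omega>) ({s} \<times> (space \<nu> \<times> {0..R})) \<le> emeasure (M \<omega>) (?B n i)"
        using bs unfolding sets_poisson(1)[OF prm \<omega>, symmetric] by (intro emeasure_mono)
      with gt have "1 < emeasure (M \<omega>) (?B n i)" by (rule less_le_trans)
      with \<omega> have "\<omega> \<in> A n i" unfolding A_def by blast
      ultimately show "\<omega> \<in> ?E n" by blast
    qed
  qed
qed

text \<open>Horizon and level run over the natural numbers, which keeps the exceptional sets
  countable in number; monotonicity in the level recovers real \<open>r\<close>.\<close>

lemma AE_poisson_no_simultaneous_atoms:
  assumes prob: "prob_space \<PP>" and \<nu>: "prob_space \<nu>" and prm: "poisson_random_measure \<PP> F \<nu> M"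
  shows "AE \<omega> in \<PP>. \<forall>s>0. \<forall>r. emeasure (M \<omega>) ({s} \<times> (space \<nu> \<times> {0..r})) \<le> 1"
proof -
  have "AE \<omega> in \<PP>. \<forall>T R. \<forall>s. 0 < s \<and> s \<le> real T \<longrightarrow> emeasure (M \<omega>) ({s} \<times> (space \<nu> \<times> {0..real R})) \<le> 1"
    unfolding AE_all_countable by (intro allI AE_poisson_no_simultaneous_atoms_bounded[OF assms]) simp_all
  then show ?thesis
    using AE_space
  proof eventually_elim
    case (elim \<omega>)
    show ?case
    proof (intro allI impI)
      fix s r :: real assume s: "0 < s"
      have m: "{s} \<times> (space \<nu> \<times> {0..real R}) \<in> sets (M \<omega>)" for R
        unfolding sets_poisson[OF prm elim(2)] using s by (intro mark_box_sets) auto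
      obtain T :: nat where "s \<le> real T" using real_arch_simple by blast
      moreover obtain R :: nat where "r \<le> real R" using real_arch_simple by blast
      then have "emeasure (M \<omega>) ({s} \<times> (space \<nu> \<times> {0..r})) \<le> emeasure (M \<omega>) ({s} \<times> (space \<nu> \<times> {0..real R}))"
        by (intro emeasure_mono[OF _ m] Sigma_mono) auto
      moreover have "emeasure (M \<omega>) ({s} \<times> (space \<nu> \<times> {0..real R})) \<le> 1"
        using elim(1) s \<open>s \<le> real T\<close> by blast
      ultimately show "emeasure (M \<omega>) ({s} \<times> (space \<nu> \<times> {0..r})) \<le> 1"
        by (metis order_trans)
    qed
  qed
qed

section \<open>Paths of finite variation\<close>

text \<open>Integration by parts for functions of finite variation: the plane of pairs of times is
  cut along \<open>\<tau>2 \<le> \<tau>1\<close> and its complement. Ties go to the first summand,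
  so there the inner factor is evaluated at the current time and in the second summand just before
  it.\<close>

lemma integral_mult_time_split:
  fixes u1 :: "'a \<Rightarrow> real" and u2 :: "'b \<Rightarrow> real"
  assumes sf: "sigma_finite_measure M1" "sigma_finite_measure M2"
    and i1: "integrable M1 u1" and i2: "integrable M2 u2"
    and [measurable]: "\<tau>1 \<in> borel_measurable M1" "\<tau>2 \<in> borel_measurable M2"
  shows "integrable M1 (\<lambda>x. u1 x * (\<integral>x'. u2 x' * of_bool (\<tau>2 x' \<le> (\<tau>1 x :: real)) \<partial>M2))" (is "?i1")
    and "integrable M2 (\<lambda>x'. u2 x' * (\<integral>x. u1 x * of_bool (\<tau>1 x < \<tau>2 x') \<partial>M1))" (is "?i2")
    and "(\<integral>x. u1 x \<partial>M1) * (\<integral>x'. u2 x' \<partial>M2) =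
      (\<integral>x. u1 x * (\<integral>x'. u2 x' * of_bool (\<tau>2 x' \<le> \<tau>1 x) \<partial>M2) \<partial>M1) +
      (\<integral>x'. u2 x' * (\<integral>x. u1 x * of_bool (\<tau>1 x < \<tau>2 x') \<partial>M1) \<partial>M2)" (is "?eq")
proof -
  interpret pair_sigma_finite M1 M2 using sf by (simp add: pair_sigma_finite_def)
  note [measurable] = borel_measurable_integrable[OF i1] borel_measurable_integrable[OF i2]
  have I: "integrable (M1 \<Otimes>\<^sub>M M2) (\<lambda>(x,x'). u1 x * u2 x')"
  proof (rule Fubini_integrable)
    show "integrable M1 (\<lambda>x. \<integral>y. norm (case (x, y) of (x,x') \<Rightarrow> u1 x * u2 x') \<partial>M2)"
      using i1 i2 by (simp add: abs_mult)
    show "AE x in M1. integrable M2 (\<lambda>y. case (x, y) of (x,x') \<Rightarrow> u1 x * u2 x')"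
      using i2 by simp
  qed measurable
  have Ia: "integrable (M1 \<Otimes>\<^sub>M M2) (\<lambda>(x,x'). u1 x * u2 x' * of_bool (\<tau>2 x' \<le> \<tau>1 x))"
    by (rule Bochner_Integration.integrable_bound[OF I]) (auto simp: of_bool_def)
  have Ib: "integrable (M1 \<Otimes>\<^sub>M M2) (\<lambda>(x,x'). u1 x * u2 x' * of_bool (\<tau>1 x < \<tau>2 x'))"
    by (rule Bochner_Integration.integrable_bound[OF I]) (auto simp: of_bool_def)
  have e1: "(\<integral>x'. u1 x * u2 x' * of_bool (\<tau>2 x' \<le> \<tau>1 x) \<partial>M2) = u1 x * (\<integral>x'. u2 x' * of_bool (\<tau>2 x' \<le> \<tau>1 x) \<partial>M2)" for x
    by (simp add: mult.assoc)
  have e2: "(\<integral>x. u1 x * u2 x' * of_bool (\<tau>1 x < \<tau>2 x') \<partial>M1) = u2 x' * (\<integral>x. u1 x * of_bool (\<tau>1 x < \<tau>2 x') \<partial>M1)" for x'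
    by (simp add: mult.assoc mult.left_commute[of "u1 _"])
  show ?i1 using integrable_fst[OF Ia] unfolding e1 .
  show ?i2 using integrable_snd[OF Ib] unfolding e2 .
  have "(\<integral>x. u1 x \<partial>M1) * (\<integral>x'. u2 x' \<partial>M2) = (\<integral>x. \<integral>x'. u1 x * u2 x' \<partial>M2 \<partial>M1)" by simp
  also have "\<dots> = (\<integral>z. (case z of (x,x') \<Rightarrow> u1 x * u2 x') \<partial>(M1 \<Otimes>\<^sub>M M2))"
    by (rule integral_fst[OF I])
  also have "\<dots> = (\<integral>z. (case z of (x,x') \<Rightarrow> u1 x * u2 x' * of_bool (\<tau>2 x' \<le> \<tau>1 x))
      + (case z of (x,x') \<Rightarrow> u1 x * u2 x' * of_bool (\<tau>1 x < \<tau>2 x')) \<partial>(M1 \<Otimes>\<^sub>M M2))"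
    by (intro Bochner_Integration.integral_cong) auto
  also have "\<dots> = (\<integral>x. \<integral>x'. u1 x * u2 x' * of_bool (\<tau>2 x' \<le> \<tau>1 x) \<partial>M2 \<partial>M1)
      + (\<integral>x'. \<integral>x. u1 x * u2 x' * of_bool (\<tau>1 x < \<tau>2 x') \<partial>M1 \<partial>M2)"
    using Bochner_Integration.integral_add[OF Ia Ib] integral_fst[OF Ia] integral_snd[OF Ib] by simp
  finally show ?eq unfolding e1 e2 .
qed

text \<open>Approached from the left, mass sitting at time \<open>s\<close> is never counted, whence
  the strict inequality in the limit. Passing to sequences makes dominated convergence
  applicable.\<close>

lemma tendsto_at_left_integral_le:
  fixes f :: "'a \<Rightarrow> real" and \<tau> :: "'a \<Rightarrow> real"
  assumes f: "integrable N f" and [measurable]: "\<tau> \<in> borel_measurable N"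
  shows "((\<lambda>t. \<integral>x. f x * of_bool (\<tau> x \<le> t) \<partial>N) \<longlongrightarrow> (\<integral>x. f x * of_bool (\<tau> x < s) \<partial>N)) (at_left s)"
proof (rule tendsto_at_left_sequentially[of "s - 1"])
  fix S :: "nat \<Rightarrow> real" assume S: "\<And>n. S n < s" "S \<longlonglongrightarrow> s"
  note [measurable] = borel_measurable_integrable[OF f]
  show "(\<lambda>n. \<integral>x. f x * of_bool (\<tau> x \<le> S n) \<partial>N) \<longlonglongrightarrow> (\<integral>x. f x * of_bool (\<tau> x < s) \<partial>N)"
  proof (rule integral_dominated_convergence[where w="\<lambda>x. norm (f x)"])
    show "AE x in N. (\<lambda>n. f x * of_bool (\<tau> x \<le> S n)) \<longlonglongrightarrow> f x * of_bool (\<tau> x < s)"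
    proof (intro AE_I2 tendsto_mult_left tendsto_eventually)
      fix x
      show "\<forall>\<^sub>F n in sequentially. of_bool (\<tau> x \<le> S n) = (of_bool (\<tau> x < s) :: real)"
      proof (cases "\<tau> x < s")
        case True
        from order_tendstoD(1)[OF S(2) True] show ?thesis by eventually_elim (use True in auto)
      next
        case False
        have "\<not> \<tau> x \<le> S n" for n using S(1)[of n] False by linarith
          with False show ?thesis by simp
      qed
    qed
  qed (use f in auto)
qed simp

text \<open>Truncation of negative numbers at 0 makes \<open>ennreal\<close> subadditive for
  arbitrary signs.\<close>

lemma ennreal_plus_le: "ennreal (x + y) \<le> ennreal x + ennreal y"
  by (cases "0 \<le> x"; cases "0 \<le> y")
    (auto simp: ennreal_neg add_nonpos_nonpos intro!: ennreal_leI simp flip: ennreal_plus)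

text \<open>\<open>Y\<^sup>2\<close> is a double integral over pairs of times, split according to which time comes first.\<close>

lemma square_path_le:
  fixes T y :: real and v Y :: "real \<Rightarrow> real" and \<tau> e :: "'a \<Rightarrow> real"
  assumes Q: "finite_measure Q" and [measurable]: "\<tau> \<in> borel_measurable Q"
    and e: "integrable Q e" "\<And>x. x \<in> space Q \<Longrightarrow> 0 \<le> e x"
    and \<tau>: "\<And>x. x \<in> space Q \<Longrightarrow> 0 < \<tau> x \<and> \<tau> x \<le> T"
    and one: "\<And>s. 0 < s \<Longrightarrow> emeasure Q {x\<in>space Q. \<tau> x = s} \<le> 1"
    and v: "set_integrable lborel {0..T} v" and T: "0 \<le> T"
    and Y: "\<And>t. 0 \<le> t \<Longrightarrow> t \<le> T \<Longrightarrow> Y t = y - (LBINT s:{0..t}. v s) + (\<integral>x. e x * of_bool (\<tau> x \<le> t) \<partial>Q)"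
  defines "Ym \<equiv> \<lambda>t. y - (LBINT s:{0..t}. v s) + (\<integral>x. e x * of_bool (\<tau> x < t) \<partial>Q)"
  assumes Ym: "\<And>s. 0 < s \<Longrightarrow> s \<le> T \<Longrightarrow> 0 \<le> Ym s"
  shows "ennreal ((Y T)\<^sup>2 + 2 * (LBINT s:{0..T}. v s * Y s))
    \<le> ennreal (y\<^sup>2) + (\<integral>\<^sup>+x. ennreal (2 * e x * Ym (\<tau> x) + (e x)\<^sup>2) \<partial>Q)"
proof -
  interpret Q: finite_measure Q by fact
  note [measurable] = borel_measurable_integrable[OF e(1)]
  define u where "u s = v s * indicator {0..T} s" for s
  have u: "integrable lborel u" using v by (simp add: u_def[abs_def] set_integrable_def mult.commute)
  note [measurable] = borel_measurable_integrable[OF u]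
  define D where "D t = (LBINT s:{0..t}. v s)" for t
  define A where "A t = (\<integral>x. e x * of_bool (\<tau> x \<le> t) \<partial>Q)" for t
  define Am where "Am t = (\<integral>x. e x * of_bool (\<tau> x < t) \<partial>Q)" for t
  have D: "D t = (\<integral>s. u s * of_bool (s \<le> t) \<partial>lborel)" if "t \<le> T" for t
    unfolding D_def u_def set_lebesgue_integral_def using that
    by (intro Bochner_Integration.integral_cong) (auto split: split_indicator)
  \<comment> \<open>Single times are Lebesgue-null, so the drift part does not distinguish the
    strict from the non-strict cut.\<close>
  have D': "D t = (\<integral>s. u s * of_bool (s < t) \<partial>lborel)" if "t \<le> T" for t
    unfolding D[OF that]
  proof (rule integral_cong_AE)
    show "AE s in lborel. u s * of_bool (s \<le> t) = u s * of_bool (s < t)"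
      using AE_lborel_singleton[of t] by eventually_elim auto
  qed measurable
  have DT: "D T = (\<integral>s. u s \<partial>lborel)"
    unfolding D_def u_def set_lebesgue_integral_def by (simp add: mult.commute)
  have AT: "A T = (\<integral>x. e x \<partial>Q)"
    unfolding A_def using \<tau> by (intro Bochner_Integration.integral_cong) auto
  have u0: "u s = 0" if "\<not> s \<le> T" for s using that by (simp add: u_def)
  have uD: "u s * (\<integral>s'. u s' * of_bool (s' \<le> s) \<partial>lborel) = u s * D s"
    "u s * (\<integral>s'. u s' * of_bool (s' < s) \<partial>lborel) = u s * D s" for s
    by (cases "s \<le> T", simp add: D, simp add: u0) (cases "s \<le> T", simp add: D', simp add: u0)
  note sl = lborel.sigma_finite_measure_axioms and sq = Q.sigma_finite_measure_axioms
  have m: "(\<lambda>s::real. s) \<in> borel_measurable lborel" by simp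
  have m\<tau>: "\<tau> \<in> borel_measurable Q" by simp
  \<comment> \<open>Both halves of the split coincide because ties between two Lebesgue times are
    negligible; hence the factor 2.\<close>
  have LL: "integrable lborel (\<lambda>s. u s * D s)" "(D T)\<^sup>2 = 2 * (\<integral>s. u s * D s \<partial>lborel)"
    using integral_mult_time_split[OF sl sl u u m m, unfolded uD] unfolding DT[symmetric]
    by (simp_all only: power2_eq_square mult_2)
  have eD: "(\<integral>x. e x * (\<integral>s. u s * of_bool (s < \<tau> x) \<partial>lborel) \<partial>Q) = (\<integral>x. e x * D (\<tau> x) \<partial>Q)"
    using D' \<tau> by (intro Bochner_Integration.integral_cong) auto
  have eD': "integrable Q (\<lambda>x. e x * (\<integral>s. u s * of_bool (s < \<tau> x) \<partial>lborel)) = integrable Q (\<lambda>x. e x * D (\<tau> x))"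
    using D' \<tau> by (intro Bochner_Integration.integrable_cong) auto
  have LQ: "integrable lborel (\<lambda>s. u s * A s)" "integrable Q (\<lambda>x. e x * D (\<tau> x))"
     "D T * A T = (\<integral>s. u s * A s \<partial>lborel) + (\<integral>x. e x * D (\<tau> x) \<partial>Q)"
    using integral_mult_time_split[OF sl sq u e(1) m m\<tau>, unfolded eD eD', folded DT AT A_def]
    by simp_all
  \<comment> \<open>For the jump part ties matter: one half involves \<open>A\<close>, the other its
    left limit \<open>Am\<close>, and their difference is the quadratic variation
    \<open>\<Delta>\<close> introduced below.\<close>
  have QQ: "integrable Q (\<lambda>x. e x * A (\<tau> x))" "integrable Q (\<lambda>x. e x * Am (\<tau> x))"
     "(A T)\<^sup>2 = (\<integral>x. e x * A (\<tau> x) \<partial>Q) + (\<integral>x. e x * Am (\<tau> x) \<partial>Q)"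
    using integral_mult_time_split[OF sq sq e(1) e(1) m\<tau> m\<tau>, folded AT A_def Am_def]
    by (simp_all add: power2_eq_square)
  have YmD: "Ym t = y - D t + Am t" for t by (simp add: Ym_def D_def Am_def)
  have YD: "Y t = y - D t + A t" if "0 \<le> t" "t \<le> T" for t using Y[OF that] by (simp add: D_def A_def)
  have uY: "(LBINT s:{0..T}. v s * Y s) = y * D T - (\<integral>s. u s * D s \<partial>lborel) + (\<integral>s. u s * A s \<partial>lborel)"
  proof -
    have "(LBINT s:{0..T}. v s * Y s) = (\<integral>s. y * u s - u s * D s + u s * A s \<partial>lborel)"
      unfolding set_lebesgue_integral_def
      by (intro Bochner_Integration.integral_cong) (auto simp: u_def YD algebra_simps split: split_indicator)
    then show ?thesis using u LL(1) LQ(1) by (simp add: DT)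
  qed
  have eYm: "integrable Q (\<lambda>x. 2 * e x * Ym (\<tau> x))"
    "(\<integral>x. 2 * e x * Ym (\<tau> x) \<partial>Q) = 2 * (y * A T - (\<integral>x. e x * D (\<tau> x) \<partial>Q) + (\<integral>x. e x * Am (\<tau> x) \<partial>Q))"
  proof -
    have eq: "2 * e x * Ym (\<tau> x) = 2 * (y * e x - e x * D (\<tau> x) + e x * Am (\<tau> x))" for x
      by (simp add: YmD algebra_simps)
    show "integrable Q (\<lambda>x. 2 * e x * Ym (\<tau> x))" unfolding eq using e LQ(2) QQ(2) by simp
    show "(\<integral>x. 2 * e x * Ym (\<tau> x) \<partial>Q) = 2 * (y * A T - (\<integral>x. e x * D (\<tau> x) \<partial>Q) + (\<integral>x. e x * Am (\<tau> x) \<partial>Q))"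
      unfolding eq using e LQ(2) QQ(2) by (simp add: AT)
  qed
  define \<Delta> where "\<Delta> = (\<integral>x. e x * A (\<tau> x) - e x * Am (\<tau> x) \<partial>Q)"
  \<comment> \<open>Expand the square of \<open>y - D T + A T\<close> and insert the three product
    formulas. Every term with an integral against \<open>u\<close> cancels against the drift
    integral added on the left.\<close>
  have id: "(Y T)\<^sup>2 + 2 * (LBINT s:{0..T}. v s * Y s) = y\<^sup>2 + (\<integral>x. 2 * e x * Ym (\<tau> x) \<partial>Q) + \<Delta>"
  proof -
    have "(Y T)\<^sup>2 = y\<^sup>2 + (D T)\<^sup>2 + (A T)\<^sup>2 - 2 * y * D T + 2 * y * A T - 2 * (D T * A T)"
      unfolding YD[OF T order_refl] by (simp add: power2_eq_square algebra_simps)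
    moreover have "\<Delta> = (\<integral>x. e x * A (\<tau> x) \<partial>Q) - (\<integral>x. e x * Am (\<tau> x) \<partial>Q)"
      unfolding \<Delta>_def using QQ by simp
    ultimately show ?thesis using LL(2) LQ(3) QQ(3) uY eYm(2) by (simp add: algebra_simps)
  qed
  have jump: "e x * A (\<tau> x) - e x * Am (\<tau> x) = (\<integral>x'. e x * e x' * of_bool (\<tau> x' = \<tau> x) \<partial>Q)" for x
  proof -
    have i: "integrable Q (\<lambda>x'. e x' * of_bool (\<tau> x' \<le> t))" "integrable Q (\<lambda>x'. e x' * of_bool (\<tau> x' < t))" for t
      by (rule Bochner_Integration.integrable_bound[OF e(1)]; auto simp: of_bool_def)+
    have "A (\<tau> x) - Am (\<tau> x) = (\<integral>x'. e x' * of_bool (\<tau> x' \<le> \<tau> x) - e x' * of_bool (\<tau> x' < \<tau> x) \<partial>Q)"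
      unfolding A_def Am_def using i by simp
    also have "\<dots> = (\<integral>x'. e x' * of_bool (\<tau> x' = \<tau> x) \<partial>Q)"
      by (intro Bochner_Integration.integral_cong) (auto simp: of_bool_def)
    finally show ?thesis by (simp add: right_diff_distrib[symmetric] mult.assoc)
  qed
  have h\<Delta>: "ennreal \<Delta> \<le> (\<integral>\<^sup>+x. ennreal ((e x)\<^sup>2) \<partial>Q)"
  proof -
    interpret QQ: pair_sigma_finite Q Q ..
    have jn: "0 \<le> e x * A (\<tau> x) - e x * Am (\<tau> x)" if "x \<in> space Q" for x
      unfolding jump using e(2) that by (intro integral_nonneg_AE) auto
    have ji: "integrable Q (\<lambda>x'. e x * e x' * of_bool (\<tau> x' = \<tau> x))" for x
      by (rule Bochner_Integration.integrable_bound[of _ "\<lambda>x'. e x * e x'"]) (use e(1) in \<open>auto simp: of_bool_def\<close>)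
    \<comment> \<open>\<open>e x * e x' \<le> ((e x)\<^sup>2 + (e x')\<^sup>2) / 2\<close>, and at most unit mass sits at each single time\<close>
    let ?h = "\<lambda>x x'. ennreal ((e x)\<^sup>2 / 2) * of_bool (\<tau> x' = \<tau> x)"
    have inner: "(\<integral>\<^sup>+x. \<integral>\<^sup>+x'. ?h x x' \<partial>Q \<partial>Q) \<le> (\<integral>\<^sup>+x. ennreal ((e x)\<^sup>2 / 2) \<partial>Q)"
    proof (intro nn_integral_mono)
      fix x assume x: "x \<in> space Q"
      have "(\<integral>\<^sup>+x'. ?h x x' \<partial>Q) = ennreal ((e x)\<^sup>2 / 2) * (\<integral>\<^sup>+x'. indicator {x'\<in>space Q. \<tau> x' = \<tau> x} x' \<partial>Q)"
        by (subst nn_integral_cmult[symmetric]) (auto intro!: nn_integral_cong)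
      also have "\<dots> = ennreal ((e x)\<^sup>2 / 2) * emeasure Q {x'\<in>space Q. \<tau> x' = \<tau> x}" by simp
      also have "\<dots> \<le> ennreal ((e x)\<^sup>2 / 2) * 1" using one[of "\<tau> x"] \<tau>[OF x] by (intro mult_left_mono) auto
      finally show "(\<integral>\<^sup>+x'. ?h x x' \<partial>Q) \<le> ennreal ((e x)\<^sup>2 / 2)" by simp
    qed
    have "ennreal \<Delta> = (\<integral>\<^sup>+x. ennreal (e x * A (\<tau> x) - e x * Am (\<tau> x)) \<partial>Q)"
      unfolding \<Delta>_def using QQ jn by (intro nn_integral_eq_integral[symmetric]) auto
    also have "\<dots> = (\<integral>\<^sup>+x. \<integral>\<^sup>+x'. ennreal (e x * e x' * of_bool (\<tau> x' = \<tau> x)) \<partial>Q \<partial>Q)"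
      unfolding jump using e ji by (intro nn_integral_cong nn_integral_eq_integral[symmetric]) auto
    also have "\<dots> \<le> (\<integral>\<^sup>+x. \<integral>\<^sup>+x'. ?h x x' + ?h x' x \<partial>Q \<partial>Q)"
    proof (intro nn_integral_mono)
      fix x x' assume "x \<in> space Q" "x' \<in> space Q"
      have "e x * e x' \<le> (e x)\<^sup>2 / 2 + (e x')\<^sup>2 / 2"
        using sum_squares_bound[of "e x" "e x'"] by simp
      then show "ennreal (e x * e x' * of_bool (\<tau> x' = \<tau> x)) \<le> ?h x x' + ?h x' x"
        by (auto simp: ennreal_plus[symmetric] intro!: ennreal_leI simp del: ennreal_plus)
    qed
    also have "\<dots> = (\<integral>\<^sup>+x. \<integral>\<^sup>+x'. ?h x x' \<partial>Q \<partial>Q) + (\<integral>\<^sup>+x. \<integral>\<^sup>+x'. ?h x' x \<partial>Q \<partial>Q)"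
      by (simp add: nn_integral_add)
    also have "(\<integral>\<^sup>+x. \<integral>\<^sup>+x'. ?h x' x \<partial>Q \<partial>Q) = (\<integral>\<^sup>+x. \<integral>\<^sup>+x'. ?h x x' \<partial>Q \<partial>Q)"
      by (rule QQ.Fubini') measurable
    also have "(\<integral>\<^sup>+x. \<integral>\<^sup>+x'. ?h x x' \<partial>Q \<partial>Q) + (\<integral>\<^sup>+x. \<integral>\<^sup>+x'. ?h x x' \<partial>Q \<partial>Q)
      \<le> (\<integral>\<^sup>+x. ennreal ((e x)\<^sup>2 / 2) \<partial>Q) + (\<integral>\<^sup>+x. ennreal ((e x)\<^sup>2 / 2) \<partial>Q)"
      by (intro add_mono inner)
    also have "\<dots> = (\<integral>\<^sup>+x. ennreal ((e x)\<^sup>2) \<partial>Q)"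
      by (subst nn_integral_add[symmetric]) (auto simp: ennreal_plus[symmetric] simp del: ennreal_plus)
    finally show ?thesis .
  qed
  \<comment> \<open>The left limits at the atoms are nonnegative, so the Bochner integral and the
    nonnegative integral agree.\<close>
  have hY: "ennreal (\<integral>x. 2 * e x * Ym (\<tau> x) \<partial>Q) = (\<integral>\<^sup>+x. ennreal (2 * e x * Ym (\<tau> x)) \<partial>Q)"
    using eYm(1) e(2) Ym \<tau> by (intro nn_integral_eq_integral[symmetric]) auto
  have "ennreal (y\<^sup>2 + (\<integral>x. 2 * e x * Ym (\<tau> x) \<partial>Q) + \<Delta>)
      \<le> ennreal (y\<^sup>2) + ennreal (\<integral>x. 2 * e x * Ym (\<tau> x) \<partial>Q) + ennreal \<Delta>"
    using ennreal_plus_le[of "y\<^sup>2 + (\<integral>x. 2 * e x * Ym (\<tau> x) \<partial>Q)" \<Delta>] ennreal_plus_le[of "y\<^sup>2" "\<integral>x. 2 * e x * Ym (\<tau> x) \<partial>Q"]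
    by (meson add_right_mono order_trans)
  also have "\<dots> \<le> ennreal (y\<^sup>2) + (\<integral>\<^sup>+x. ennreal (2 * e x * Ym (\<tau> x)) \<partial>Q) + (\<integral>\<^sup>+x. ennreal ((e x)\<^sup>2) \<partial>Q)"
    unfolding hY by (rule add_left_mono[OF h\<Delta>])
  also have "\<dots> = ennreal (y\<^sup>2) + (\<integral>\<^sup>+x. ennreal (2 * e x * Ym (\<tau> x)) + ennreal ((e x)\<^sup>2) \<partial>Q)"
    using eYm(1) by (subst nn_integral_add) (auto simp: add.assoc)
  also have "(\<integral>\<^sup>+x. ennreal (2 * e x * Ym (\<tau> x)) + ennreal ((e x)\<^sup>2) \<partial>Q)
      = (\<integral>\<^sup>+x. ennreal (2 * e x * Ym (\<tau> x) + (e x)\<^sup>2) \<partial>Q)"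
    using e(2) Ym \<tau> by (intro nn_integral_cong ennreal_plus[symmetric]) auto
  finally show ?thesis unfolding id .
qed

section \<open>Discretisation in time\<close>

text \<open>For positive \<open>s\<close>, the largest multiple of 1/(n+1) strictly below
  \<open>s\<close>. The strictness puts the cell of \<open>s\<close> after the grid point, as
  independence from the past demands; \<open>nat\<close> clips the remaining times to 0.\<close>

definition grid_left :: "nat \<Rightarrow> real \<Rightarrow> real" where
  "grid_left n s = real (nat (\<lceil>real (Suc n) * s\<rceil> - 1)) / real (Suc n)"

text \<open>For nonnegative \<open>s\<close>, the smallest multiple of 1/(n+1) strictly above
  \<open>s\<close>; it serves to exploit right continuity.\<close>

definition grid_right :: "nat \<Rightarrow> real \<Rightarrow> real" where
  "grid_right n s = real (Suc (nat \<lfloor>real (Suc n) * s\<rfloor>)) / real (Suc n)"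

text \<open>Rationality of the grid points later allows a dominating supremum over countably many
  times.\<close>

lemma grid_left_bounds:
  assumes "0 < s"
  shows "0 \<le> grid_left n s" "grid_left n s < s" "s - inverse (real (Suc n)) \<le> grid_left n s" "grid_left n s \<in> \<rat>"
proof -
  have p: "0 < real (Suc n) * s" using assms by simp
  have "real (nat (\<lceil>real (Suc n) * s\<rceil> - 1)) < real (Suc n) * s"
    "real (Suc n) * s \<le> real (nat (\<lceil>real (Suc n) * s\<rceil> - 1)) + 1" using p by linarith+
  then show "grid_left n s < s" "s - inverse (real (Suc n)) \<le> grid_left n s"
    unfolding grid_left_def by (simp_all add: field_simps del: of_nat_Suc)
qed (auto simp: grid_left_def)

lemma grid_right_bounds:
  assumes "0 \<le> s"
  shows "s < grid_right n s" "grid_right n s \<le> s + inverse (real (Suc n))"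
proof -
  have p: "0 \<le> real (Suc n) * s" using assms by simp
  have "real (Suc n) * s < real (Suc (nat \<lfloor>real (Suc n) * s\<rfloor>))"
    "real (Suc (nat \<lfloor>real (Suc n) * s\<rfloor>)) \<le> real (Suc n) * s + 1" using p by linarith+
  then show "s < grid_right n s" "grid_right n s \<le> s + inverse (real (Suc n))"
    unfolding grid_right_def by (simp_all add: field_simps del: of_nat_Suc)
qed

lemma filterlim_grid_left:
  assumes "0 < s" shows "filterlim (\<lambda>n. grid_left n s) (at_left s) sequentially"
  unfolding filterlim_at
proof
  have "(\<lambda>n. s - inverse (real (Suc n))) \<longlonglongrightarrow> s - 0"
    by (intro tendsto_intros LIMSEQ_inverse_real_of_nat)
  then have lim: "(\<lambda>n. s - inverse (real (Suc n))) \<longlonglongrightarrow> s" by simp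
  show "(\<lambda>n. grid_left n s) \<longlonglongrightarrow> s"
  proof (rule real_tendsto_sandwich[OF _ _ lim tendsto_const])
    show "\<forall>\<^sub>F n in sequentially. s - inverse (real (Suc n)) \<le> grid_left n s"
      by (intro always_eventually allI grid_left_bounds[OF assms])
    show "\<forall>\<^sub>F n in sequentially. grid_left n s \<le> s"
      by (intro always_eventually allI less_imp_le grid_left_bounds[OF assms])
  qed
  show "\<forall>\<^sub>F n in sequentially. grid_left n s \<in> {..<s} \<and> grid_left n s \<noteq> s"
    using grid_left_bounds[OF assms] by (simp add: less_imp_neq less_imp_neq[symmetric])
qed

lemma filterlim_grid_right:
  assumes "0 \<le> s" shows "filterlim (\<lambda>n. grid_right n s) (at_right s) sequentially"
  unfolding filterlim_at
proof
  have "(\<lambda>n. s + inverse (real (Suc n))) \<longlonglongrightarrow> s + 0"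
    by (intro tendsto_intros LIMSEQ_inverse_real_of_nat)
  then have lim: "(\<lambda>n. s + inverse (real (Suc n))) \<longlonglongrightarrow> s" by simp
  show "(\<lambda>n. grid_right n s) \<longlonglongrightarrow> s"
  proof (rule real_tendsto_sandwich[OF _ _ tendsto_const lim])
    show "\<forall>\<^sub>F n in sequentially. grid_right n s \<le> s + inverse (real (Suc n))"
      by (intro always_eventually allI grid_right_bounds[OF assms])
    show "\<forall>\<^sub>F n in sequentially. s \<le> grid_right n s"
      by (intro always_eventually allI less_imp_le grid_right_bounds[OF assms])
  qed
  show "\<forall>\<^sub>F n in sequentially. grid_right n s \<in> {s<..} \<and> grid_right n s \<noteq> s"
    using grid_right_bounds[OF assms] by (simp add: less_imp_neq less_imp_neq[symmetric])
qed

section \<open>Cadlag paths and processes as limits along the grid\<close>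

lemma cadlag_tendsto_left_lim:
  assumes "cadlag f" "0 < t" shows "(f \<longlongrightarrow> left_lim f t) (at_left t)"
proof -
  obtain l where l: "(f \<longlongrightarrow> l) (at_left t)" using assms by (auto simp: cadlag_def)
  then have "Lim (at_left t) f = l" by (intro tendsto_Lim) simp_all
  then show ?thesis using l assms by (simp add: left_lim_def)
qed

lemma left_lim_eqI:
  assumes "(f \<longlongrightarrow> l) (at_left t)" "0 < t" shows "left_lim f t = l"
  using tendsto_Lim[OF _ assms(1)] assms(2) by (simp add: left_lim_def)

lemma cadlag_grid_left:
  assumes "cadlag f" "0 < t" shows "(\<lambda>n. f (grid_left n t)) \<longlonglongrightarrow> left_lim f t"
  by (rule filterlim_compose[OF cadlag_tendsto_left_lim[OF assms] filterlim_grid_left[OF assms(2)]])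

lemma measurable_grid_left:
  fixes f :: "real \<Rightarrow> 'a :: topological_space" shows "(\<lambda>t. f (grid_left n t)) \<in> borel_measurable borel"
  unfolding grid_left_def
  by (rule measurable_compose_countable[of "\<lambda>k _. f (real k / real (Suc n))"]) measurable

lemma borel_measurable_left_lim:
  assumes "cadlag f" shows "left_lim f \<in> borel_measurable borel"
proof (rule borel_measurable_LIMSEQ_real)
  show "(\<lambda>n. if t \<le> 0 then f 0 else f (grid_left n t)) \<longlonglongrightarrow> left_lim f t" for t
    using cadlag_grid_left[OF assms, of t] by (auto simp: left_lim_def)
  show "(\<lambda>t. if t \<le> 0 then f 0 else f (grid_left n t)) \<in> borel_measurable borel" for n
    using measurable_grid_left[of f n] by measurable
qed

text \<open>Right continuity presents the process as a limit of processes that are piecewise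
  constant in time. The \<open>max 0\<close> freezes the process at negative times, about which the
  hypotheses say nothing.\<close>

lemma cadlag_joint_measurable:
  fixes X :: "real \<Rightarrow> 'a \<Rightarrow> real"
  assumes X: "\<And>t. 0 \<le> t \<Longrightarrow> X t \<in> borel_measurable N"
    and c: "\<And>\<omega>. \<omega> \<in> space N \<Longrightarrow> cadlag (\<lambda>t. X t \<omega>)"
  shows "(\<lambda>(t,\<omega>). X (max 0 t) \<omega>) \<in> borel_measurable (borel \<Otimes>\<^sub>M N)"
proof (rule borel_measurable_LIMSEQ_real)
  show "(\<lambda>n. case x of (t,\<omega>) \<Rightarrow> X (grid_right n (max 0 t)) \<omega>) \<longlonglongrightarrow> (case x of (t,\<omega>) \<Rightarrow> X (max 0 t) \<omega>)"
    if "x \<in> space (borel \<Otimes>\<^sub>M N)" for x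
  proof (cases x)
    case (Pair t \<omega>)
    with that have "\<omega> \<in> space N" by (simp add: space_pair_measure)
    then have "((\<lambda>t. X t \<omega>) \<longlongrightarrow> X (max 0 t) \<omega>) (at_right (max 0 t))"
      using c by (simp add: cadlag_def)
    from filterlim_compose[OF this filterlim_grid_right] show ?thesis by (simp add: Pair)
  qed
  show "(\<lambda>x. case x of (t,\<omega>) \<Rightarrow> X (grid_right n (max 0 t)) \<omega>) \<in> borel_measurable (borel \<Otimes>\<^sub>M N)" for n
  proof -
    have [measurable]: "X (real (Suc k) / real (Suc n)) \<in> borel_measurable N" for k using X by simp
    have "(\<lambda>x. X (real (Suc (nat \<lfloor>real (Suc n) * max 0 (fst x)\<rfloor>)) / real (Suc n)) (snd x)) \<in> borel_measurable (borel \<Otimes>\<^sub>M N)"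
      by (rule measurable_compose_countable[of "\<lambda>k x. X (real (Suc k) / real (Suc n)) (snd x)"]) measurable
    then show ?thesis unfolding grid_right_def by (simp add: case_prod_beta')
  qed
qed

text \<open>Compensator formula for integrands that are constant on grid cells. Each cell lies
  strictly after its left end point, where \<open>H\<close> and \<open>J\<close> are evaluated, so
  \<open>nn_integral_poisson_level\<close> applies cell by cell.\<close>

lemma nn_integral_poisson_grid:
  fixes H :: "real \<Rightarrow> 'o \<Rightarrow> ennreal" and J :: "real \<Rightarrow> 'o \<Rightarrow> nat" and T :: real
  assumes prob: "prob_space \<PP>" and \<nu>: "prob_space \<nu>" and prm: "poisson_random_measure \<PP> F \<nu> M"
    and spF: "\<And>t. space (F t) = space \<PP>"
    and H: "\<And>t. 0 \<le> t \<Longrightarrow> H t \<in> borel_measurable (F t)"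
    and J: "\<And>t. 0 \<le> t \<Longrightarrow> J t \<in> measurable (F t) (count_space UNIV)"
    and g: "g \<in> borel_measurable \<nu>"
  defines "h \<equiv> \<lambda>n \<omega>. \<lambda>(s,\<zeta>,r). indicator {0<..T} s * H (grid_left n s) \<omega> * g \<zeta> * indicator {..real (J (grid_left n s) \<omega>)} r"
  shows "(\<lambda>\<omega>. \<integral>\<^sup>+x. h n \<omega> x \<partial>M \<omega>) \<in> borel_measurable \<PP>"
    and "\<omega> \<in> space \<PP> \<Longrightarrow> h n \<omega> \<in> borel_measurable (M \<omega>)"
    and "(\<integral>\<^sup>+\<omega>. \<integral>\<^sup>+x. h n \<omega> x \<partial>M \<omega> \<partial>\<PP>) =
      (\<integral>\<^sup>+\<omega>. \<integral>\<^sup>+s. indicator {0<..T} s * (H (grid_left n s) \<omega> * of_nat (J (grid_left n s) \<omega>)) \<partial>lborel \<partial>\<PP>) * (\<integral>\<^sup>+\<zeta>. g \<zeta> \<partial>\<nu>)"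
proof -
  define t where "t i = real i / real (Suc n)" for i
  \<comment> \<open>The i-th cell, cut off at \<open>T\<close>. Describing it through the index
    computed by \<open>grid_left\<close> makes a sum over cells pick exactly one term for each time
    in (0,T].\<close>
  define S where "S i = {s. 0 < s \<and> s \<le> T \<and> nat (\<lceil>real (Suc n) * s\<rceil> - 1) = i}" for i
  have t0: "0 \<le> t i" for i by (simp add: t_def)
  have S: "S i \<in> sets borel" "S i \<subseteq> {t i<..}" for i
  proof -
    show "S i \<in> sets borel" unfolding S_def by measurable
    show "S i \<subseteq> {t i<..}" using grid_left_bounds(2)[of _ n] by (auto simp: S_def t_def grid_left_def)
  qed
  have split: "(\<Sum>i. indicator (S i) s * \<phi> i) = indicator {0<..T} s * (\<phi> (nat (\<lceil>real (Suc n) * s\<rceil> - 1)) :: ennreal)" for s \<phi>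
  proof -
    let ?k = "nat (\<lceil>real (Suc n) * s\<rceil> - 1)"
    have "(\<lambda>i. indicator (S i) s * \<phi> i) = (\<lambda>i. if i = ?k then indicator {0<..T} s * \<phi> i else 0)"
      by (auto simp: S_def fun_eq_iff split: split_indicator)
    then show ?thesis using sums_unique[OF sums_single[of ?k "\<lambda>i. indicator {0<..T} s * \<phi> i"]] by simp
  qed
  have hsum: "h n \<omega> x = (\<Sum>i. H (t i) \<omega> * (case x of (s,\<zeta>,r) \<Rightarrow> indicator (S i) s * g \<zeta> * indicator {..real (J (t i) \<omega>)} r))"
    for \<omega> x
  proof (cases x)
    case (fields s \<zeta> r)
    have "h n \<omega> x = (\<Sum>i. indicator (S i) s * (H (t i) \<omega> * g \<zeta> * indicator {..real (J (t i) \<omega>)} r))"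
      unfolding split by (simp add: h_def fields t_def grid_left_def mult_ac)
    then show ?thesis by (simp add: fields mult_ac)
  qed
  have mS: "(\<lambda>(s,\<zeta>,r). indicator (S i) s * g \<zeta> * indicator {..R} r :: ennreal) \<in> borel_measurable (mark_intensity \<nu>)" for i R
    using S[of i] t0[of i] by (intro measurable_mark_box[OF _ _ g]) auto
  have mM: "(\<lambda>(s,\<zeta>,r). indicator (S i) s * g \<zeta> * indicator {..R} r :: ennreal) \<in> borel_measurable (M \<omega>)" if "\<omega> \<in> space \<PP>" for i R \<omega>
    using mS[of i R] sets_poisson(1)[OF prm that] by (simp cong: measurable_cong_sets)
  show hM: "h n \<omega> \<in> borel_measurable (M \<omega>)" if "\<omega> \<in> space \<PP>" for \<omega>
    unfolding hsum[abs_def] using mM[OF that] by measurable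
  let ?I = "\<lambda>i \<omega>. \<integral>\<^sup>+(s,\<zeta>,r). indicator (S i) s * g \<zeta> * indicator {..real (J (t i) \<omega>)} r \<partial>M \<omega>"
  let ?HJ = "\<lambda>i \<omega>. H (t i) \<omega> * of_nat (J (t i) \<omega>)"
  have int: "(\<integral>\<^sup>+x. h n \<omega> x \<partial>M \<omega>) = (\<Sum>i. H (t i) \<omega> * ?I i \<omega>)"
    if "\<omega> \<in> space \<PP>" for \<omega>
    unfolding hsum using mM[OF that]
    by (subst nn_integral_suminf) (auto intro!: suminf_cong nn_integral_cmult)
  note lev = nn_integral_poisson_level[OF prob \<nu> prm spF t0 H[OF t0] J[OF t0] S g]
  have Hm: "H (t i) \<in> borel_measurable \<PP>" "J (t i) \<in> measurable \<PP> (count_space UNIV)" for i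
    by (rule measurable_from_filtration[OF prob prm spF t0 H[OF t0]],
        rule measurable_from_filtration[OF prob prm spF t0 J[OF t0]])
  note [measurable] = Hm
  have [measurable]: "S i \<in> sets borel" for i by (rule S)
  have "(\<lambda>\<omega>. \<Sum>i. H (t i) \<omega> * ?I i \<omega>) \<in> borel_measurable \<PP>"
    using lev(1) by (rule borel_measurable_suminf_order)
  then show "(\<lambda>\<omega>. \<integral>\<^sup>+x. h n \<omega> x \<partial>M \<omega>) \<in> borel_measurable \<PP>"
    by (subst measurable_cong[OF int])
  have "(\<integral>\<^sup>+\<omega>. \<integral>\<^sup>+x. h n \<omega> x \<partial>M \<omega> \<partial>\<PP>) =
      (\<integral>\<^sup>+\<omega>. (\<Sum>i. H (t i) \<omega> * ?I i \<omega>) \<partial>\<PP>)"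
    by (rule nn_integral_cong[OF int])
  also have "\<dots> = (\<Sum>i. (\<integral>\<^sup>+\<omega>. ?HJ i \<omega> \<partial>\<PP>) * emeasure lborel (S i) * (\<integral>\<^sup>+\<zeta>. g \<zeta> \<partial>\<nu>))"
    by (subst nn_integral_suminf[OF lev(1)]) (rule suminf_cong[OF lev(2)])
  also have "\<dots> = (\<Sum>i. (\<integral>\<^sup>+\<omega>. ?HJ i \<omega> \<partial>\<PP>) * emeasure lborel (S i)) * (\<integral>\<^sup>+\<zeta>. g \<zeta> \<partial>\<nu>)"
    by (rule ennreal_suminf_multc)
  also have "(\<Sum>i. (\<integral>\<^sup>+\<omega>. ?HJ i \<omega> \<partial>\<PP>) * emeasure lborel (S i)) =
      (\<Sum>i. \<integral>\<^sup>+\<omega>. \<integral>\<^sup>+s. indicator (S i) s * (?HJ i \<omega>) \<partial>lborel \<partial>\<PP>)"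
  proof (rule suminf_cong)
    fix i
    have "(\<integral>\<^sup>+s. indicator (S i) s * c \<partial>lborel) = c * emeasure lborel (S i)" for c :: ennreal
      by (subst nn_integral_multc) (auto simp: mult.commute)
    then show "(\<integral>\<^sup>+\<omega>. ?HJ i \<omega> \<partial>\<PP>) * emeasure lborel (S i) =
      (\<integral>\<^sup>+\<omega>. \<integral>\<^sup>+s. indicator (S i) s * (?HJ i \<omega>) \<partial>lborel \<partial>\<PP>)"
      by (simp add: nn_integral_multc)
  qed
  also have "\<dots> = (\<integral>\<^sup>+\<omega>. (\<Sum>i. \<integral>\<^sup>+s. indicator (S i) s * (?HJ i \<omega>) \<partial>lborel) \<partial>\<PP>)"
    by (intro nn_integral_suminf[symmetric]) (simp add: nn_integral_multc)
  also have "\<dots> = (\<integral>\<^sup>+\<omega>. \<integral>\<^sup>+s. (\<Sum>i. indicator (S i) s * (?HJ i \<omega>)) \<partial>lborel \<partial>\<PP>)"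
    by (intro nn_integral_cong nn_integral_suminf[symmetric]) measurable
  also have "\<dots> = (\<integral>\<^sup>+\<omega>. \<integral>\<^sup>+s. indicator {0<..T} s * (H (grid_left n s) \<omega> * of_nat (J (grid_left n s) \<omega>)) \<partial>lborel \<partial>\<PP>)"
    unfolding split t_def grid_left_def ..
  finally show "(\<integral>\<^sup>+\<omega>. \<integral>\<^sup>+x. h n \<omega> x \<partial>M \<omega> \<partial>\<PP>) =
      (\<integral>\<^sup>+\<omega>. \<integral>\<^sup>+s. indicator {0<..T} s * (H (grid_left n s) \<omega> * of_nat (J (grid_left n s) \<omega>)) \<partial>lborel \<partial>\<PP>) * (\<integral>\<^sup>+\<zeta>. g \<zeta> \<partial>\<nu>)" .
qed

section \<open>The Hawkes path at a fixed sample point\<close>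

text \<open>An instance of the left limit of integrals cut in time, with the identity as time
  function; the end point is Lebesgue-null.\<close>

lemma LBINT_tendsto_at_left:
  fixes v :: "real \<Rightarrow> real"
  assumes v: "set_integrable lborel {0..s} v" and s: "0 < s"
  shows "((\<lambda>t. LBINT x:{0..t}. v x) \<longlongrightarrow> (LBINT x:{0..s}. v x)) (at_left s)"
proof -
  let ?u = "\<lambda>x. v x * indicator {0..s} x"
  have u: "integrable lborel ?u" using v by (simp add: set_integrable_def mult.commute)
  have m: "(\<lambda>x::real. x) \<in> borel_measurable lborel" by simp
  have "(\<integral>x. ?u x * of_bool (x < s) \<partial>lborel) = (LBINT x:{0..s}. v x)"
    unfolding set_lebesgue_integral_def
  proof (rule integral_cong_AE)
    show "AE x in lborel. ?u x * of_bool (x < s) = indicator {0..s} x *\<^sub>R v x"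
      using AE_lborel_singleton[of s] by eventually_elim (auto split: split_indicator)
    show "(\<lambda>x. ?u x * of_bool (x < s)) \<in> borel_measurable lborel"
      using borel_measurable_integrable[OF u] by measurable
    show "(\<lambda>x. indicator {0..s} x *\<^sub>R v x) \<in> borel_measurable lborel"
      using v by (simp add: set_integrable_def borel_measurable_integrable)
  qed
  then have "((\<lambda>t. \<integral>x. ?u x * of_bool (x \<le> t) \<partial>lborel) \<longlongrightarrow> (LBINT x:{0..s}. v x)) (at_left s)"
    using tendsto_at_left_integral_le[OF u m, of s] by (simp only:)
  moreover have "\<forall>\<^sub>F t in at_left s. (\<integral>x. ?u x * of_bool (x \<le> t) \<partial>lborel) = (LBINT x:{0..t}. v x)"
    using eventually_at_left_real[OF s]
  proof eventually_elim
    case (elim t)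
    then show ?case unfolding set_lebesgue_integral_def
      by (intro Bochner_Integration.integral_cong) (auto split: split_indicator)
  qed
  ultimately show ?thesis by (rule Lim_transform_eventually)
qed

text \<open>Nothing is known of \<mu> off the positive axis, so the composition is made with \<mu>
  cut off there, which is Borel.\<close>

lemma continuous_borel_measurable_pos:
  fixes \<mu> :: "real \<Rightarrow> real"
  assumes "continuous_on {0<..} \<mu>" and f: "f \<in> borel_measurable N" and "\<And>x. x \<in> space N \<Longrightarrow> 0 < f x"
  shows "(\<lambda>x. \<mu> (f x)) \<in> borel_measurable N"
proof -
  have "(\<lambda>x. indicator {0<..} x *\<^sub>R \<mu> x) \<in> borel_measurable borel"
    by (rule borel_measurable_continuous_on_indicator) (use assms in auto)
  from measurable_compose[OF f this] show ?thesis
    by (subst measurable_cong[of _ _ "\<lambda>x. indicator {0<..} (f x) *\<^sub>R \<mu> (f x)"]) (use assms in auto)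
qed

section \<open>One sample point: \<open>m\<close> is a realisation of the random measure and
  \<open>N\<close> its thinning\<close>

context
  fixes m :: "(real \<times> 'z \<times> real) measure" and \<nu> :: "'z measure" and Pp Yp :: "real \<Rightarrow> real"
    and \<mu> :: "real \<Rightarrow> real" and e :: "'z \<Rightarrow> real" and b y T :: real and N :: "(real \<times> 'z) measure"
    and \<Lambda> :: "real \<Rightarrow> real"
  assumes sm: "sets m = sets (mark_intensity \<nu>)"
    and atoms: "\<And>s r. 0 < s \<Longrightarrow> emeasure m ({s} \<times> (space \<nu> \<times> {0..r})) \<le> 1"
    and cad: "cadlag Pp" "cadlag Yp" and pos: "\<And>t. 0 \<le> t \<Longrightarrow> 0 < Pp t \<and> 0 \<le> Yp t"
    and Pcont: "\<And>s. 0 < s \<Longrightarrow> left_lim Pp s = Pp s"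
    and c\<mu>: "continuous_on {0<..} \<mu>"
    and e: "e \<in> borel_measurable \<nu>" "\<And>\<zeta>. \<zeta> \<in> space \<nu> \<Longrightarrow> 0 \<le> e \<zeta>"
    and T: "0 < T"
    and \<Lambda>: "\<Lambda> = (\<lambda>t. \<mu> (left_lim Pp t) + left_lim Yp t)"
    and N: "N = distr (density m (\<lambda>(t,\<zeta>,r). indicator {..\<Lambda> t} r)) (restrict_space borel {0..} \<Otimes>\<^sub>M \<nu>) (\<lambda>(t,\<zeta>,r). (t,\<zeta>))"
    and fin: "emeasure N ({0<..T} \<times> space \<nu>) < \<infinity>"
    and Yint: "set_integrable lborel {0..T} Yp"
    and eint: "set_integrable N ({0<..T} \<times> space \<nu>) (\<lambda>(s,\<zeta>). e \<zeta>)"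
    and Yeq: "\<And>t. 0 \<le> t \<Longrightarrow> t \<le> T \<Longrightarrow>
      Yp t = y - (LBINT s:{0..t}. b * Yp s) + (LINT (s,\<zeta>):({0<..t} \<times> space \<nu>)|N. e \<zeta>)"
begin

text \<open>The threshold involves \<mu> at left limits of \<open>Pp\<close>. By
  \<open>Pcont\<close> these are values of \<open>Pp\<close>, hence positive, and there \<mu> is
  continuous.\<close>

lemma path_intensity_measurable:
  "(\<lambda>(t,\<zeta>,r). indicator {..\<Lambda> t} r :: ennreal) \<in> borel_measurable m"
proof -
  let ?L = "restrict_space lborel {0::real..}"
  have l: "left_lim Pp t = Pp t" if "0 \<le> t" for t using Pcont[of t] that by (cases "t = 0") (auto simp: left_lim_def)
  have "(\<lambda>t. \<mu> (left_lim Pp t)) \<in> borel_measurable ?L"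
    by (rule continuous_borel_measurable_pos[OF c\<mu>])
      (use pos l borel_measurable_left_lim[OF cad(1)] in \<open>auto simp: measurable_restrict_space1\<close>)
  moreover have "left_lim Yp \<in> borel_measurable ?L"
    using borel_measurable_left_lim[OF cad(2)] by (simp add: measurable_restrict_space1)
  ultimately have [measurable]: "\<Lambda> \<in> borel_measurable ?L" unfolding \<Lambda> by measurable
  have [measurable]: "(\<lambda>r. r) \<in> borel_measurable ?L" by (simp add: measurable_restrict_space1)
  have "(\<lambda>x. indicator {x. snd (snd x) \<le> \<Lambda> (fst x)} x :: ennreal) \<in> borel_measurable (mark_intensity \<nu>)"
    unfolding mark_intensity_def by measurable
  then show ?thesis using sm by (simp add: case_prod_beta' indicator_def cong: measurable_cong_sets)
qed

lemma path_projection_measurable: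
  "(\<lambda>(t,\<zeta>,r). (t,\<zeta>)) \<in> measurable m (restrict_space borel {0..} \<Otimes>\<^sub>M \<nu>)"
proof -
  have [measurable]: "(\<lambda>t. t) \<in> measurable (restrict_space lborel {0::real..}) (restrict_space borel {0..})"
    by (simp add: measurable_restrict_space3)
  have "(\<lambda>(t,\<zeta>,r). (t,\<zeta>)) \<in> measurable (mark_intensity \<nu>) (restrict_space borel {0..} \<Otimes>\<^sub>M \<nu>)"
    unfolding mark_intensity_def case_prod_beta' by measurable
  then show ?thesis using sm by (simp cong: measurable_cong_sets)
qed

lemma path_space: "sets N = sets (restrict_space borel {0..} \<Otimes>\<^sub>M \<nu>)" "space N = {0..} \<times> space \<nu>"
  by (simp_all add: N space_pair_measure)

lemma path_strip: "S \<in> sets borel \<Longrightarrow> S \<subseteq> {0..} \<Longrightarrow> S \<times> space \<nu> \<in> sets N"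
  unfolding path_space by (intro pair_measureI) (auto simp: sets_restrict_space_iff)

lemma path_nn_integral:
  assumes h: "h \<in> borel_measurable N"
  shows "(\<integral>\<^sup>+x. h x \<partial>N) = (\<integral>\<^sup>+(t,\<zeta>,r). h (t,\<zeta>) * indicator {..\<Lambda> t} r \<partial>m)"
proof -
  note pm = path_projection_measurable
  have h': "h \<in> borel_measurable (restrict_space borel {0..} \<Otimes>\<^sub>M \<nu>)"
    using h path_space(1) by (simp cong: measurable_cong_sets)
  have hm: "(\<lambda>(t,\<zeta>,r). h (t,\<zeta>)) \<in> borel_measurable m"
    using measurable_compose[OF pm h'] by (simp add: case_prod_beta')
  have "(\<integral>\<^sup>+x. h x \<partial>N) = (\<integral>\<^sup>+x. h (case x of (t,\<zeta>,r) \<Rightarrow> (t,\<zeta>)) \<partial>density m (\<lambda>(t,\<zeta>,r). indicator {..\<Lambda> t} r))"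
    unfolding N by (rule nn_integral_distr) (use pm h' in simp_all)
  also have "\<dots> = (\<integral>\<^sup>+x. (case x of (t,\<zeta>,r) \<Rightarrow> indicator {..\<Lambda> t} r) * h (case x of (t,\<zeta>,r) \<Rightarrow> (t,\<zeta>)) \<partial>m)"
    by (rule nn_integral_density[OF path_intensity_measurable measurable_compose[OF pm h']])
  also have "\<dots> = (\<integral>\<^sup>+(t,\<zeta>,r). h (t,\<zeta>) * indicator {..\<Lambda> t} r \<partial>m)"
    by (intro nn_integral_cong) (auto simp: mult.commute)
  finally show ?thesis .
qed

text \<open>At a fixed time the threshold is the number \<open>\<Lambda> s\<close>, so the mass of
  \<open>N\<close> at \<open>s\<close> is the mass of \<open>m\<close> in a single box.\<close>

lemma path_simultaneous:
  assumes s: "0 < s" shows "emeasure N ({s} \<times> space \<nu>) \<le> 1"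
proof -
  have "emeasure N ({s} \<times> space \<nu>) = (\<integral>\<^sup>+x. indicator ({s} \<times> space \<nu>) x \<partial>N)"
    using path_strip[of "{s}"] s by simp
  also have "\<dots> = (\<integral>\<^sup>+(t,\<zeta>,r). indicator ({s} \<times> space \<nu>) (t,\<zeta>) * indicator {..\<Lambda> t} r \<partial>m)"
    using path_strip[of "{s}"] s by (intro path_nn_integral) auto
  also have "\<dots> = (\<integral>\<^sup>+x. indicator ({s} \<times> (space \<nu> \<times> {0..\<Lambda> s})) x \<partial>m)"
    using sets_eq_imp_space_eq[OF sm] by (intro nn_integral_cong) (auto simp: indicator_def)
  also have "\<dots> = emeasure m ({s} \<times> (space \<nu> \<times> {0..\<Lambda> s}))"
    using mark_box_sets[of "{s}" \<nu> "\<Lambda> s"] s sm by simp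
  also have "\<dots> \<le> 1" by (rule atoms[OF s])
  finally show ?thesis .
qed

lemma path_left_lim_nonneg:
  assumes "0 < s" shows "0 \<le> left_lim Yp s"
  using cadlag_grid_left[OF cad(2) assms] pos grid_left_bounds(1)[OF assms]
  by (intro LIMSEQ_le_const[of _ "left_lim Yp s" 0]) auto

text \<open>The square inequality is applied to \<open>Q\<close>, the jump measure on (0,T], with
  the first coordinate as time. The second claim permits exchanging left limits for values under
  Lebesgue integrals: \<open>Yp\<close> can jump only at times charged by \<open>Q\<close>.\<close>

lemma path_square_le_left_lim_AE:
  "ennreal ((Yp T)\<^sup>2 + 2 * (LBINT s:{0..T}. b * Yp s * Yp s)) \<le>
     ennreal (y\<^sup>2) + (\<integral>\<^sup>+(s,\<zeta>,r). indicator {0<..T} s * ennreal (2 * e \<zeta> * left_lim Yp s + (e \<zeta>)\<^sup>2) * indicator {..\<Lambda> s} r \<partial>m)" (is ?A)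
  "AE s in lborel. s \<in> {0<..T} \<longrightarrow> left_lim Yp s = Yp s" (is ?cont)
proof -
  let ?B = "{0<..T} \<times> space \<nu>"
  define Q where "Q = restrict_space N ?B"
  have B: "?B \<in> sets N" by (rule path_strip) auto
  have Bi: "?B \<inter> space N = ?B" unfolding path_space by auto
  have Bs: "?B \<inter> space N \<in> sets N" unfolding Bi by (rule B)
  have spQ: "space Q = ?B" unfolding Q_def space_restrict_space Bi ..
  have [measurable]: "fst \<in> borel_measurable N" "snd \<in> measurable N \<nu>"
  proof -
    have [measurable]: "(\<lambda>t. t) \<in> borel_measurable (restrict_space borel {0::real..})"
      by (simp add: measurable_restrict_space1)
    have "(\<lambda>x. fst x) \<in> borel_measurable (restrict_space borel {0::real..} \<Otimes>\<^sub>M \<nu>)" by measurable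
    then show "fst \<in> borel_measurable N" using path_space(1) by (simp cong: measurable_cong_sets)
    have "snd \<in> measurable (restrict_space borel {0::real..} \<Otimes>\<^sub>M \<nu>) \<nu>" by measurable
    then show "snd \<in> measurable N \<nu>" using path_space(1) by (simp cong: measurable_cong_sets)
  qed
  have fstQ: "fst \<in> borel_measurable Q" unfolding Q_def by (rule measurable_restrict_space1) simp
  have "emeasure Q (space Q) = emeasure N ?B"
    unfolding spQ unfolding Q_def by (rule emeasure_restrict_space[OF Bs]) simp
  then have Qfin: "finite_measure Q" using fin by (intro finite_measureI) simp
  interpret Q: finite_measure Q by (rule Qfin)
  have eQ: "integrable Q (\<lambda>x. e (snd x))"
    unfolding Q_def integrable_restrict_space[OF Bs]
    using eint by (simp add: set_integrable_def case_prod_beta')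
  have A: "(\<integral>x. e (snd x) * of_bool (fst x \<le> t) \<partial>Q) = (LINT (s,\<zeta>):({0<..t} \<times> space \<nu>)|N. e \<zeta>)" if "t \<le> T" for t
    unfolding Q_def integral_restrict_space[OF Bs] set_lebesgue_integral_def
    using that by (intro Bochner_Integration.integral_cong) (auto simp: case_prod_beta' split: split_indicator)
  have Qone: "emeasure Q {x\<in>space Q. fst x = s} \<le> 1" if s: "0 < s" for s
  proof -
    have "emeasure Q {x\<in>space Q. fst x = s} = emeasure N {x\<in>space Q. fst x = s}"
      unfolding Q_def by (rule emeasure_restrict_space[OF Bs]) (auto simp: space_restrict_space)
    also have "\<dots> \<le> emeasure N ({s} \<times> space \<nu>)"
      using s by (intro emeasure_mono path_strip) (auto simp: spQ)
    also have "\<dots> \<le> 1" by (rule path_simultaneous[OF s])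
    finally show ?thesis .
  qed
  have bY: "set_integrable lborel {0..T} (\<lambda>s. b * Yp s)" using Yint by simp
  define Ym where "Ym t = y - (LBINT s:{0..t}. b * Yp s) + (\<integral>x. e (snd x) * of_bool (fst x < t) \<partial>Q)" for t
  have YA: "Yp t = y - (LBINT s:{0..t}. b * Yp s) + (\<integral>x. e (snd x) * of_bool (fst x \<le> t) \<partial>Q)" if "0 \<le> t" "t \<le> T" for t
    using Yeq[OF that] A[OF that(2)] by simp
  \<comment> \<open>The drift integral is continuous and the jump integral loses exactly the mass at
    \<open>s\<close>; this identifies the abstract \<open>Ym\<close> of the square inequality with
    the left limit.\<close>
  have Ym: "left_lim Yp s = Ym s" if s: "0 < s" "s \<le> T" for s
  proof (rule left_lim_eqI[OF _ s(1)])
    have "set_integrable lborel {0..s} (\<lambda>s. b * Yp s)" using bY by (rule set_integrable_subset) (use s in auto)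
    then have "((\<lambda>t. y - (LBINT s:{0..t}. b * Yp s) + (\<integral>x. e (snd x) * of_bool (fst x \<le> t) \<partial>Q)) \<longlongrightarrow> Ym s) (at_left s)"
      unfolding Ym_def by (intro tendsto_intros LBINT_tendsto_at_left tendsto_at_left_integral_le eQ fstQ s)
    moreover have "\<forall>\<^sub>F t in at_left s. y - (LBINT s:{0..t}. b * Yp s) + (\<integral>x. e (snd x) * of_bool (fst x \<le> t) \<partial>Q) = Yp t"
      using eventually_at_left_real[OF s(1)]
    proof eventually_elim
      case (elim t)
      then show ?case using YA[of t] s by simp
    qed
    ultimately show "(Yp \<longlongrightarrow> Ym s) (at_left s)" by (rule Lim_transform_eventually)
  qed
  have "ennreal ((Yp T)\<^sup>2 + 2 * (LBINT s:{0..T}. b * Yp s * Yp s)) \<le>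
     ennreal (y\<^sup>2) + (\<integral>\<^sup>+x. ennreal (2 * e (snd x) * Ym (fst x) + (e (snd x))\<^sup>2) \<partial>Q)"
  proof (rule square_path_le[where v="\<lambda>s. b * Yp s", OF Qfin fstQ eQ _ _ Qone bY _ YA, folded Ym_def])
    show "0 \<le> Ym s" if "0 < s" "s \<le> T" for s using path_left_lim_nonneg[OF that(1)] Ym[OF that] by simp
  qed (use T e(2) in \<open>auto simp: spQ\<close>)
  also have "(\<integral>\<^sup>+x. ennreal (2 * e (snd x) * Ym (fst x) + (e (snd x))\<^sup>2) \<partial>Q) =
    (\<integral>\<^sup>+x. ennreal (2 * e (snd x) * left_lim Yp (fst x) + (e (snd x))\<^sup>2) \<partial>Q)"
    by (intro nn_integral_cong) (auto simp: spQ Ym)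
  also have "\<dots> = (\<integral>\<^sup>+x. ennreal (2 * e (snd x) * left_lim Yp (fst x) + (e (snd x))\<^sup>2) * indicator ?B x \<partial>N)"
    unfolding Q_def by (rule nn_integral_restrict_space[OF Bs])
  also have "\<dots> = (\<integral>\<^sup>+(s,\<zeta>,r). ennreal (2 * e \<zeta> * left_lim Yp s + (e \<zeta>)\<^sup>2) * indicator ?B (s,\<zeta>) * indicator {..\<Lambda> s} r \<partial>m)"
  proof (subst path_nn_integral)
    have [measurable]: "left_lim Yp \<in> borel_measurable borel" by (rule borel_measurable_left_lim[OF cad(2)])
    note [measurable] = e(1) B
    show "(\<lambda>x. ennreal (2 * e (snd x) * left_lim Yp (fst x) + (e (snd x))\<^sup>2) * indicator ?B x) \<in> borel_measurable N"
      by measurable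
  qed simp
  also have "\<dots> = (\<integral>\<^sup>+(s,\<zeta>,r). indicator {0<..T} s * ennreal (2 * e \<zeta> * left_lim Yp s + (e \<zeta>)\<^sup>2) * indicator {..\<Lambda> s} r \<partial>m)"
    using sets_eq_imp_space_eq[OF sm] by (intro nn_integral_cong) (auto simp: indicator_def)
  finally show ?A .
  \<comment> \<open>The time marginal of a finite measure has at most countably many atoms, a
    Lebesgue-null set of times; elsewhere the strict and the non-strict cut give the same
    integral.\<close>
  interpret D: finite_measure "distr Q borel fst" by (rule Q.finite_measure_distr[OF fstQ])
  have "countable {s. measure (distr Q borel fst) {s} \<noteq> 0}" by (rule D.countable_support)
  then have "AE s in lborel. s \<notin> {s. measure (distr Q borel fst) {s} \<noteq> 0}"
    by (intro AE_not_in countable_imp_null_set_lborel)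
  then show ?cont
  proof eventually_elim
    case (elim s)
    show ?case
    proof
      assume s: "s \<in> {0<..T}"
      have "{x\<in>space Q. fst x = s} \<in> sets Q" using fstQ by measurable
      moreover have "emeasure Q {x\<in>space Q. fst x = s} = 0"
        using elim fstQ by (simp add: measure_distr Q.emeasure_eq_measure vimage_def Int_def conj_commute)
      ultimately have "AE x in Q. fst x \<noteq> s" by (intro AE_I[of _ _ "{x\<in>space Q. fst x = s}"]) auto
      then have "(\<integral>x. e (snd x) * of_bool (fst x < s) \<partial>Q) = (\<integral>x. e (snd x) * of_bool (fst x \<le> s) \<partial>Q)"
        using fstQ borel_measurable_integrable[OF eQ]
        by (intro integral_cong_AE) (auto elim!: eventually_mono)
      then show "left_lim Yp s = Yp s" using Ym[of s] YA[of s] s by (simp add: Ym_def)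
    qed
  qed
qed

end

section \<open>The second moment of the excitation process\<close>

lemma joint_measurable_lborel:
  assumes "f \<in> measurable (borel \<Otimes>\<^sub>M N) L"
  shows "(\<lambda>x. f (snd x, fst x)) \<in> measurable (N \<Otimes>\<^sub>M lborel) L"
proof (rule measurable_compose[OF _ assms])
  show "(\<lambda>x. (snd x, fst x)) \<in> measurable (N \<Otimes>\<^sub>M lborel) (borel \<Otimes>\<^sub>M N)" by measurable
qed

lemma grid_joint_measurable:
  assumes X: "\<And>t. 0 \<le> t \<Longrightarrow> X t \<in> measurable N L"
  shows "(\<lambda>x. X (grid_left n (snd x)) (fst x)) \<in> measurable (N \<Otimes>\<^sub>M lborel) L"
proof -
  have [measurable]: "X (real k / real (Suc n)) \<in> measurable N L" for k using X by simp
  show ?thesis unfolding grid_left_def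
    by (rule measurable_compose_countable[of "\<lambda>k x. X (real k / real (Suc n)) (fst x)"]) measurable
qed

text \<open>Dominated convergence in time at almost every sample point, then in the sample point.
  The majorant \<open>w\<close> is constant in time, so its time integral is
  \<open>w \<omega> * ennreal T\<close>. Domination is asked for at grid times, so that
  \<open>w\<close> may be a supremum over countably many times.\<close>

lemma nn_integral_grid_tendsto:
  fixes \<phi> :: "real \<Rightarrow> 'o \<Rightarrow> ennreal"
  assumes m: "\<And>t. 0 \<le> t \<Longrightarrow> \<phi> t \<in> borel_measurable N"
    and m': "(\<lambda>x. indicator {0<..T} (snd x) * \<phi> (snd x) (fst x)) \<in> borel_measurable (N \<Otimes>\<^sub>M lborel)"
    and w: "w \<in> borel_measurable N" "(\<integral>\<^sup>+\<omega>. w \<omega> \<partial>N) < \<infinity>" and T: "0 \<le> T"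
    and dom: "\<And>n s \<omega>. 0 < s \<Longrightarrow> s \<le> T \<Longrightarrow> \<omega> \<in> space N \<Longrightarrow> \<phi> (grid_left n s) \<omega> \<le> w \<omega>"
    and lim: "AE \<omega> in N. AE s in lborel. 0 < s \<and> s \<le> T \<longrightarrow> (\<lambda>n. \<phi> (grid_left n s) \<omega>) \<longlonglongrightarrow> \<phi> s \<omega>"
  shows "(\<lambda>n. \<integral>\<^sup>+\<omega>. \<integral>\<^sup>+s. indicator {0<..T} s * \<phi> (grid_left n s) \<omega> \<partial>lborel \<partial>N)
    \<longlonglongrightarrow> (\<integral>\<^sup>+\<omega>. \<integral>\<^sup>+s. indicator {0<..T} s * \<phi> s \<omega> \<partial>lborel \<partial>N)"
proof -
  have g: "(\<lambda>x. indicator {0<..T} (snd x) * \<phi> (grid_left n (snd x)) (fst x)) \<in> borel_measurable (N \<Otimes>\<^sub>M lborel)" for n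
    using grid_joint_measurable[OF m, where n=n] by measurable
  have gs: "(\<lambda>s. indicator {0<..T} s * \<phi> (grid_left n s) \<omega>) \<in> borel_measurable lborel" if "\<omega> \<in> space N" for n \<omega>
    using measurable_Pair2[OF g that] by simp
  have fs: "(\<lambda>s. indicator {0<..T} s * \<phi> s \<omega>) \<in> borel_measurable lborel" if "\<omega> \<in> space N" for \<omega>
    using measurable_Pair2[OF m' that] by simp
  have gI: "(\<lambda>\<omega>. \<integral>\<^sup>+s. indicator {0<..T} s * \<phi> (grid_left n s) \<omega> \<partial>lborel) \<in> borel_measurable N" for n
    using lborel.borel_measurable_nn_integral_fst[OF g] by simp
  have fI: "(\<lambda>\<omega>. \<integral>\<^sup>+s. indicator {0<..T} s * \<phi> s \<omega> \<partial>lborel) \<in> borel_measurable N"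
    using lborel.borel_measurable_nn_integral_fst[OF m'] by simp
  have wT: "(\<integral>\<^sup>+s. indicator {0<..T} s * w \<omega> \<partial>lborel) = w \<omega> * ennreal T" for \<omega>
    using T by (subst nn_integral_multc) (auto simp: mult.commute)
  have fin: "AE \<omega> in N. w \<omega> < \<infinity>" using nn_integral_PInf_AE[OF w(1)] w(2) by (auto simp: less_top)
  show ?thesis
  proof (rule nn_integral_dominated_convergence[where w="\<lambda>\<omega>. w \<omega> * ennreal T"])
    show "AE \<omega> in N. (\<integral>\<^sup>+s. indicator {0<..T} s * \<phi> (grid_left n s) \<omega> \<partial>lborel) \<le> w \<omega> * ennreal T" for n
      unfolding wT[symmetric]
      by (intro AE_I2 nn_integral_mono) (auto split: split_indicator intro: dom)
    show "(\<integral>\<^sup>+\<omega>. w \<omega> * ennreal T \<partial>N) < \<infinity>" using w by (simp add: nn_integral_multc ennreal_mult_less_top)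
    show "AE \<omega> in N. (\<lambda>n. \<integral>\<^sup>+s. indicator {0<..T} s * \<phi> (grid_left n s) \<omega> \<partial>lborel)
       \<longlonglongrightarrow> (\<integral>\<^sup>+s. indicator {0<..T} s * \<phi> s \<omega> \<partial>lborel)"
      using lim fin AE_space
    proof eventually_elim
      case (elim \<omega>)
      show ?case
      proof (rule nn_integral_dominated_convergence[where w="\<lambda>s. indicator {0<..T} s * w \<omega>"])
        show "AE s in lborel. indicator {0<..T} s * \<phi> (grid_left n s) \<omega> \<le> indicator {0<..T} s * w \<omega>" for n
          by (intro AE_I2) (auto split: split_indicator intro: dom elim)
        show "AE s in lborel. (\<lambda>n. indicator {0<..T} s * \<phi> (grid_left n s) \<omega>) \<longlonglongrightarrow> indicator {0<..T} s * \<phi> s \<omega>"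
          using elim(1) by eventually_elim (auto split: split_indicator)
        show "(\<integral>\<^sup>+s. indicator {0<..T} s * w \<omega> \<partial>lborel) < \<infinity>"
          unfolding wT using elim(2) by (simp add: ennreal_mult_less_top)
      qed (use gs fs elim in auto)
    qed
  qed (use gI fI w in auto)
qed

section \<open>Regularity and joint measurability extracted from the definitions\<close>

lemma locally_lipschitz_continuous:
  fixes f :: "real \<Rightarrow> real"
  assumes "locally_lipschitz_family X {f}" "open X"
  shows "continuous_on X f"
proof -
  have "isCont f x" if x: "x \<in> X" for x
  proof -
    obtain u L where u: "0 < u" "L-lipschitz_on (cball x u \<inter> X) f"
      using assms(1) x by (auto simp: locally_lipschitz_family_def)
    have "continuous_on (ball x u \<inter> X) f"
      using lipschitz_on_continuous_on[OF u(2)] by (rule continuous_on_subset) auto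
    moreover have "open (ball x u \<inter> X)" "x \<in> ball x u \<inter> X" using assms(2) x u by auto
    ultimately show ?thesis using continuous_on_eq_continuous_at by blast
  qed
  then show ?thesis by (intro continuous_at_imp_continuous_on) auto
qed

lemma stochastic_basisD:
  assumes "stochastic_basis \<PP> F \<nu> W M"
  shows "prob_space \<PP>" "prob_space \<nu>" "poisson_random_measure \<PP> F \<nu> M" "\<And>t. space (F t) = space \<PP>"
proof -
  show "prob_space \<PP>" "prob_space \<nu>" "poisson_random_measure \<PP> F \<nu> M"
    using assms by (auto simp: stochastic_basis_def)
  have "F = augmented_filtration \<PP> \<nu> W M" using assms by (simp add: stochastic_basis_def)
  then show "space (F t) = space \<PP>" for t by (simp add: augmented_filtration_def space_measure_of_conv)
qed

lemma strong_solution_joint_measurable: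
  assumes basis: "stochastic_basis \<PP> F \<nu> W M"
    and sol: "strong_solution \<PP> F \<nu> W M bcap bpol om \<sigma> b \<mu> e \<alpha> k p y K P Y"
  shows "(\<lambda>x. K (max 0 (snd x)) (fst x)) \<in> borel_measurable (\<PP> \<Otimes>\<^sub>M lborel)"
    and "(\<lambda>x. P (max 0 (snd x)) (fst x)) \<in> borel_measurable (\<PP> \<Otimes>\<^sub>M lborel)"
    and "(\<lambda>x. Y (max 0 (snd x)) (fst x)) \<in> borel_measurable (\<PP> \<Otimes>\<^sub>M lborel)"
    and "intensity_coefficient \<mu> \<Longrightarrow> (\<lambda>x. \<mu> (P (max 0 (snd x)) (fst x))) \<in> borel_measurable (\<PP> \<Otimes>\<^sub>M lborel)"
proof -
  note sb = stochastic_basisD[OF basis]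
  have X: "(\<lambda>x. X (max 0 (snd x)) (fst x)) \<in> borel_measurable (\<PP> \<Otimes>\<^sub>M lborel)"
    if ad: "\<And>t. 0 \<le> t \<Longrightarrow> X t \<in> borel_measurable (F t)" and c: "\<And>\<omega>. \<omega> \<in> space \<PP> \<Longrightarrow> cadlag (\<lambda>t. X t \<omega>)" for X
  proof -
    have "0 \<le> t \<Longrightarrow> X t \<in> borel_measurable \<PP>" for t
      using measurable_from_filtration[OF sb(1,3,4)] ad by blast
    from joint_measurable_lborel[OF cadlag_joint_measurable[OF this c]] show ?thesis by simp
  qed
  show "(\<lambda>x. K (max 0 (snd x)) (fst x)) \<in> borel_measurable (\<PP> \<Otimes>\<^sub>M lborel)"
    "(\<lambda>x. Y (max 0 (snd x)) (fst x)) \<in> borel_measurable (\<PP> \<Otimes>\<^sub>M lborel)"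
    by (rule X; use sol in \<open>simp add: strong_solution_def\<close>)+
  show Pm: "(\<lambda>x. P (max 0 (snd x)) (fst x)) \<in> borel_measurable (\<PP> \<Otimes>\<^sub>M lborel)"
    by (rule X; use sol in \<open>simp add: strong_solution_def\<close>)
  assume "intensity_coefficient \<mu>"
  then have "continuous_on {0<..} \<mu>"
    by (auto simp: intensity_coefficient_def intro: locally_lipschitz_continuous)
  then show "(\<lambda>x. \<mu> (P (max 0 (snd x)) (fst x))) \<in> borel_measurable (\<PP> \<Otimes>\<^sub>M lborel)"
    using Pm by (rule continuous_borel_measurable_pos) (use sol in \<open>auto simp: space_pair_measure strong_solution_def\<close>)
qed

section \<open>One solution on a fixed horizon, for a general excitation function\<close>

context
  fixes \<PP> :: "'o measure" and F :: "real \<Rightarrow> 'o measure" and \<nu> :: "'z measure"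
    and W :: "real \<Rightarrow> 'o \<Rightarrow> real" and M :: "'o \<Rightarrow> (real \<times> 'z \<times> real) measure"
    and bcap bpol :: "real \<Rightarrow> real \<Rightarrow> real \<times> real \<Rightarrow> real"
    and om :: "real \<Rightarrow> real \<Rightarrow> 'z \<Rightarrow> real"
    and \<mu> :: "real \<Rightarrow> real" and e :: "'z \<Rightarrow> real"
    and \<sigma> b k p y T :: real and \<alpha> :: "real \<Rightarrow> 'o \<Rightarrow> real \<times> real"
    and K P Y :: "real \<Rightarrow> 'o \<Rightarrow> real"
  assumes basis: "stochastic_basis \<PP> F \<nu> W M"
    and mu: "intensity_coefficient \<mu>"
    and e: "excitation_coefficient \<nu> e"
    and b: "0 \<le> b" and T: "0 < T"
    and sol: "strong_solution \<PP> F \<nu> W M bcap bpol om \<sigma> b \<mu> e \<alpha> k p y K P Y"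
    and fa: "AE \<omega> in \<PP>. emeasure (hawkes_jumps \<nu> M \<mu> P Y \<omega>) ({0<..T} \<times> space \<nu>) < \<infinity>"
    and mom: "(\<integral>\<^sup>+\<omega>. (SUP t\<in>{0..T}. ennreal ((K t \<omega>)\<^sup>2 + (P t \<omega>)\<^sup>2 + (Y t \<omega>)\<^sup>2)) \<partial>\<PP>) < \<infinity>"
begin

private lemma prob: "prob_space \<PP>" and prob\<nu>: "prob_space \<nu>" and prm: "poisson_random_measure \<PP> F \<nu> M"
  and spF: "space (F t) = space \<PP>"
  using stochastic_basisD[OF basis] by auto

interpretation prob_space \<PP> by (rule prob)

private lemma c\<mu>: "continuous_on {0<..} \<mu>"
  using mu by (auto simp: intensity_coefficient_def intro: locally_lipschitz_continuous)

private lemma adapted: "0 \<le> t \<Longrightarrow> P t \<in> borel_measurable (F t)" "0 \<le> t \<Longrightarrow> Y t \<in> borel_measurable (F t)"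
  using sol by (auto simp: strong_solution_def)

private lemma meas: "0 \<le> t \<Longrightarrow> P t \<in> borel_measurable \<PP>" "0 \<le> t \<Longrightarrow> Y t \<in> borel_measurable \<PP>"
  using measurable_from_filtration[OF prob prm spF] adapted by blast+

private lemma cad: "\<omega> \<in> space \<PP> \<Longrightarrow> cadlag (\<lambda>t. P t \<omega>)" "\<omega> \<in> space \<PP> \<Longrightarrow> cadlag (\<lambda>t. Y t \<omega>)"
  using sol by (auto simp: strong_solution_def)

private lemma pos: "\<omega> \<in> space \<PP> \<Longrightarrow> 0 \<le> t \<Longrightarrow> 0 < P t \<omega>" "\<omega> \<in> space \<PP> \<Longrightarrow> 0 \<le> t \<Longrightarrow> 0 \<le> Y t \<omega>"
  using sol by (auto simp: strong_solution_def)

text \<open>Built from current values rather than left limits: at a grid point these are known to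
  the past, and along \<open>grid_left\<close> they tend to the intensity just before
  \<open>s\<close>.\<close>

private definition "lam t \<omega> = \<mu> (P t \<omega>) + Y t \<omega>"

private lemma lam_adapted: "0 \<le> t \<Longrightarrow> lam t \<in> borel_measurable (F t)"
  unfolding lam_def[abs_def]
  by (intro borel_measurable_add adapted continuous_borel_measurable_pos[OF c\<mu>]) (auto simp: spF pos)

private lemma lam_meas: "0 \<le> t \<Longrightarrow> lam t \<in> borel_measurable \<PP>"
  using measurable_from_filtration[OF prob prm spF] lam_adapted by blast

private lemma lam_nonneg: "\<omega> \<in> space \<PP> \<Longrightarrow> 0 \<le> t \<Longrightarrow> 0 \<le> lam t \<omega>"
  using mu pos by (auto simp: lam_def intensity_coefficient_def)

private lemma joint:
  "(\<lambda>x. P (max 0 (snd x)) (fst x)) \<in> borel_measurable (\<PP> \<Otimes>\<^sub>M lborel)"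
  "(\<lambda>x. Y (max 0 (snd x)) (fst x)) \<in> borel_measurable (\<PP> \<Otimes>\<^sub>M lborel)"
  "(\<lambda>x. lam (max 0 (snd x)) (fst x)) \<in> borel_measurable (\<PP> \<Otimes>\<^sub>M lborel)"
proof -
  note [measurable] = strong_solution_joint_measurable(2,3)[OF basis sol] strong_solution_joint_measurable(4)[OF basis sol mu]
  show "(\<lambda>x. P (max 0 (snd x)) (fst x)) \<in> borel_measurable (\<PP> \<Otimes>\<^sub>M lborel)"
    "(\<lambda>x. Y (max 0 (snd x)) (fst x)) \<in> borel_measurable (\<PP> \<Otimes>\<^sub>M lborel)"
    "(\<lambda>x. lam (max 0 (snd x)) (fst x)) \<in> borel_measurable (\<PP> \<Otimes>\<^sub>M lborel)"
    unfolding lam_def by measurable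
qed

text \<open>Joint measurability is available for processes frozen at negative times; the indicator
  makes the freezing invisible.\<close>

private lemma joint_on:
  assumes "f \<in> borel_measurable (borel \<Otimes>\<^sub>M borel)"
  shows "(\<lambda>x. indicator {0<..T} (snd x) * (f (Y (snd x) (fst x), lam (snd x) (fst x)) :: ennreal)) \<in> borel_measurable (\<PP> \<Otimes>\<^sub>M lborel)"
proof -
  note [measurable] = joint assms
  have "(\<lambda>x. indicator {0<..T} (snd x) * f (Y (max 0 (snd x)) (fst x), lam (max 0 (snd x)) (fst x))) \<in> borel_measurable (\<PP> \<Otimes>\<^sub>M lborel)"
    by measurable
  then show ?thesis by (rule measurable_cong[THEN iffD1, rotated]) (auto split: split_indicator)
qed

private definition "c1 = (\<integral>\<zeta>. e \<zeta> \<partial>\<nu>)"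
private definition "c2 = (\<integral>\<zeta>. (e \<zeta>)\<^sup>2 \<partial>\<nu>)"

private lemma c: "0 \<le> c1" "0 \<le> c2" "(\<integral>\<^sup>+\<zeta>. ennreal (e \<zeta>) \<partial>\<nu>) = ennreal c1" "(\<integral>\<^sup>+\<zeta>. ennreal ((e \<zeta>)\<^sup>2) \<partial>\<nu>) = ennreal c2"
  using e unfolding c1_def c2_def excitation_coefficient_def
  by (auto intro!: nn_integral_eq_integral integral_nonneg_AE)

text \<open>Compensator density of the squared process: the mean contribution of a jump in the
  present state times the intensity, the latter enlarged by the rounding excess 2.\<close>

private definition "\<phi> t \<omega> = ennreal ((2 * Y t \<omega> * c1 + c2) * (lam t \<omega> + 2))"

text \<open>The finite time integral serves twice: it makes almost every path of \<open>Y\<close>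
  square integrable on the horizon, and it allows the dissipation term to be cancelled later. It
  follows by exchanging the integrals and bounding each time by the running supremum.\<close>

lemma hawkes_second_moment_finite:
  "(\<integral>\<^sup>+\<omega>. \<integral>\<^sup>+s. indicator {0<..T} s * ennreal ((Y s \<omega>)\<^sup>2) \<partial>lborel \<partial>\<PP>) < \<infinity>"
  "(\<integral>\<^sup>+\<omega>. ennreal ((Y T \<omega>)\<^sup>2) \<partial>\<PP>) < \<infinity>"
proof -
  interpret PL: pair_sigma_finite \<PP> lborel ..
  define S where "S = (\<integral>\<^sup>+\<omega>. (SUP t\<in>{0..T}. ennreal ((K t \<omega>)\<^sup>2 + (P t \<omega>)\<^sup>2 + (Y t \<omega>)\<^sup>2)) \<partial>\<PP>)"
  note mom' = mom[folded S_def]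
  have le: "(\<integral>\<^sup>+\<omega>. ennreal ((Y s \<omega>)\<^sup>2) \<partial>\<PP>) \<le> S" if "s \<in> {0..T}" for s
    unfolding S_def by (intro nn_integral_mono SUP_upper2[OF that]) (auto intro: ennreal_leI)
  from le[of T] mom' T show "(\<integral>\<^sup>+\<omega>. ennreal ((Y T \<omega>)\<^sup>2) \<partial>\<PP>) < \<infinity>" by (auto intro: le_less_trans)
  have m: "(\<lambda>(\<omega>,s). indicator {0<..T} s * ennreal ((Y s \<omega>)\<^sup>2)) \<in> borel_measurable (\<PP> \<Otimes>\<^sub>M lborel)"
    using joint_on[of "\<lambda>x. ennreal ((fst x)\<^sup>2)"] by (simp add: case_prod_beta')
  have "(\<integral>\<^sup>+\<omega>. \<integral>\<^sup>+s. indicator {0<..T} s * ennreal ((Y s \<omega>)\<^sup>2) \<partial>lborel \<partial>\<PP>) =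
      (\<integral>\<^sup>+s. \<integral>\<^sup>+\<omega>. indicator {0<..T} s * ennreal ((Y s \<omega>)\<^sup>2) \<partial>\<PP> \<partial>lborel)"
    by (rule PL.Fubini'[symmetric, OF m])
  also have "\<dots> \<le> (\<integral>\<^sup>+s. indicator {0<..T} s * S \<partial>lborel)"
    by (intro nn_integral_mono) (auto split: split_indicator intro: le)
  also have "\<dots> = ennreal T * S" using T by (subst nn_integral_multc) auto
  also have "\<dots> < \<infinity>" using mom' by (simp add: ennreal_mult_less_top)
  finally show "(\<integral>\<^sup>+\<omega>. \<integral>\<^sup>+s. indicator {0<..T} s * ennreal ((Y s \<omega>)\<^sup>2) \<partial>lborel \<partial>\<PP>) < \<infinity>" .
qed

text \<open>The equation for \<open>P\<close> has no jump term: the drift integral and the Ito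
  integral are both continuous. Consequently the left limits of \<open>P\<close> are positive, which
  right continuity and positivity of the path alone would not ensure.\<close>

private lemma P_left_lim:
  "AE \<omega> in \<PP>. \<forall>s>0. left_lim (\<lambda>t. P t \<omega>) s = P s \<omega>"
proof -
  obtain I where I: "ito_integral \<PP> F W (\<lambda>t \<omega>. \<sigma> * P t \<omega>) I"
    and ae: "AE \<omega> in \<PP>. \<forall>t\<ge>0. set_integrable lborel {0..t} (\<lambda>s. bpol (K s \<omega>) (P s \<omega>) (\<alpha> s \<omega>)) \<and>
      P t \<omega> = p + (LBINT s:{0..t}. bpol (K s \<omega>) (P s \<omega>) (\<alpha> s \<omega>)) + I t \<omega>"
    using sol unfolding strong_solution_def Let_def
    by (elim conjE exE) (rule that, assumption, auto elim!: eventually_mono)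
  from ae AE_space show ?thesis
  proof eventually_elim
    case (elim \<omega>)
    show ?case
    proof (intro allI impI)
      fix s :: real assume s: "0 < s"
      have "continuous_on {0..} (\<lambda>t. I t \<omega>)" using I elim(2) by (auto simp: ito_integral_def)
      then have "isCont (\<lambda>t. I t \<omega>) s" using s by (intro continuous_on_interior) (auto simp: interior_real_atLeast)
      then have "((\<lambda>t. I t \<omega>) \<longlongrightarrow> I s \<omega>) (at_left s)" by (auto simp: isCont_def intro: tendsto_within_subset)
      then have "((\<lambda>t. p + (LBINT r:{0..t}. bpol (K r \<omega>) (P r \<omega>) (\<alpha> r \<omega>)) + I t \<omega>) \<longlongrightarrow>
          p + (LBINT r:{0..s}. bpol (K r \<omega>) (P r \<omega>) (\<alpha> r \<omega>)) + I s \<omega>) (at_left s)"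
        using elim(1) s by (intro tendsto_intros LBINT_tendsto_at_left) auto
      moreover have "\<forall>\<^sub>F t in at_left s. p + (LBINT r:{0..t}. bpol (K r \<omega>) (P r \<omega>) (\<alpha> r \<omega>)) + I t \<omega> = P t \<omega>"
        using eventually_at_left_real[OF s] by eventually_elim (use elim(1) in auto)
      ultimately have "((\<lambda>t. P t \<omega>) \<longlongrightarrow> p + (LBINT r:{0..s}. bpol (K r \<omega>) (P r \<omega>) (\<alpha> r \<omega>)) + I s \<omega>) (at_left s)"
        by (rule Lim_transform_eventually)
      then have "left_lim (\<lambda>t. P t \<omega>) s = p + (LBINT r:{0..s}. bpol (K r \<omega>) (P r \<omega>) (\<alpha> r \<omega>)) + I s \<omega>"
        using s by (rule left_lim_eqI)
      also have "\<dots> = P s \<omega>" using elim(1) s by simp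
      finally show "left_lim (\<lambda>t. P t \<omega>) s = P s \<omega>" .
    qed
  qed
qed

text \<open>The two clauses on left limits are kept for the passage to the limit along the grid. In
  the inequality the Bochner integral of the squared path is replaced by a nonnegative integral,
  legitimate wherever that integral is finite, hence almost surely.\<close>

private lemma path_bound:
  "AE \<omega> in \<PP>. (\<forall>s>0. left_lim (\<lambda>t. P t \<omega>) s = P s \<omega>) \<and>
     (AE s in lborel. s \<in> {0<..T} \<longrightarrow> left_lim (\<lambda>t. Y t \<omega>) s = Y s \<omega>) \<and>
     ennreal ((Y T \<omega>)\<^sup>2) + (\<integral>\<^sup>+s. indicator {0<..T} s * ennreal (2 * b * (Y s \<omega>)\<^sup>2) \<partial>lborel) \<le>
     ennreal (y\<^sup>2) + (\<integral>\<^sup>+(s,\<zeta>,r). indicator {0<..T} s * ennreal (2 * e \<zeta> * left_lim (\<lambda>t. Y t \<omega>) s + (e \<zeta>)\<^sup>2) *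
       indicator {..\<mu> (left_lim (\<lambda>t. P t \<omega>) s) + left_lim (\<lambda>t. Y t \<omega>) s} r \<partial>M \<omega>)"
proof -
  have ae: "AE \<omega> in \<PP>. \<forall>t\<ge>0.
      set_integrable (hawkes_jumps \<nu> M \<mu> P Y \<omega>) ({0<..t} \<times> space \<nu>) (\<lambda>(s, \<zeta>). e \<zeta>) \<and>
      Y t \<omega> = y - (LBINT s:{0..t}. b * Y s \<omega>) + (LINT (s, \<zeta>):({0<..t} \<times> space \<nu>)|hawkes_jumps \<nu> M \<mu> P Y \<omega>. e \<zeta>)"
    using sol unfolding strong_solution_def Let_def by (auto elim!: eventually_mono)
  have mI: "(\<lambda>\<omega>. \<integral>\<^sup>+s. indicator {0<..T} s * ennreal ((Y s \<omega>)\<^sup>2) \<partial>lborel) \<in> borel_measurable \<PP>"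
    using lborel.borel_measurable_nn_integral_fst[OF joint_on[of "\<lambda>x. ennreal ((fst x)\<^sup>2)"]] by simp
  have fin: "AE \<omega> in \<PP>. (\<integral>\<^sup>+s. indicator {0<..T} s * ennreal ((Y s \<omega>)\<^sup>2) \<partial>lborel) \<noteq> \<infinity>"
    using nn_integral_PInf_AE[OF mI] hawkes_second_moment_finite(1) by auto
  from ae fin P_left_lim AE_poisson_no_simultaneous_atoms[OF prob prob\<nu> prm] fa AE_space show ?thesis
  proof eventually_elim
    case (elim \<omega>)
    note \<omega> = elim(6)
    have mY: "(\<lambda>s. indicator {0..T} s * Y s \<omega>) \<in> borel_measurable lborel"
    proof -
      have "(\<lambda>s. Y (max 0 s) \<omega>) \<in> borel_measurable lborel" using measurable_Pair2[OF joint(2) \<omega>] by simp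
      then have "(\<lambda>s. indicator {0..T} s * Y (max 0 s) \<omega>) \<in> borel_measurable lborel" by measurable
      then show ?thesis by (rule measurable_cong[THEN iffD1, rotated]) (auto split: split_indicator)
    qed
    \<comment> \<open>Time 0 is null: the half-open interval fits the grid cells, the closed one the
      drift integrals.\<close>
    have eqI: "(\<integral>\<^sup>+s. indicator {0<..T} s * ennreal (a * (Y s \<omega>)\<^sup>2) \<partial>lborel) =
        (\<integral>\<^sup>+s. ennreal (a * (indicator {0..T} s * Y s \<omega>)\<^sup>2) \<partial>lborel)" for a
      by (rule nn_integral_cong_AE, use AE_lborel_singleton[of 0] in eventually_elim) (auto split: split_indicator)
    have sqi: "integrable lborel (\<lambda>s. (indicator {0..T} s * Y s \<omega>)\<^sup>2)"
    proof (rule integrableI_nonneg)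
      show "(\<integral>\<^sup>+s. ennreal ((indicator {0..T} s * Y s \<omega>)\<^sup>2) \<partial>lborel) < \<infinity>"
        using elim(2) eqI[of 1] by (simp add: less_top)
    qed (use mY in auto)
    have i1: "integrable lborel (indicator {0..T} :: real \<Rightarrow> real)" using T by (intro integrable_real_indicator) (auto simp: emeasure_lborel_Icc)
    have "integrable lborel (\<lambda>s. indicator {0..T} s * Y s \<omega>)"
    proof (rule Bochner_Integration.integrable_bound[OF Bochner_Integration.integrable_add[OF i1 sqi] mY])
      \<comment> \<open>On a bounded interval this bound turns square integrability into
        integrability.\<close>
      have "\<bar>z\<bar> \<le> 1 + z\<^sup>2" for z :: real
        using zero_le_power2[of "\<bar>z\<bar> - 1"] abs_ge_zero[of z] by (simp add: power2_diff)
      then show "AE s in lborel. norm (indicator {0..T} s * Y s \<omega>) \<le> norm (indicator {0..T} s + (indicator {0..T} s * Y s \<omega>)\<^sup>2)"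
        by (intro AE_I2) (auto split: split_indicator)
    qed
    then have Yint: "set_integrable lborel {0..T} (\<lambda>s. Y s \<omega>)" by (simp add: set_integrable_def)
    have a1: "emeasure (M \<omega>) ({s} \<times> (space \<nu> \<times> {0..r})) \<le> 1" if "0 < s" for s r using elim(4) that by blast
    have a2: "0 < P t \<omega> \<and> 0 \<le> Y t \<omega>" if "0 \<le> t" for t using pos[OF \<omega> that] by blast
    have a3: "left_lim (\<lambda>t. P t \<omega>) s = P s \<omega>" if "0 < s" for s using elim(3) that by blast
    have a4: "e \<in> borel_measurable \<nu>" "\<And>\<zeta>. \<zeta> \<in> space \<nu> \<Longrightarrow> 0 \<le> e \<zeta>" using e by (auto simp: excitation_coefficient_def)
    have a5: "emeasure (hawkes_jumps \<nu> M \<mu> P Y \<omega>) ({0<..T} \<times> space \<nu>) < \<infinity>" by (rule elim(5))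
    have a6: "set_integrable (hawkes_jumps \<nu> M \<mu> P Y \<omega>) ({0<..T} \<times> space \<nu>) (\<lambda>(s,\<zeta>). e \<zeta>)" using elim(1) T by simp
    have a7: "Y t \<omega> = y - (LBINT s:{0..t}. b * Y s \<omega>) + (LINT (s, \<zeta>):({0<..t} \<times> space \<nu>)|hawkes_jumps \<nu> M \<mu> P Y \<omega>. e \<zeta>)"
      if "0 \<le> t" "t \<le> T" for t using elim(1) that by blast
    note pl = path_square_le_left_lim_AE[OF sets_poisson(1)[OF prm \<omega>] a1 cad(1)[OF \<omega>] cad(2)[OF \<omega>] a2 a3 c\<mu> a4 T refl hawkes_jumps_def a5 Yint a6 a7]
    have L: "(LBINT s:{0..T}. b * Y s \<omega> * Y s \<omega>) = (\<integral>s. b * (indicator {0..T} s * Y s \<omega>)\<^sup>2 \<partial>lborel)"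
      unfolding set_lebesgue_integral_def
      by (intro Bochner_Integration.integral_cong) (auto simp: power2_eq_square split: split_indicator)
    have "ennreal ((Y T \<omega>)\<^sup>2) + (\<integral>\<^sup>+s. indicator {0<..T} s * ennreal (2 * b * (Y s \<omega>)\<^sup>2) \<partial>lborel) =
        ennreal ((Y T \<omega>)\<^sup>2) + ennreal (\<integral>s. 2 * b * (indicator {0..T} s * Y s \<omega>)\<^sup>2 \<partial>lborel)"
      unfolding eqI using b sqi by (subst nn_integral_eq_integral) auto
    also have "\<dots> = ennreal ((Y T \<omega>)\<^sup>2 + 2 * (LBINT s:{0..T}. b * Y s \<omega> * Y s \<omega>))"
      unfolding L using b by (subst ennreal_plus[symmetric]) (auto intro!: integral_nonneg_AE)
    finally show ?case using pl a3 by simp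
  qed
qed


text \<open>Rounding up by at least 1 makes the integer level at the left grid point eventually exceed the
  intensity at \<open>s-\<close>, so that no atom below the intensity is lost in the limit; the excess of at
  most 2 is absorbed later.\<close>

private definition "lev t \<omega> = nat \<lfloor>lam t \<omega>\<rfloor> + 2"

private lemma lev_adapted: "0 \<le> t \<Longrightarrow> lev t \<in> measurable (F t) (count_space UNIV)"
  unfolding lev_def[abs_def] using lam_adapted[of t] by measurable

private lemma lev_bounds:
  assumes "\<omega> \<in> space \<PP>" "0 \<le> t"
  shows "lam t \<omega> + 1 \<le> real (lev t \<omega>)" "real (lev t \<omega>) \<le> lam t \<omega> + 2"
  using lam_nonneg[OF assms] unfolding lev_def by linarith+

text \<open>The integrand \<open>2 * e \<zeta> * Y + (e \<zeta>)\<^sup>2\<close> is not a product of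
  a time factor and a mark factor, which the grid formula requires; hence the separation into a part
  linear and a part quadratic in the jump size.\<close>

private definition "jumps1 n \<omega> = (\<lambda>(s,\<zeta>,r). indicator {0<..T} s * ennreal (2 * Y (grid_left n s) \<omega>) * ennreal (e \<zeta>) *
  indicator {..real (lev (grid_left n s) \<omega>)} r)"

private definition "jumps2 n \<omega> = (\<lambda>(s,\<zeta>,r). indicator {0<..T} s * 1 * ennreal ((e \<zeta>)\<^sup>2) *
  indicator {..real (lev (grid_left n s) \<omega>)} r)"

private lemma e_meas: "(\<lambda>\<zeta>. ennreal (e \<zeta>)) \<in> borel_measurable \<nu>" "(\<lambda>\<zeta>. ennreal ((e \<zeta>)\<^sup>2)) \<in> borel_measurable \<nu>"
  using e by (auto simp: excitation_coefficient_def)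

private lemma twoY: "0 \<le> t \<Longrightarrow> (\<lambda>\<omega>. ennreal (2 * Y t \<omega>)) \<in> borel_measurable (F t)"
  using adapted(2) by measurable

private lemma jumps1:
  "(\<lambda>\<omega>. \<integral>\<^sup>+x. jumps1 n \<omega> x \<partial>M \<omega>) \<in> borel_measurable \<PP>"
  "\<omega> \<in> space \<PP> \<Longrightarrow> jumps1 n \<omega> \<in> borel_measurable (M \<omega>)"
  "(\<integral>\<^sup>+\<omega>. \<integral>\<^sup>+x. jumps1 n \<omega> x \<partial>M \<omega> \<partial>\<PP>) =
     (\<integral>\<^sup>+\<omega>. \<integral>\<^sup>+s. indicator {0<..T} s * (ennreal (2 * Y (grid_left n s) \<omega>) * of_nat (lev (grid_left n s) \<omega>)) \<partial>lborel \<partial>\<PP>) * ennreal c1"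
  using nn_integral_poisson_grid[where T=T and n=n, OF prob prob\<nu> prm spF twoY lev_adapted e_meas(1)]
  unfolding c(3) jumps1_def by simp_all

private lemma jumps2:
  "(\<lambda>\<omega>. \<integral>\<^sup>+x. jumps2 n \<omega> x \<partial>M \<omega>) \<in> borel_measurable \<PP>"
  "\<omega> \<in> space \<PP> \<Longrightarrow> jumps2 n \<omega> \<in> borel_measurable (M \<omega>)"
  "(\<integral>\<^sup>+\<omega>. \<integral>\<^sup>+x. jumps2 n \<omega> x \<partial>M \<omega> \<partial>\<PP>) =
     (\<integral>\<^sup>+\<omega>. \<integral>\<^sup>+s. indicator {0<..T} s * (1 * of_nat (lev (grid_left n s) \<omega>)) \<partial>lborel \<partial>\<PP>) * ennreal c2"
  using nn_integral_poisson_grid[where H="\<lambda>_ _. 1" and T=T and n=n, OF prob prob\<nu> prm spF _ lev_adapted e_meas(2)]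
  unfolding c(4) jumps2_def by simp_all

text \<open>Fatou's lemma with respect to \<open>M \<omega>\<close> at a single sample point. It
  applies because at every mark the limit inferior of the grid integrands dominates the true
  integrand.\<close>

private lemma path_bound_grid:
  "AE \<omega> in \<PP>. ennreal ((Y T \<omega>)\<^sup>2) + (\<integral>\<^sup>+s. indicator {0<..T} s * ennreal (2 * b * (Y s \<omega>)\<^sup>2) \<partial>lborel) \<le>
     ennreal (y\<^sup>2) + liminf (\<lambda>n. (\<integral>\<^sup>+x. jumps1 n \<omega> x \<partial>M \<omega>) + (\<integral>\<^sup>+x. jumps2 n \<omega> x \<partial>M \<omega>))"
  using path_bound AE_space
proof eventually_elim
  case (elim \<omega>)
  note \<omega> = elim(2)
  let ?P = "left_lim (\<lambda>t. P t \<omega>)" and ?Y = "left_lim (\<lambda>t. Y t \<omega>)"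
  have pw: "indicator {0<..T} s * ennreal (2 * e \<zeta> * ?Y s + (e \<zeta>)\<^sup>2) * indicator {..\<mu> (?P s) + ?Y s} r
     \<le> liminf (\<lambda>n. jumps1 n \<omega> (s,\<zeta>,r) + jumps2 n \<omega> (s,\<zeta>,r))" if \<zeta>: "\<zeta> \<in> space \<nu>" for s \<zeta> r
  proof (cases "0 < s \<and> s \<le> T \<and> r \<le> \<mu> (?P s) + ?Y s")
    case True
    then have s: "0 < s" by simp
    have e0: "0 \<le> e \<zeta>" using e \<zeta> by (auto simp: excitation_coefficient_def)
    have Yl: "(\<lambda>n. Y (grid_left n s) \<omega>) \<longlonglongrightarrow> ?Y s" by (rule cadlag_grid_left[OF cad(2)[OF \<omega>] s])
    have Pl: "(\<lambda>n. P (grid_left n s) \<omega>) \<longlonglongrightarrow> ?P s" by (rule cadlag_grid_left[OF cad(1)[OF \<omega>] s])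
    \<comment> \<open>Continuity of \<mu> is known at positive points, and the left limit of
      \<open>P\<close> is one of them because it equals the value at \<open>s\<close>.\<close>
    have "0 < ?P s" using elim(1) s pos(1)[OF \<omega>, of s] by simp
    then have "isCont \<mu> (?P s)" using c\<mu> by (intro continuous_on_interior) (auto simp: interior_open)
    from isCont_tendsto_compose[OF this Pl] Yl have "(\<lambda>n. lam (grid_left n s) \<omega>) \<longlonglongrightarrow> \<mu> (?P s) + ?Y s"
      unfolding lam_def by (rule tendsto_add)
    \<comment> \<open>The slack of 1 is the rounding surplus in \<open>lev\<close>. It makes mere
      convergence of \<open>lam\<close> sufficient, even when \<open>r\<close> equals the
      threshold.\<close>
    then have "\<forall>\<^sub>F n in sequentially. \<mu> (?P s) + ?Y s - 1 < lam (grid_left n s) \<omega>"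
      by (rule order_tendstoD(1)) simp
    then have ev: "\<forall>\<^sub>F n in sequentially. ennreal (2 * e \<zeta> * Y (grid_left n s) \<omega> + (e \<zeta>)\<^sup>2) = jumps1 n \<omega> (s,\<zeta>,r) + jumps2 n \<omega> (s,\<zeta>,r)"
    proof eventually_elim
      case (elim n)
      have g0: "0 \<le> grid_left n s" by (rule grid_left_bounds(1)[OF s])
      have "r \<le> real (lev (grid_left n s) \<omega>)" using lev_bounds(1)[OF \<omega> g0] elim True by linarith
      then have "jumps1 n \<omega> (s,\<zeta>,r) + jumps2 n \<omega> (s,\<zeta>,r) = ennreal (2 * Y (grid_left n s) \<omega>) * ennreal (e \<zeta>) + ennreal ((e \<zeta>)\<^sup>2)"
        using True by (simp add: jumps1_def jumps2_def)
      also have "\<dots> = ennreal (2 * e \<zeta> * Y (grid_left n s) \<omega> + (e \<zeta>)\<^sup>2)"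
        using pos(2)[OF \<omega> g0] e0 by (simp add: ennreal_mult[symmetric] ennreal_plus[symmetric] mult_ac del: ennreal_plus)
      finally show ?case by simp
    qed
    have "(\<lambda>n. ennreal (2 * e \<zeta> * Y (grid_left n s) \<omega> + (e \<zeta>)\<^sup>2)) \<longlonglongrightarrow> ennreal (2 * e \<zeta> * ?Y s + (e \<zeta>)\<^sup>2)"
      by (intro tendsto_ennrealI tendsto_intros Yl)
    from lim_imp_Liminf[OF _ Lim_transform_eventually[OF this ev]]
    show ?thesis using True by simp
  next
    case False
    then show ?thesis by (auto simp: indicator_def)
  qed
  have "(\<integral>\<^sup>+(s,\<zeta>,r). indicator {0<..T} s * ennreal (2 * e \<zeta> * ?Y s + (e \<zeta>)\<^sup>2) * indicator {..\<mu> (?P s) + ?Y s} r \<partial>M \<omega>)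
     \<le> (\<integral>\<^sup>+x. liminf (\<lambda>n. jumps1 n \<omega> x + jumps2 n \<omega> x) \<partial>M \<omega>)"
    using sets_poisson(2)[OF prm \<omega>] by (intro nn_integral_mono) (auto intro!: pw)
  also have "\<dots> \<le> liminf (\<lambda>n. \<integral>\<^sup>+x. jumps1 n \<omega> x + jumps2 n \<omega> x \<partial>M \<omega>)"
    using jumps1(2)[OF \<omega>] jumps2(2)[OF \<omega>] by (intro nn_integral_liminf) measurable
  also have "(\<lambda>n. \<integral>\<^sup>+x. jumps1 n \<omega> x + jumps2 n \<omega> x \<partial>M \<omega>) = (\<lambda>n. (\<integral>\<^sup>+x. jumps1 n \<omega> x \<partial>M \<omega>) + (\<integral>\<^sup>+x. jumps2 n \<omega> x \<partial>M \<omega>))"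
    using jumps1(2)[OF \<omega>] jumps2(2)[OF \<omega>] by (intro ext nn_integral_add)
  finally show ?case using elim(1) by (meson add_left_mono order_trans)
qed

text \<open>The grid expectations are exact; the only loss is the replacement of the integer level
  by its upper bound \<open>lam t \<omega> + 2\<close>.\<close>

private lemma jumps_expectation_le:
  "(\<integral>\<^sup>+\<omega>. (\<integral>\<^sup>+x. jumps1 n \<omega> x \<partial>M \<omega>) + (\<integral>\<^sup>+x. jumps2 n \<omega> x \<partial>M \<omega>) \<partial>\<PP>)
    \<le> (\<integral>\<^sup>+\<omega>. \<integral>\<^sup>+s. indicator {0<..T} s * \<phi> (grid_left n s) \<omega> \<partial>lborel \<partial>\<PP>)"
proof -
  have levm: "0 \<le> t \<Longrightarrow> lev t \<in> measurable \<PP> (count_space UNIV)" for t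
    using measurable_from_filtration[OF prob prm spF] lev_adapted by blast
  let ?a1 = "\<lambda>\<omega> s. indicator {0<..T} s * (ennreal (2 * Y (grid_left n s) \<omega>) * of_nat (lev (grid_left n s) \<omega>))"
  let ?a2 = "\<lambda>\<omega> s. indicator {0<..T} s * (1 * of_nat (lev (grid_left n s) \<omega>)) :: ennreal"
  have [measurable]: "(\<lambda>x. Y (grid_left n (snd x)) (fst x)) \<in> borel_measurable (\<PP> \<Otimes>\<^sub>M lborel)"
    by (rule grid_joint_measurable[OF meas(2)])
  have [measurable]: "(\<lambda>x. lev (grid_left n (snd x)) (fst x)) \<in> measurable (\<PP> \<Otimes>\<^sub>M lborel) (count_space UNIV)"
    by (rule grid_joint_measurable[OF levm])
  let ?b1 = "\<lambda>\<omega>. \<integral>\<^sup>+s. ?a1 \<omega> s \<partial>lborel" and ?b2 = "\<lambda>\<omega>. \<integral>\<^sup>+s. ?a2 \<omega> s \<partial>lborel"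
  have a: "case_prod ?a1 \<in> borel_measurable (\<PP> \<Otimes>\<^sub>M lborel)" "case_prod ?a2 \<in> borel_measurable (\<PP> \<Otimes>\<^sub>M lborel)"
    unfolding case_prod_beta' by measurable
  note ai = a[THEN lborel.borel_measurable_nn_integral]
  have as: "?a1 \<omega> \<in> borel_measurable lborel" "?a2 \<omega> \<in> borel_measurable lborel" if "\<omega> \<in> space \<PP>" for \<omega>
    using measurable_Pair2[OF a(1) that] measurable_Pair2[OF a(2) that] by simp_all
  have "(\<integral>\<^sup>+\<omega>. (\<integral>\<^sup>+x. jumps1 n \<omega> x \<partial>M \<omega>) + (\<integral>\<^sup>+x. jumps2 n \<omega> x \<partial>M \<omega>) \<partial>\<PP>) =
    (\<integral>\<^sup>+\<omega>. ?b1 \<omega> \<partial>\<PP>) * ennreal c1 + (\<integral>\<^sup>+\<omega>. ?b2 \<omega> \<partial>\<PP>) * ennreal c2"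
    unfolding jumps1(3)[symmetric] jumps2(3)[symmetric] by (rule nn_integral_add[OF jumps1(1) jumps2(1)])
  also have "\<dots> = (\<integral>\<^sup>+\<omega>. ?b1 \<omega> * ennreal c1 + ?b2 \<omega> * ennreal c2 \<partial>\<PP>)"
    using ai by (subst nn_integral_add) (auto simp: nn_integral_multc)
  also have "\<dots> = (\<integral>\<^sup>+\<omega>. \<integral>\<^sup>+s. ?a1 \<omega> s * ennreal c1 + ?a2 \<omega> s * ennreal c2 \<partial>lborel \<partial>\<PP>)"
    using as by (intro nn_integral_cong) (simp add: nn_integral_add nn_integral_multc)
  also have "\<dots> \<le> (\<integral>\<^sup>+\<omega>. \<integral>\<^sup>+s. indicator {0<..T} s * \<phi> (grid_left n s) \<omega> \<partial>lborel \<partial>\<PP>)"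
  proof (intro nn_integral_mono)
    fix \<omega> s assume \<omega>: "\<omega> \<in> space \<PP>"
    show "?a1 \<omega> s * ennreal c1 + ?a2 \<omega> s * ennreal c2 \<le> indicator {0<..T} s * \<phi> (grid_left n s) \<omega>"
    proof (cases "s \<in> {0<..T}")
      case True
      let ?t = "grid_left n s" and ?l = "real (lev (grid_left n s) \<omega>)"
      have t: "0 \<le> ?t" using True by (intro grid_left_bounds(1)) auto
      have "?a1 \<omega> s * ennreal c1 + ?a2 \<omega> s * ennreal c2 =
        ennreal (2 * Y ?t \<omega> * ?l * c1 + ?l * c2)"
        using True c(1,2) pos(2)[OF \<omega> t]
        by (simp add: ennreal_of_nat_eq_real_of_nat ennreal_mult[symmetric] ennreal_plus[symmetric] del: ennreal_plus)
      also have "2 * Y ?t \<omega> * ?l * c1 + ?l * c2 = (2 * Y ?t \<omega> * c1 + c2) * real (lev ?t \<omega>)"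
        by (simp add: algebra_simps)
      also have "\<dots> \<le> (2 * Y ?t \<omega> * c1 + c2) * (lam ?t \<omega> + 2)"
        using lev_bounds(2)[OF \<omega> t] c(1,2) pos(2)[OF \<omega> t] by (intro mult_left_mono) auto
      finally show ?thesis using True by (simp add: \<phi>_def ennreal_leI)
    qed simp
  qed
  finally show ?thesis .
qed

text \<open>By linear growth of \<mu> the density is at most quadratic in \<open>P\<close> and
  \<open>Y\<close>, so the moment of the running supremum dominates it. Pointwise convergence holds
  at almost every time only, namely where \<open>Y\<close> does not jump.\<close>

private lemma \<phi>_grid_tendsto:
  "(\<lambda>n. \<integral>\<^sup>+\<omega>. \<integral>\<^sup>+s. indicator {0<..T} s * \<phi> (grid_left n s) \<omega> \<partial>lborel \<partial>\<PP>)
    \<longlonglongrightarrow> (\<integral>\<^sup>+\<omega>. \<integral>\<^sup>+s. indicator {0<..T} s * \<phi> s \<omega> \<partial>lborel \<partial>\<PP>)"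
proof -
  obtain L where L: "0 < L" "\<And>x. 0 < x \<Longrightarrow> \<mu> x \<le> L * (1 + x)"
    using mu by (auto simp: intensity_coefficient_def)
  \<comment> \<open>The factors \<open>2 * c1 + c2\<close> and \<open>L + 3\<close> bound the two
    factors of the density by multiples of 1 + P + Y; the 3 comes from squaring this sum of three
    terms.\<close>
  define C where "C = 3 * (2 * c1 + c2) * (L + 3)"
  have C: "0 \<le> C" using L c by (simp add: C_def)
  \<comment> \<open>Grid points are rational, so a supremum over rational times is a majorant, and
    being countable it is measurable.\<close>
  define R where "R = \<rat> \<inter> {0..T}"
  have R: "countable R" "R \<subseteq> {0..T}" by (auto simp: R_def countable_rat)
  define w0 where "w0 \<omega> = (SUP q\<in>R. ennreal ((P q \<omega>)\<^sup>2 + (Y q \<omega>)\<^sup>2))" for \<omega>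
  have w0m: "w0 \<in> borel_measurable \<PP>"
    unfolding w0_def[abs_def] using R meas by (intro borel_measurable_SUP) auto
  have w0f: "(\<integral>\<^sup>+\<omega>. w0 \<omega> \<partial>\<PP>) < \<infinity>"
  proof (rule le_less_trans[OF nn_integral_mono mom])
    show "w0 \<omega> \<le> (SUP t\<in>{0..T}. ennreal ((K t \<omega>)\<^sup>2 + (P t \<omega>)\<^sup>2 + (Y t \<omega>)\<^sup>2))" for \<omega>
      unfolding w0_def using R by (intro SUP_mono) (auto intro!: bexI ennreal_leI simp del: ennreal_plus)
  qed
  define w where "w \<omega> = ennreal C * (1 + w0 \<omega>)" for \<omega>
  show ?thesis
  proof (rule nn_integral_grid_tendsto[where w=w])
    show "\<phi> t \<in> borel_measurable \<PP>" if "0 \<le> t" for t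
      using meas[OF that] lam_meas[OF that] unfolding \<phi>_def[abs_def] by measurable
    show "(\<lambda>x. indicator {0<..T} (snd x) * \<phi> (snd x) (fst x)) \<in> borel_measurable (\<PP> \<Otimes>\<^sub>M lborel)"
      unfolding \<phi>_def using joint_on[of "\<lambda>x. ennreal ((2 * fst x * c1 + c2) * (snd x + 2))"] by simp
    show "w \<in> borel_measurable \<PP>" unfolding w_def using w0m by measurable
    show "(\<integral>\<^sup>+\<omega>. w \<omega> \<partial>\<PP>) < \<infinity>"
      unfolding w_def using w0m w0f by (simp add: nn_integral_cmult nn_integral_add emeasure_space_1 ennreal_mult_less_top)
    show "0 \<le> T" using T by simp
    show "\<phi> (grid_left n s) \<omega> \<le> w \<omega>" if s: "0 < s" "s \<le> T" and \<omega>: "\<omega> \<in> space \<PP>" for n s \<omega>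
    proof -
      define t where "t = grid_left n s"
      have t: "t \<in> R" "0 \<le> t" using grid_left_bounds[OF s(1), of n] s by (auto simp: R_def t_def)
      let ?y = "Y t \<omega>" and ?p = "P t \<omega>"
      have yp: "0 \<le> ?y" "0 < ?p" using pos[OF \<omega> t(2)] by auto
      have "lam t \<omega> + 2 \<le> L * (1 + ?p) + ?y + 2" using L(2)[OF yp(2)] by (simp add: lam_def)
      also have "\<dots> \<le> (L + 3) * (1 + ?p + ?y)" using L(1) yp by (simp add: algebra_simps)
      finally have 1: "lam t \<omega> + 2 \<le> (L + 3) * (1 + ?p + ?y)" .
      have 2: "2 * ?y * c1 + c2 \<le> (2 * c1 + c2) * (1 + ?p + ?y)"
      proof -
        have "0 \<le> c1 * 2 + c1 * ?p * 2 + c2 * ?p + c2 * ?y" using c yp by simp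
        then show ?thesis by (simp add: algebra_simps)
      qed
      have 3: "(1 + ?p + ?y)\<^sup>2 \<le> 3 * (1 + ?p\<^sup>2 + ?y\<^sup>2)"
      proof -
        have "0 \<le> (1 - ?p)\<^sup>2 + (1 - ?y)\<^sup>2 + (?p - ?y)\<^sup>2" by simp
        then show ?thesis by (simp add: power2_eq_square algebra_simps)
      qed
      have "(2 * ?y * c1 + c2) * (lam t \<omega> + 2) \<le> ((2 * c1 + c2) * (1 + ?p + ?y)) * ((L + 3) * (1 + ?p + ?y))"
        using 1 2 c yp L(1) lam_nonneg[OF \<omega> t(2)] by (intro mult_mono) auto
      also have "\<dots> = ((2 * c1 + c2) * (L + 3)) * (1 + ?p + ?y)\<^sup>2" by (simp add: power2_eq_square)
      also have "\<dots> \<le> ((2 * c1 + c2) * (L + 3)) * (3 * (1 + ?p\<^sup>2 + ?y\<^sup>2))"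
        using 3 c L(1) by (intro mult_left_mono) auto
      also have "\<dots> = C * (1 + (?p\<^sup>2 + ?y\<^sup>2))" by (simp add: C_def algebra_simps)
      finally have "\<phi> t \<omega> \<le> ennreal (C * (1 + (?p\<^sup>2 + ?y\<^sup>2)))" unfolding \<phi>_def by (rule ennreal_leI)
      also have "\<dots> = ennreal C * (1 + ennreal (?p\<^sup>2 + ?y\<^sup>2))"
        using C by (subst ennreal_mult) simp_all
      also have "\<dots> \<le> w \<omega>"
        unfolding w_def w0_def using t(1) by (intro mult_left_mono add_left_mono SUP_upper) auto
      finally show ?thesis by (simp add: t_def)
    qed
    show "AE \<omega> in \<PP>. AE s in lborel. 0 < s \<and> s \<le> T \<longrightarrow> (\<lambda>n. \<phi> (grid_left n s) \<omega>) \<longlonglongrightarrow> \<phi> s \<omega>"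
      using path_bound AE_space
    proof eventually_elim
      case (elim \<omega>)
      note \<omega> = elim(2)
      have "AE s in lborel. s \<in> {0<..T} \<longrightarrow> left_lim (\<lambda>t. Y t \<omega>) s = Y s \<omega>" using elim(1) by blast
      then show ?case
      proof eventually_elim
        case (elim s)
        show ?case
        proof
          assume s: "0 < s \<and> s \<le> T"
          then have s0: "0 < s" by simp
          have Yl: "(\<lambda>n. Y (grid_left n s) \<omega>) \<longlonglongrightarrow> Y s \<omega>"
            using cadlag_grid_left[OF cad(2)[OF \<omega>] s0] elim s by simp
          have "left_lim (\<lambda>t. P t \<omega>) s = P s \<omega>" using \<open>(\<forall>s>0. _ s = _ s) \<and> _\<close> s0 by blast
          then have Pl: "(\<lambda>n. P (grid_left n s) \<omega>) \<longlonglongrightarrow> P s \<omega>"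
            using cadlag_grid_left[OF cad(1)[OF \<omega>] s0] by simp
          have "isCont \<mu> (P s \<omega>)" using c\<mu> pos(1)[OF \<omega>, of s] s0 by (intro continuous_on_interior) (auto simp: interior_open)
          from isCont_tendsto_compose[OF this Pl] have "(\<lambda>n. \<mu> (P (grid_left n s) \<omega>)) \<longlonglongrightarrow> \<mu> (P s \<omega>)" .
          then show "(\<lambda>n. \<phi> (grid_left n s) \<omega>) \<longlonglongrightarrow> \<phi> s \<omega>"
            unfolding \<phi>_def lam_def by (intro tendsto_ennrealI tendsto_intros Yl)
        qed
      qed
    qed
  qed
qed

text \<open>Fatou's lemma is used a second time, now under \<PP>, and on the right the limit
  inferior is a true limit by dominated convergence. The 2 in the last factor is the surviving
  rounding excess.\<close>

lemma hawkes_square_bound: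
  "(\<integral>\<^sup>+\<omega>. ennreal ((Y T \<omega>)\<^sup>2) \<partial>\<PP>) + (\<integral>\<^sup>+\<omega>. \<integral>\<^sup>+s. indicator {0<..T} s * ennreal (2 * b * (Y s \<omega>)\<^sup>2) \<partial>lborel \<partial>\<PP>)
    \<le> ennreal (y\<^sup>2) + (\<integral>\<^sup>+\<omega>. \<integral>\<^sup>+s. indicator {0<..T} s *
        ennreal ((2 * Y s \<omega> * (\<integral>\<zeta>. e \<zeta> \<partial>\<nu>) + (\<integral>\<zeta>. (e \<zeta>)\<^sup>2 \<partial>\<nu>)) * (\<mu> (P s \<omega>) + Y s \<omega> + 2)) \<partial>lborel \<partial>\<PP>)"
proof -
  let ?G = "\<lambda>n \<omega>. (\<integral>\<^sup>+x. jumps1 n \<omega> x \<partial>M \<omega>) + (\<integral>\<^sup>+x. jumps2 n \<omega> x \<partial>M \<omega>)"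
  let ?L = "\<lambda>\<omega>. \<integral>\<^sup>+s. indicator {0<..T} s * ennreal (2 * b * (Y s \<omega>)\<^sup>2) \<partial>lborel"
  have G: "?G n \<in> borel_measurable \<PP>" for n using jumps1(1)[of n] jumps2(1)[of n] by measurable
  have lG: "(\<lambda>\<omega>. liminf (\<lambda>n. ?G n \<omega>)) \<in> borel_measurable \<PP>" using G by (rule borel_measurable_liminf)
  have mI: "(\<lambda>\<omega>. ?L \<omega>) \<in> borel_measurable \<PP>"
    using lborel.borel_measurable_nn_integral_fst[OF joint_on[of "\<lambda>x. ennreal (2 * b * (fst x)\<^sup>2)"]] by simp
  have mY: "(\<lambda>\<omega>. ennreal ((Y T \<omega>)\<^sup>2)) \<in> borel_measurable \<PP>" using meas(2)[of T] T by simp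
  have "(\<integral>\<^sup>+\<omega>. ennreal ((Y T \<omega>)\<^sup>2) \<partial>\<PP>) + (\<integral>\<^sup>+\<omega>. ?L \<omega> \<partial>\<PP>)
     = (\<integral>\<^sup>+\<omega>. ennreal ((Y T \<omega>)\<^sup>2) + ?L \<omega> \<partial>\<PP>)"
    by (rule nn_integral_add[symmetric, OF mY mI])
  also have "\<dots> \<le> (\<integral>\<^sup>+\<omega>. ennreal (y\<^sup>2) + liminf (\<lambda>n. ?G n \<omega>) \<partial>\<PP>)"
    by (rule nn_integral_mono_AE[OF path_bound_grid])
  also have "\<dots> = ennreal (y\<^sup>2) + (\<integral>\<^sup>+\<omega>. liminf (\<lambda>n. ?G n \<omega>) \<partial>\<PP>)"
    by (subst nn_integral_add[OF _ lG]) (simp_all add: emeasure_space_1)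
  also have "(\<integral>\<^sup>+\<omega>. liminf (\<lambda>n. ?G n \<omega>) \<partial>\<PP>) \<le> liminf (\<lambda>n. \<integral>\<^sup>+\<omega>. ?G n \<omega> \<partial>\<PP>)"
    by (rule nn_integral_liminf[OF G])
  also have "\<dots> \<le> liminf (\<lambda>n. \<integral>\<^sup>+\<omega>. \<integral>\<^sup>+s. indicator {0<..T} s * \<phi> (grid_left n s) \<omega> \<partial>lborel \<partial>\<PP>)"
    by (intro Liminf_mono always_eventually allI jumps_expectation_le)
  also have "\<dots> = (\<integral>\<^sup>+\<omega>. \<integral>\<^sup>+s. indicator {0<..T} s * \<phi> s \<omega> \<partial>lborel \<partial>\<PP>)"
    by (rule lim_imp_Liminf[OF _ \<phi>_grid_tendsto]) simp
  finally show ?thesis unfolding \<phi>_def lam_def c1_def c2_def by (simp add: add_left_mono)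
qed

end

section \<open>Discounted moments\<close>

lemma nn_integral_exp_atLeast:
  assumes \<rho>: "0 < \<rho>"
  shows "(\<integral>\<^sup>+t. indicator {s..} t * ennreal (exp (- \<rho> * t)) \<partial>lborel) = ennreal (exp (- \<rho> * s) / \<rho>)"
proof -
  have "(\<integral>\<^sup>+t. ennreal (exp (- \<rho> * t)) * indicator {s..} t \<partial>lborel) = 0 - (- exp (- \<rho> * s) / \<rho>)"
  proof (rule nn_integral_FTC_atLeast)
    show "((\<lambda>t. - exp (- \<rho> * t) / \<rho>) has_real_derivative exp (- \<rho> * t)) (at t)" for t
      using \<rho> by (auto intro!: derivative_eq_intros)
    have "((\<lambda>t. exp (- (\<rho> * t))) \<longlongrightarrow> 0) at_top"
      using \<rho> by (intro filterlim_compose[OF exp_at_bot] filterlim_uminus_at_bot_at_top[THEN filterlim_compose])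
        (auto intro!: filterlim_tendsto_pos_mult_at_top[OF tendsto_const] filterlim_ident)
    then have "((\<lambda>t. - exp (- \<rho> * t) / \<rho>) \<longlongrightarrow> - 0 / \<rho>) at_top"
      using \<rho> by (intro tendsto_intros) auto
    then show "((\<lambda>t. - exp (- \<rho> * t) / \<rho>) \<longlongrightarrow> 0) at_top" by simp
  qed auto
  then show ?thesis by (simp add: mult.commute)
qed

text \<open>By Tonelli each time \<open>s\<close> is collected over all later \<open>t\<close>, and
  the exponential integrated from \<open>s\<close> on is \<open>exp (- \<rho> * s) / \<rho>\<close>.
  After discounting, an additional time integral thus costs a factor
  \<open>1 / \<rho>\<close>.\<close>

lemma laplace_primitive_le:
  assumes \<rho>: "0 < \<rho>" and h[measurable]: "h \<in> borel_measurable lborel"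
  shows "(\<integral>\<^sup>+t. indicator {0..} t * (ennreal (exp (- \<rho> * t)) * (\<integral>\<^sup>+s. indicator {0<..t} s * h s \<partial>lborel)) \<partial>lborel)
    \<le> ennreal (1 / \<rho>) * (\<integral>\<^sup>+s. indicator {0..} s * (ennreal (exp (- \<rho> * s)) * h s) \<partial>lborel)"
proof -
  let ?D = "indicator {x :: real \<times> real. 0 < fst x \<and> fst x \<le> snd x} :: _ \<Rightarrow> ennreal"
  have [measurable]: "{x :: real \<times> real. 0 < fst x \<and> fst x \<le> snd x} \<in> sets (lborel \<Otimes>\<^sub>M lborel)"
  proof -
    have "Measurable.pred (lborel \<Otimes>\<^sub>M lborel) (\<lambda>x :: real \<times> real. 0 < fst x \<and> fst x \<le> snd x)" by measurable
    then show ?thesis by (simp add: pred_def space_pair_measure)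
  qed
  have "(\<integral>\<^sup>+t. indicator {0..} t * (ennreal (exp (- \<rho> * t)) * (\<integral>\<^sup>+s. indicator {0<..t} s * h s \<partial>lborel)) \<partial>lborel)
    = (\<integral>\<^sup>+t. \<integral>\<^sup>+s. ennreal (exp (- \<rho> * t)) * (?D (s,t) * h s) \<partial>lborel \<partial>lborel)"
  proof (rule nn_integral_cong)
    fix t :: real
    have "(\<integral>\<^sup>+s. ennreal (exp (- \<rho> * t)) * (?D (s,t) * h s) \<partial>lborel)
      = ennreal (exp (- \<rho> * t)) * (\<integral>\<^sup>+s. indicator {0<..t} s * h s \<partial>lborel)"
      by (subst nn_integral_cmult[symmetric]) (auto intro!: nn_integral_cong split: split_indicator)
    moreover have "(\<integral>\<^sup>+s. indicator {0<..t} s * h s \<partial>lborel) = 0" if "t < 0"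
      using that by simp
    ultimately show "indicator {0..} t * (ennreal (exp (- \<rho> * t)) * (\<integral>\<^sup>+s. indicator {0<..t} s * h s \<partial>lborel))
      = (\<integral>\<^sup>+s. ennreal (exp (- \<rho> * t)) * (?D (s,t) * h s) \<partial>lborel)"
      by (cases "t < 0") (auto split: split_indicator)
  qed
  also have "\<dots> = (\<integral>\<^sup>+s. \<integral>\<^sup>+t. ennreal (exp (- \<rho> * t)) * (?D (s,t) * h s) \<partial>lborel \<partial>lborel)"
    by (rule lborel_pair.Fubini') measurable
  also have "\<dots> \<le> (\<integral>\<^sup>+s. ennreal (1 / \<rho>) * (indicator {0..} s * (ennreal (exp (- \<rho> * s)) * h s)) \<partial>lborel)"
  proof (rule nn_integral_mono)
    fix s :: real
    show "(\<integral>\<^sup>+t. ennreal (exp (- \<rho> * t)) * (?D (s,t) * h s) \<partial>lborel)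
      \<le> ennreal (1 / \<rho>) * (indicator {0..} s * (ennreal (exp (- \<rho> * s)) * h s))"
    proof (cases "0 < s")
      case True
      have "(\<integral>\<^sup>+t. ennreal (exp (- \<rho> * t)) * (?D (s,t) * h s) \<partial>lborel)
        = (\<integral>\<^sup>+t. indicator {s..} t * ennreal (exp (- \<rho> * t)) * h s \<partial>lborel)"
        using True by (intro nn_integral_cong) (auto split: split_indicator)
      also have "\<dots> = ennreal (exp (- \<rho> * s) / \<rho>) * h s"
        by (subst nn_integral_multc) (simp_all add: nn_integral_exp_atLeast[OF \<rho>, simplified])
      also have "ennreal (exp (- \<rho> * s) / \<rho>) = ennreal (1 / \<rho>) * ennreal (exp (- \<rho> * s))"
        using \<rho> by (subst ennreal_mult[symmetric]) auto
      finally show ?thesis using True by (simp add: mult.assoc)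
    qed simp
  qed
  also have "\<dots> = ennreal (1 / \<rho>) * (\<integral>\<^sup>+s. indicator {0..} s * (ennreal (exp (- \<rho> * s)) * h s) \<partial>lborel)"
    by (rule nn_integral_cmult) measurable
  finally show ?thesis .
qed

section \<open>Calculus of the discounted expectation\<close>

lemma discounted_expectation_alt:
  assumes "prob_space \<PP>"
    and m: "(\<lambda>x. G (max 0 (snd x)) (fst x)) \<in> borel_measurable (\<PP> \<Otimes>\<^sub>M lborel)"
  shows "discounted_expectation \<PP> \<rho> G = (\<integral>\<^sup>+t. indicator {0..} t * (ennreal (exp (- \<rho> * t)) * (\<integral>\<^sup>+\<omega>. ennreal (G (max 0 t) \<omega>) \<partial>\<PP>)) \<partial>lborel)"
proof -
  interpret prob_space \<PP> by fact
  interpret PL: pair_sigma_finite \<PP> lborel ..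
  note [measurable] = m
  have Gt: "(\<lambda>\<omega>. ennreal (G (max 0 t) \<omega>)) \<in> borel_measurable \<PP>" for t
    using measurable_Pair1[OF m, of t] by simp
  have eq: "ennreal (exp (- \<rho> * t) * G t \<omega>) * indicator {0..} t
      = indicator {0..} t * (ennreal (exp (- \<rho> * t)) * ennreal (G (max 0 t) \<omega>))" for t \<omega>
    by (simp add: ennreal_mult' split: split_indicator)
  have "discounted_expectation \<PP> \<rho> G = (\<integral>\<^sup>+t. \<integral>\<^sup>+\<omega>. indicator {0..} t * (ennreal (exp (- \<rho> * t)) * ennreal (G (max 0 t) \<omega>)) \<partial>\<PP> \<partial>lborel)"
    unfolding discounted_expectation_def eq
    by (rule PL.Fubini'[symmetric]) (simp add: case_prod_beta')
  then show ?thesis using Gt by (simp add: nn_integral_cmult)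
qed

text \<open>Measurability is asked of the two majorants, which have to be added; for
  \<open>G\<close> itself monotonicity of the integral is enough.\<close>

lemma discounted_expectation_le:
  assumes "prob_space \<PP>"
    and m1: "(\<lambda>x. G1 (max 0 (snd x)) (fst x)) \<in> borel_measurable (\<PP> \<Otimes>\<^sub>M lborel)"
    and m2: "(\<lambda>x. G2 (max 0 (snd x)) (fst x)) \<in> borel_measurable (\<PP> \<Otimes>\<^sub>M lborel)"
    and c: "0 \<le> c1" "0 \<le> c2"
    and le: "\<And>t \<omega>. 0 \<le> t \<Longrightarrow> \<omega> \<in> space \<PP> \<Longrightarrow> 0 \<le> G1 t \<omega> \<and> 0 \<le> G2 t \<omega> \<and> G t \<omega> \<le> c1 * G1 t \<omega> + c2 * G2 t \<omega>"
  shows "discounted_expectation \<PP> \<rho> G \<le> ennreal c1 * discounted_expectation \<PP> \<rho> G1 + ennreal c2 * discounted_expectation \<PP> \<rho> G2"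
proof -
  interpret prob_space \<PP> by fact
  have m: "(\<lambda>x. ennreal (exp (- \<rho> * snd x) * H (snd x) (fst x)) * indicator {0..} (snd x)) \<in> borel_measurable (\<PP> \<Otimes>\<^sub>M lborel)"
    if [measurable]: "(\<lambda>x. H (max 0 (snd x)) (fst x)) \<in> borel_measurable (\<PP> \<Otimes>\<^sub>M lborel)" for H
  proof -
    have "(\<lambda>x. ennreal (exp (- \<rho> * snd x) * H (max 0 (snd x)) (fst x)) * indicator {0..} (snd x)) \<in> borel_measurable (\<PP> \<Otimes>\<^sub>M lborel)"
      by measurable
    then show ?thesis by (rule measurable_cong[THEN iffD1, rotated]) (auto split: split_indicator)
  qed
  let ?f = "\<lambda>H \<omega> t. ennreal (exp (- \<rho> * t) * H t \<omega>) * indicator {0..} t"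
  have mt: "?f G1 \<omega> \<in> borel_measurable lborel" "?f G2 \<omega> \<in> borel_measurable lborel" if "\<omega> \<in> space \<PP>" for \<omega>
    using measurable_Pair2[OF m[OF m1] that] measurable_Pair2[OF m[OF m2] that] by simp_all
  have mw: "(\<lambda>\<omega>. \<integral>\<^sup>+t. ?f G1 \<omega> t \<partial>lborel) \<in> borel_measurable \<PP>" "(\<lambda>\<omega>. \<integral>\<^sup>+t. ?f G2 \<omega> t \<partial>lborel) \<in> borel_measurable \<PP>"
    using lborel.borel_measurable_nn_integral_fst[OF m[OF m1]] lborel.borel_measurable_nn_integral_fst[OF m[OF m2]] by simp_all
  have "discounted_expectation \<PP> \<rho> G \<le> (\<integral>\<^sup>+\<omega>. \<integral>\<^sup>+t. ennreal c1 * ?f G1 \<omega> t + ennreal c2 * ?f G2 \<omega> t \<partial>lborel \<partial>\<PP>)"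
    unfolding discounted_expectation_def
  proof (intro nn_integral_mono)
    fix \<omega> t assume \<omega>: "\<omega> \<in> space \<PP>"
    show "?f G \<omega> t \<le> ennreal c1 * ?f G1 \<omega> t + ennreal c2 * ?f G2 \<omega> t"
    proof (cases "0 \<le> t")
      case True
      note l = le[OF True \<omega>]
      have "exp (- \<rho> * t) * G t \<omega> \<le> exp (- \<rho> * t) * (c1 * G1 t \<omega> + c2 * G2 t \<omega>)"
        using l by (intro mult_left_mono) auto
      also have "\<dots> = c1 * (exp (- \<rho> * t) * G1 t \<omega>) + c2 * (exp (- \<rho> * t) * G2 t \<omega>)" by (simp add: algebra_simps)
      finally have "ennreal (exp (- \<rho> * t) * G t \<omega>) \<le> ennreal (c1 * (exp (- \<rho> * t) * G1 t \<omega>) + c2 * (exp (- \<rho> * t) * G2 t \<omega>))"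
        by (rule ennreal_leI)
      also have "\<dots> = ennreal c1 * ennreal (exp (- \<rho> * t) * G1 t \<omega>) + ennreal c2 * ennreal (exp (- \<rho> * t) * G2 t \<omega>)"
        using c l by (simp add: ennreal_mult)
      finally show ?thesis using True by simp
    qed simp
  qed
  also have "\<dots> = (\<integral>\<^sup>+\<omega>. ennreal c1 * (\<integral>\<^sup>+t. ?f G1 \<omega> t \<partial>lborel) + ennreal c2 * (\<integral>\<^sup>+t. ?f G2 \<omega> t \<partial>lborel) \<partial>\<PP>)"
    using mt by (intro nn_integral_cong) (simp add: nn_integral_add nn_integral_cmult)
  also have "\<dots> = ennreal c1 * discounted_expectation \<PP> \<rho> G1 + ennreal c2 * discounted_expectation \<PP> \<rho> G2"
    unfolding discounted_expectation_def using mw by (simp add: nn_integral_add nn_integral_cmult)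
  finally show ?thesis .
qed

lemma discounted_expectation_one:
  assumes "prob_space \<PP>" "0 < \<rho>"
  shows "discounted_expectation \<PP> \<rho> (\<lambda>_ _. 1) = ennreal (1 / \<rho>)"
proof -
  interpret prob_space \<PP> by fact
  show ?thesis
    using nn_integral_exp_atLeast[OF assms(2), of 0]
    by (simp add: discounted_expectation_def mult.commute emeasure_space_1)
qed

text \<open>The three summands are the remainders of the three estimates in the absorption argument,
  with \<open>m\<close> the baseline intensity and the shift by 2 the rounding excess: the product
  of \<open>Y\<close> with \<open>m + 2\<close>, the term linear in \<open>Y\<close> coming from
  \<open>a2\<close>, and the term free of \<open>Y\<close>. The 8 and the 3 come from
  \<open>(m + 2)\<^sup>2 \<le> 8 * (1 + m\<^sup>2)\<close> and
  \<open>m + 2 \<le> 3 * (1 + m\<^sup>2)\<close>.\<close>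

definition absorption_const :: "real \<Rightarrow> real \<Rightarrow> real \<Rightarrow> real \<Rightarrow> real" where
  "absorption_const b \<eta>0 a1 a2 = 8 * a1\<^sup>2 / (b - \<eta>0 * a1) + \<eta>0\<^sup>2 * a2\<^sup>2 / (4 * (b - \<eta>0 * a1)) + 3 * a2"

lemma absorption_const_nonneg: "\<eta>0 * a1 < b \<Longrightarrow> 0 \<le> a2 \<Longrightarrow> 0 \<le> absorption_const b \<eta>0 a1 a2"
  by (simp add: absorption_const_def)

text \<open>Young's inequality: since \<open>\<eta> a\<^sub>1 < b\<close>, the dissipation \<open>2 b x\<^sup>2\<close> absorbs every term that is quadratic or
  linear in \<open>x = Y\<close>, at the price of a remainder of order \<open>\<eta>\<^sup>2\<close>.\<close>

lemma excitation_absorption: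
  fixes a1 a2 b \<eta> \<eta>0 x m :: real
  assumes "0 \<le> a1" "0 \<le> a2" "0 < \<eta>" "\<eta> \<le> \<eta>0" "\<eta>0 * a1 < b" "0 \<le> x" "0 \<le> m"
  shows "(2 * x * (\<eta> * a1) + \<eta>\<^sup>2 * a2) * (m + x + 2)
    \<le> 2 * b * x\<^sup>2 + \<eta>\<^sup>2 * absorption_const b \<eta>0 a1 a2 * (1 + m\<^sup>2)"
proof -
  \<comment> \<open>The gap is spent twice:
    \<open>2 * b = 2 * (\<eta>0 * a1) + 2 * \<kappa>\<close>, where the first summand takes the
    genuinely quadratic term and one \<kappa> goes to each of the two terms linear in
    \<open>x\<close>.\<close>
  define \<kappa> where "\<kappa> = b - \<eta>0 * a1"
  have k: "0 < \<kappa>" using assms by (simp add: \<kappa>_def)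
  have young: "2 * u * v \<le> \<kappa> * u\<^sup>2 + v\<^sup>2 / \<kappa>" for u v
  proof -
    have "0 \<le> (\<kappa> * u - v)\<^sup>2 / \<kappa>" using k by simp
    also have "\<dots> = \<kappa> * u\<^sup>2 + v\<^sup>2 / \<kappa> - 2 * u * v" using k by (simp add: power2_eq_square field_simps)
    finally show ?thesis by simp
  qed
  have m8: "(m + 2)\<^sup>2 \<le> 8 * (1 + m\<^sup>2)"
  proof -
    have "0 \<le> (m - 1)\<^sup>2 * 2 + 5 * m\<^sup>2 + 2" by simp
    then show ?thesis by (simp add: power2_eq_square algebra_simps)
  qed
  have m3: "m + 2 \<le> 3 * (1 + m\<^sup>2)"
  proof -
    have "0 \<le> (m - 1)\<^sup>2 + 2 * m\<^sup>2 + m" using assms(7) by simp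
    then show ?thesis by (simp add: power2_eq_square algebra_simps)
  qed
  have t1: "2 * x * (\<eta> * a1 * (m + 2)) \<le> \<kappa> * x\<^sup>2 + \<eta>\<^sup>2 * (8 * a1\<^sup>2 / \<kappa>) * (1 + m\<^sup>2)"
  proof -
    have "(\<eta> * a1 * (m + 2))\<^sup>2 / \<kappa> = \<eta>\<^sup>2 * a1\<^sup>2 / \<kappa> * (m + 2)\<^sup>2" by (simp add: power_mult_distrib)
    also have "\<dots> \<le> \<eta>\<^sup>2 * a1\<^sup>2 / \<kappa> * (8 * (1 + m\<^sup>2))" using k by (intro mult_left_mono[OF m8]) simp
    also have "\<dots> = \<eta>\<^sup>2 * (8 * a1\<^sup>2 / \<kappa>) * (1 + m\<^sup>2)" by simp
    finally show ?thesis by (rule order_trans[OF young add_left_mono])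
  qed
  have t2: "\<eta>\<^sup>2 * a2 * x \<le> \<kappa> * x\<^sup>2 + \<eta>\<^sup>2 * (\<eta>0\<^sup>2 * a2\<^sup>2 / (4 * \<kappa>)) * (1 + m\<^sup>2)"
  proof -
    have "(\<eta>\<^sup>2 * a2 / 2)\<^sup>2 / \<kappa> = \<eta>\<^sup>2 * \<eta>\<^sup>2 * (a2\<^sup>2 / (4 * \<kappa>))" by (simp add: power2_eq_square)
    also have "\<dots> \<le> \<eta>\<^sup>2 * \<eta>0\<^sup>2 * (a2\<^sup>2 / (4 * \<kappa>))"
      using k assms by (intro mult_right_mono mult_left_mono power_mono) auto
    also have "\<dots> = \<eta>\<^sup>2 * (\<eta>0\<^sup>2 * a2\<^sup>2 / (4 * \<kappa>)) * 1" by simp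
    also have "\<dots> \<le> \<eta>\<^sup>2 * (\<eta>0\<^sup>2 * a2\<^sup>2 / (4 * \<kappa>)) * (1 + m\<^sup>2)" using k by (intro mult_left_mono) auto
    finally show ?thesis using young[of x "\<eta>\<^sup>2 * a2 / 2"] by (simp add: mult_ac)
  qed
  have t3: "\<eta>\<^sup>2 * a2 * (m + 2) \<le> \<eta>\<^sup>2 * (3 * a2) * (1 + m\<^sup>2)"
  proof -
    have "\<eta>\<^sup>2 * a2 * (m + 2) \<le> \<eta>\<^sup>2 * a2 * (3 * (1 + m\<^sup>2))" using assms by (intro mult_left_mono[OF m3]) simp
    also have "\<dots> = \<eta>\<^sup>2 * (3 * a2) * (1 + m\<^sup>2)" by (simp only: mult_ac)
    finally show ?thesis .
  qed
  have t4: "2 * (\<eta> * a1) * x\<^sup>2 \<le> 2 * (\<eta>0 * a1) * x\<^sup>2"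
    using assms by (intro mult_right_mono mult_left_mono) auto
  have "(2 * x * (\<eta> * a1) + \<eta>\<^sup>2 * a2) * (m + x + 2) =
     2 * (\<eta> * a1) * x\<^sup>2 + 2 * x * (\<eta> * a1 * (m + 2)) + \<eta>\<^sup>2 * a2 * x + \<eta>\<^sup>2 * a2 * (m + 2)"
    by (simp add: power2_eq_square algebra_simps)
  also have "\<dots> \<le> 2 * (\<eta>0 * a1) * x\<^sup>2 + (\<kappa> * x\<^sup>2 + \<eta>\<^sup>2 * (8 * a1\<^sup>2 / \<kappa>) * (1 + m\<^sup>2)) +
     (\<kappa> * x\<^sup>2 + \<eta>\<^sup>2 * (\<eta>0\<^sup>2 * a2\<^sup>2 / (4 * \<kappa>)) * (1 + m\<^sup>2)) + \<eta>\<^sup>2 * (3 * a2) * (1 + m\<^sup>2)"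
    by (intro add_mono t1 t2 t3 t4)
  also have "\<dots> = 2 * (\<eta>0 * a1 + \<kappa>) * x\<^sup>2 + \<eta>\<^sup>2 * (8 * a1\<^sup>2 / \<kappa> + \<eta>0\<^sup>2 * a2\<^sup>2 / (4 * \<kappa>) + 3 * a2) * (1 + m\<^sup>2)"
    by (simp only: distrib_left distrib_right mult_2 add_ac)
  finally show ?thesis by (simp add: \<kappa>_def absorption_const_def)
qed

text \<open>Once the compensator is bounded by the absorption inequality, the dissipation term
  stands on both sides and cancels. Apart from the initial value, everything left carries a factor
  \<open>\<eta>\<^sup>2\<close>.\<close>

lemma hawkes_second_moment_le:
  fixes \<eta> \<eta>0 b :: real
  assumes basis: "stochastic_basis \<PP> F \<nu> W M"
    and mu: "intensity_coefficient \<mu>"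
    and a: "excitation_coefficient \<nu> a"
    and b: "0 \<le> b" and T: "0 < T"
    and \<eta>: "0 < \<eta>" "\<eta> \<le> \<eta>0" and sub: "\<eta>0 * (\<integral>\<zeta>. a \<zeta> \<partial>\<nu>) < b"
    and sol: "strong_solution \<PP> F \<nu> W M bcap bpol om \<sigma> b \<mu> (\<lambda>\<zeta>. \<eta> * a \<zeta>) \<alpha> k p y K P Y"
    and fa: "AE \<omega> in \<PP>. emeasure (hawkes_jumps \<nu> M \<mu> P Y \<omega>) ({0<..T} \<times> space \<nu>) < \<infinity>"
    and mom: "(\<integral>\<^sup>+\<omega>. (SUP t\<in>{0..T}. ennreal ((K t \<omega>)\<^sup>2 + (P t \<omega>)\<^sup>2 + (Y t \<omega>)\<^sup>2)) \<partial>\<PP>) < \<infinity>"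
  defines "C \<equiv> absorption_const b \<eta>0 (\<integral>\<zeta>. a \<zeta> \<partial>\<nu>) (\<integral>\<zeta>. (a \<zeta>)\<^sup>2 \<partial>\<nu>)"
  shows "(\<integral>\<^sup>+\<omega>. ennreal ((Y T \<omega>)\<^sup>2) \<partial>\<PP>) \<le> ennreal (y\<^sup>2) +
    ennreal (\<eta>\<^sup>2 * C) * (\<integral>\<^sup>+s. indicator {0<..T} s * (\<integral>\<^sup>+\<omega>. ennreal (1 + (\<mu> (P (max 0 s) \<omega>))\<^sup>2) \<partial>\<PP>) \<partial>lborel)"
proof -
  note sb = stochastic_basisD[OF basis]
  interpret prob_space \<PP> by (rule sb)
  interpret PL: pair_sigma_finite \<PP> lborel ..
  define a1 where "a1 = (\<integral>\<zeta>. a \<zeta> \<partial>\<nu>)"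
  define a2 where "a2 = (\<integral>\<zeta>. (a \<zeta>)\<^sup>2 \<partial>\<nu>)"
  have a12: "0 \<le> a1" "0 \<le> a2"
    using a unfolding a1_def a2_def excitation_coefficient_def by (auto intro!: integral_nonneg_AE)
  have C: "0 \<le> C" using absorption_const_nonneg[OF sub] a12 by (simp add: C_def a2_def)
  have ea: "excitation_coefficient \<nu> (\<lambda>\<zeta>. \<eta> * a \<zeta>)"
    using a \<eta> by (auto simp: excitation_coefficient_def power_mult_distrib)
  have e12: "(\<integral>\<zeta>. \<eta> * a \<zeta> \<partial>\<nu>) = \<eta> * a1" "(\<integral>\<zeta>. (\<eta> * a \<zeta>)\<^sup>2 \<partial>\<nu>) = \<eta>\<^sup>2 * a2"
    by (simp_all add: a1_def a2_def power_mult_distrib)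
  note jm = strong_solution_joint_measurable[OF basis sol]
  note [measurable] = jm(3) jm(4)[OF mu]
  let ?X = "\<integral>\<^sup>+\<omega>. \<integral>\<^sup>+s. indicator {0<..T} s * ennreal (2 * b * (Y s \<omega>)\<^sup>2) \<partial>lborel \<partial>\<PP>"
  let ?h = "\<lambda>\<omega> s. indicator {0<..T} s * ennreal (1 + (\<mu> (P (max 0 s) \<omega>))\<^sup>2)"
  let ?y = "\<lambda>\<omega> s. indicator {0<..T} s * ennreal ((Y (max 0 s) \<omega>)\<^sup>2)"
  let ?Z = "\<integral>\<^sup>+\<omega>. ennreal ((Y T \<omega>)\<^sup>2) \<partial>\<PP>" and ?HH = "\<integral>\<^sup>+\<omega>. \<integral>\<^sup>+s. ?h \<omega> s \<partial>lborel \<partial>\<PP>"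
    and ?q = "\<lambda>\<omega> s. (2 * Y s \<omega> * (\<eta> * a1) + \<eta>\<^sup>2 * a2) * (\<mu> (P s \<omega>) + Y s \<omega> + 2)"
  have mh: "case_prod ?h \<in> borel_measurable (\<PP> \<Otimes>\<^sub>M lborel)" "case_prod ?y \<in> borel_measurable (\<PP> \<Otimes>\<^sub>M lborel)"
    unfolding case_prod_beta' by measurable
  have mhs: "?h \<omega> \<in> borel_measurable lborel" "?y \<omega> \<in> borel_measurable lborel" if "\<omega> \<in> space \<PP>" for \<omega>
    using measurable_Pair2[OF mh(1) that] measurable_Pair2[OF mh(2) that] by simp_all
  note mhw = mh[THEN lborel.borel_measurable_nn_integral]
  have Xeq: "?X = ennreal (2 * b) * (\<integral>\<^sup>+\<omega>. \<integral>\<^sup>+s. ?y \<omega> s \<partial>lborel \<partial>\<PP>)"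
  proof -
    have "?X = (\<integral>\<^sup>+\<omega>. \<integral>\<^sup>+s. ennreal (2 * b) * ?y \<omega> s \<partial>lborel \<partial>\<PP>)"
      using b by (intro nn_integral_cong) (auto simp: ennreal_mult split: split_indicator)
    also have "\<dots> = (\<integral>\<^sup>+\<omega>. ennreal (2 * b) * (\<integral>\<^sup>+s. ?y \<omega> s \<partial>lborel) \<partial>\<PP>)"
      using mhs(2) by (intro nn_integral_cong nn_integral_cmult)
    also have "\<dots> = ennreal (2 * b) * (\<integral>\<^sup>+\<omega>. \<integral>\<^sup>+s. ?y \<omega> s \<partial>lborel \<partial>\<PP>)"
      using mhw(2) by (rule nn_integral_cmult)
    finally show ?thesis .
  qed
  have "(\<integral>\<^sup>+\<omega>. \<integral>\<^sup>+s. ?y \<omega> s \<partial>lborel \<partial>\<PP>) = (\<integral>\<^sup>+\<omega>. \<integral>\<^sup>+s. indicator {0<..T} s * ennreal ((Y s \<omega>)\<^sup>2) \<partial>lborel \<partial>\<PP>)"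
    by (intro nn_integral_cong) (auto split: split_indicator)
  also have "\<dots> < \<infinity>"
    by (rule hawkes_second_moment_finite(1)[OF basis mu ea b T sol fa mom])
  \<comment> \<open>The moment hypothesis enters here: in \<open>ennreal\<close> a term may be
    cancelled only if it is finite.\<close>
  finally have Xfin: "?X \<noteq> \<infinity>" unfolding Xeq by (simp add: ennreal_mult_eq_top_iff)
  have "?X + ?Z \<le> ennreal (y\<^sup>2) + (\<integral>\<^sup>+\<omega>. \<integral>\<^sup>+s. indicator {0<..T} s *
        ennreal (?q \<omega> s) \<partial>lborel \<partial>\<PP>)"
    using hawkes_square_bound[OF basis mu ea b T sol fa mom] unfolding e12 by (simp add: add.commute)
  also have "(\<integral>\<^sup>+\<omega>. \<integral>\<^sup>+s. indicator {0<..T} s *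
        ennreal (?q \<omega> s) \<partial>lborel \<partial>\<PP>)
     \<le> (\<integral>\<^sup>+\<omega>. \<integral>\<^sup>+s. ennreal (2 * b) * ?y \<omega> s + ennreal (\<eta>\<^sup>2 * C) * ?h \<omega> s \<partial>lborel \<partial>\<PP>)"
  proof (intro nn_integral_mono)
    fix \<omega> s assume \<omega>: "\<omega> \<in> space \<PP>"
    show "indicator {0<..T} s * ennreal (?q \<omega> s)
      \<le> ennreal (2 * b) * ?y \<omega> s + ennreal (\<eta>\<^sup>2 * C) * ?h \<omega> s"
    proof (cases "s \<in> {0<..T}")
      case True
      then have "0 \<le> Y s \<omega>" "0 \<le> \<mu> (P s \<omega>)"
        using sol mu \<omega> by (auto simp: strong_solution_def intensity_coefficient_def)
      from excitation_absorption[OF a12 \<eta> sub[folded a1_def] this]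
      have "?q \<omega> s
        \<le> 2 * b * (Y s \<omega>)\<^sup>2 + \<eta>\<^sup>2 * C * (1 + (\<mu> (P s \<omega>))\<^sup>2)"
        unfolding C_def a1_def[symmetric] a2_def[symmetric] .
      then have "ennreal (?q \<omega> s)
        \<le> ennreal (2 * b * (Y s \<omega>)\<^sup>2 + \<eta>\<^sup>2 * C * (1 + (\<mu> (P s \<omega>))\<^sup>2))" by (rule ennreal_leI)
      also have "\<dots> = ennreal (2 * b) * ennreal ((Y s \<omega>)\<^sup>2) + ennreal (\<eta>\<^sup>2 * C) * ennreal (1 + (\<mu> (P s \<omega>))\<^sup>2)"
      proof -
        have "0 \<le> 1 + (\<mu> (P s \<omega>))\<^sup>2" "0 \<le> \<eta>\<^sup>2 * C" using C by auto
        then show ?thesis using b by (simp only: ennreal_plus ennreal_mult mult_nonneg_nonneg zero_le_power2 zero_le_numeral)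
      qed
      finally show ?thesis using True by simp
    qed simp
  qed
  also have "\<dots> = (\<integral>\<^sup>+\<omega>. ennreal (2 * b) * (\<integral>\<^sup>+s. ?y \<omega> s \<partial>lborel) + ennreal (\<eta>\<^sup>2 * C) * (\<integral>\<^sup>+s. ?h \<omega> s \<partial>lborel) \<partial>\<PP>)"
    using mhs by (intro nn_integral_cong) (simp only: nn_integral_add nn_integral_cmult borel_measurable_times_ennreal measurable_const borel_measurable_const)
  also have "\<dots> = ?X + ennreal (\<eta>\<^sup>2 * C) * ?HH"
    unfolding Xeq using mhw by (simp only: nn_integral_add nn_integral_cmult borel_measurable_times_ennreal borel_measurable_const)
  finally have "?X + ?Z \<le> ennreal (y\<^sup>2) + (?X + ennreal (\<eta>\<^sup>2 * C) * ?HH)"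
    using add_left_mono by blast
  then have "?X + ?Z \<le> ?X + (ennreal (y\<^sup>2) + ennreal (\<eta>\<^sup>2 * C) * ?HH)"
    by (simp only: add_ac)
  then have "?Z \<le> ennreal (y\<^sup>2) + ennreal (\<eta>\<^sup>2 * C) * ?HH"
    using Xfin ennreal_add_left_cancel_le by blast
  also have "?HH = (\<integral>\<^sup>+s. \<integral>\<^sup>+\<omega>. ?h \<omega> s \<partial>\<PP> \<partial>lborel)"
    by (rule PL.Fubini'[symmetric, OF mh(1)])
  also have "\<dots> = (\<integral>\<^sup>+s. indicator {0<..T} s * (\<integral>\<^sup>+\<omega>. ennreal (1 + (\<mu> (P (max 0 s) \<omega>))\<^sup>2) \<partial>\<PP>) \<partial>lborel)"
  proof (intro nn_integral_cong nn_integral_cmult)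
    fix s :: real
    have "(\<lambda>x. ennreal (1 + (\<mu> (P (max 0 (snd x)) (fst x)))\<^sup>2)) \<in> borel_measurable (\<PP> \<Otimes>\<^sub>M lborel)" by measurable
    from measurable_Pair1[OF this, of s] show "(\<lambda>\<omega>. ennreal (1 + (\<mu> (P (max 0 s) \<omega>))\<^sup>2)) \<in> borel_measurable \<PP>" by simp
  qed
  finally show ?thesis .
qed

text \<open>The initial value contributes \<open>cy\<^sup>2 / \<rho>\<close>. In the other summand
  one factor \<open>1 / \<rho>\<close> pays for the time integral by
  \<open>laplace_primitive_le\<close>, and \<open>1 / \<rho> + B\<close> bounds the discounted
  expectation of 1 plus the squared baseline intensity. Nonnegativity of the constant is recorded
  for later products in \<open>ennreal\<close>.\<close>

lemma hawkes_discounted_second_moment_le: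
  fixes \<eta> \<eta>0 b \<rho> :: real
  assumes basis: "stochastic_basis \<PP> F \<nu> W M"
    and mu: "intensity_coefficient \<mu>"
    and a: "excitation_coefficient \<nu> a"
    and b: "0 \<le> b" and \<rho>: "0 < \<rho>"
    and \<eta>: "0 < \<eta>" "\<eta> \<le> \<eta>0" and sub: "\<eta>0 * (\<integral>\<zeta>. a \<zeta> \<partial>\<nu>) < b"
    and sol: "strong_solution \<PP> F \<nu> W M bcap bpol om \<sigma> b \<mu> (\<lambda>\<zeta>. \<eta> * a \<zeta>) \<alpha> k p y K P Y"
    and fa: "\<And>T. 0 < T \<Longrightarrow> AE \<omega> in \<PP>. emeasure (hawkes_jumps \<nu> M \<mu> P Y \<omega>) ({0<..T} \<times> space \<nu>) < \<infinity>"
    and mom: "\<And>T. 0 < T \<Longrightarrow> (\<integral>\<^sup>+\<omega>. (SUP t\<in>{0..T}. ennreal ((K t \<omega>)\<^sup>2 + (P t \<omega>)\<^sup>2 + (Y t \<omega>)\<^sup>2)) \<partial>\<PP>) < \<infinity>"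
    and y: "0 \<le> y" "y \<le> cy * \<eta>"
    and B: "discounted_expectation \<PP> \<rho> (\<lambda>t \<omega>. (\<mu> (P t \<omega>))\<^sup>2) \<le> ennreal B" "0 \<le> B"
  defines "C \<equiv> absorption_const b \<eta>0 (\<integral>\<zeta>. a \<zeta> \<partial>\<nu>) (\<integral>\<zeta>. (a \<zeta>)\<^sup>2 \<partial>\<nu>)"
  shows "discounted_expectation \<PP> \<rho> (\<lambda>t \<omega>. (Y t \<omega>)\<^sup>2) \<le> ennreal (\<eta>\<^sup>2 * (cy\<^sup>2 / \<rho> + C / \<rho> * (1 / \<rho> + B)))"
    and "0 \<le> cy\<^sup>2 / \<rho> + C / \<rho> * (1 / \<rho> + B)"
proof -
  note sb = stochastic_basisD[OF basis]
  interpret prob_space \<PP> by (rule sb)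
  have C: "0 \<le> C" using absorption_const_nonneg[OF sub] by (simp add: C_def)
  show "0 \<le> cy\<^sup>2 / \<rho> + C / \<rho> * (1 / \<rho> + B)" using \<rho> C B by simp
  note jm = strong_solution_joint_measurable[OF basis sol]
  note [measurable] = jm(3) jm(4)[OF mu]
  define h where "h s = (\<integral>\<^sup>+\<omega>. ennreal (1 + (\<mu> (P (max 0 s) \<omega>))\<^sup>2) \<partial>\<PP>)" for s
  have hm: "h \<in> borel_measurable lborel"
  proof -
    have "(\<lambda>x. ennreal (1 + (\<mu> (P (max 0 (fst x)) (snd x)))\<^sup>2)) \<in> borel_measurable (lborel \<Otimes>\<^sub>M \<PP>)"
    proof -
      have "(\<lambda>x. ennreal (1 + (\<mu> (P (max 0 (snd x)) (fst x)))\<^sup>2)) \<in> borel_measurable (\<PP> \<Otimes>\<^sub>M lborel)" by measurable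
      from measurable_compose[OF measurable_pair_swap' this] show ?thesis by (simp add: case_prod_beta')
    qed
    from borel_measurable_nn_integral_fst[OF this] show ?thesis by (simp add: h_def[abs_def])
  qed
  have mY: "(\<lambda>x. (Y (max 0 (snd x)) (fst x))\<^sup>2) \<in> borel_measurable (\<PP> \<Otimes>\<^sub>M lborel)"
    and m1: "(\<lambda>x. 1 + (\<mu> (P (max 0 (snd x)) (fst x)))\<^sup>2) \<in> borel_measurable (\<PP> \<Otimes>\<^sub>M lborel)"
    and m2: "(\<lambda>x. (\<mu> (P (max 0 (snd x)) (fst x)))\<^sup>2) \<in> borel_measurable (\<PP> \<Otimes>\<^sub>M lborel)"
    by measurable
  let ?E = "\<lambda>t. ennreal (exp (- \<rho> * t))"
  let ?H = "\<lambda>t. \<integral>\<^sup>+s. indicator {0<..t} s * h s \<partial>lborel"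
  have "discounted_expectation \<PP> \<rho> (\<lambda>t \<omega>. (Y t \<omega>)\<^sup>2)
      = (\<integral>\<^sup>+t. indicator {0..} t * (?E t * (\<integral>\<^sup>+\<omega>. ennreal ((Y (max 0 t) \<omega>)\<^sup>2) \<partial>\<PP>)) \<partial>lborel)"
    by (rule discounted_expectation_alt[OF prob_space_axioms mY])
  \<comment> \<open>The moment bound is stated for positive horizons; time 0 is
    Lebesgue-null.\<close>
  also have "\<dots> \<le> (\<integral>\<^sup>+t. ennreal (y\<^sup>2) * (indicator {0..} t * ?E t) + ennreal (\<eta>\<^sup>2 * C) * (indicator {0..} t * (?E t * ?H t)) \<partial>lborel)"
  proof (rule nn_integral_mono_AE, use AE_lborel_singleton[of 0] in eventually_elim)
    case (elim t)
    show ?case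
    proof (cases "0 < t")
      case True
      from hawkes_second_moment_le[OF basis mu a b True \<eta> sub sol fa[OF True] mom[OF True]]
      have "(\<integral>\<^sup>+\<omega>. ennreal ((Y t \<omega>)\<^sup>2) \<partial>\<PP>) \<le> ennreal (y\<^sup>2) + ennreal (\<eta>\<^sup>2 * C) * ?H t"
        unfolding C_def h_def .
      then have "?E t * (\<integral>\<^sup>+\<omega>. ennreal ((Y t \<omega>)\<^sup>2) \<partial>\<PP>) \<le> ?E t * (ennreal (y\<^sup>2) + ennreal (\<eta>\<^sup>2 * C) * ?H t)"
        by (rule mult_left_mono) simp
      then show ?thesis using True by (simp add: distrib_left mult_ac)
    qed (use elim in simp)
  qed
  also have "\<dots> = ennreal (y\<^sup>2) * (\<integral>\<^sup>+t. indicator {0..} t * ?E t \<partial>lborel) + ennreal (\<eta>\<^sup>2 * C) * (\<integral>\<^sup>+t. indicator {0..} t * (?E t * ?H t) \<partial>lborel)"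
  proof -
    have "?H \<in> borel_measurable lborel"
    proof (rule lborel.borel_measurable_nn_integral)
      have [measurable]: "{x :: real \<times> real. 0 < snd x \<and> snd x \<le> fst x} \<in> sets (lborel \<Otimes>\<^sub>M lborel)"
      proof -
        have "Measurable.pred (lborel \<Otimes>\<^sub>M lborel) (\<lambda>x :: real \<times> real. 0 < snd x \<and> snd x \<le> fst x)" by measurable
        then show ?thesis by (simp add: pred_def space_pair_measure)
      qed
      note [measurable] = hm
      have "(\<lambda>x. indicator {x :: real \<times> real. 0 < snd x \<and> snd x \<le> fst x} x * h (snd x)) \<in> borel_measurable (lborel \<Otimes>\<^sub>M lborel)"
        by measurable
      then show "(\<lambda>(t, s). indicator {0<..t} s * h s) \<in> borel_measurable (lborel \<Otimes>\<^sub>M lborel)"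
        by (rule measurable_cong[THEN iffD1, rotated]) (auto split: split_indicator)
    qed
    then show ?thesis
      by (subst nn_integral_add) (auto simp: nn_integral_cmult)
  qed
  also have "\<dots> \<le> ennreal (y\<^sup>2) * ennreal (1 / \<rho>) + ennreal (\<eta>\<^sup>2 * C) * (ennreal (1 / \<rho>) * ennreal (1 / \<rho> + B))"
  proof (intro add_mono mult_left_mono)
    show "(\<integral>\<^sup>+t. indicator {0..} t * ?E t \<partial>lborel) \<le> ennreal (1 / \<rho>)"
      using nn_integral_exp_atLeast[OF \<rho>, of 0] by simp
    have "(\<integral>\<^sup>+t. indicator {0..} t * (?E t * ?H t) \<partial>lborel)
      \<le> ennreal (1 / \<rho>) * (\<integral>\<^sup>+s. indicator {0..} s * (?E s * h s) \<partial>lborel)"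
      by (rule laplace_primitive_le[OF \<rho> hm])
    also have "(\<integral>\<^sup>+s. indicator {0..} s * (?E s * h s) \<partial>lborel) = discounted_expectation \<PP> \<rho> (\<lambda>t \<omega>. 1 + (\<mu> (P t \<omega>))\<^sup>2)"
      unfolding h_def by (rule discounted_expectation_alt[OF prob_space_axioms m1, symmetric])
    also have "\<dots> \<le> ennreal 1 * discounted_expectation \<PP> \<rho> (\<lambda>_ _. 1) + ennreal 1 * discounted_expectation \<PP> \<rho> (\<lambda>t \<omega>. (\<mu> (P t \<omega>))\<^sup>2)"
      by (rule discounted_expectation_le[OF prob_space_axioms _ m2]) simp_all
    also have "\<dots> \<le> ennreal (1 / \<rho>) + ennreal B"
      using B(1) by (simp add: discounted_expectation_one[OF prob_space_axioms \<rho>] add_left_mono)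
    also have "\<dots> = ennreal (1 / \<rho> + B)" using \<rho> B(2) by (simp add: ennreal_plus)
    finally show "(\<integral>\<^sup>+t. indicator {0..} t * (?E t * ?H t) \<partial>lborel) \<le> ennreal (1 / \<rho>) * ennreal (1 / \<rho> + B)"
      by (simp add: mult_left_mono)
  qed simp_all
  also have "\<dots> = ennreal (y\<^sup>2 * (1 / \<rho>) + \<eta>\<^sup>2 * C * ((1 / \<rho>) * (1 / \<rho> + B)))"
  proof -
    have "0 \<le> 1 / \<rho>" "0 \<le> 1 / \<rho> + B" "0 \<le> \<eta>\<^sup>2 * C" using \<rho> B C by auto
    then show ?thesis by (simp only: ennreal_plus ennreal_mult mult_nonneg_nonneg zero_le_power2)
  qed
  also have "\<dots> \<le> ennreal (\<eta>\<^sup>2 * (cy\<^sup>2 / \<rho> + C / \<rho> * (1 / \<rho> + B)))"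
  proof (rule ennreal_leI)
    have "y\<^sup>2 \<le> (cy * \<eta>)\<^sup>2" using y by (rule power_mono[rotated])
    then have "y\<^sup>2 * (1 / \<rho>) \<le> (cy * \<eta>)\<^sup>2 * (1 / \<rho>)" using \<rho> by (intro mult_right_mono) auto
    then show "y\<^sup>2 * (1 / \<rho>) + \<eta>\<^sup>2 * C * ((1 / \<rho>) * (1 / \<rho> + B)) \<le> \<eta>\<^sup>2 * (cy\<^sup>2 / \<rho> + C / \<rho> * (1 / \<rho> + B))"
      by (simp add: power_mult_distrib distrib_left mult_ac)
  qed
  finally show "discounted_expectation \<PP> \<rho> (\<lambda>t \<omega>. (Y t \<omega>)\<^sup>2) \<le> ennreal (\<eta>\<^sup>2 * (cy\<^sup>2 / \<rho> + C / \<rho> * (1 / \<rho> + B)))" .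
qed

text \<open>The weight \<open>1 / (2 * \<eta>)\<close> balances the two terms: the second moment of
  \<open>Y\<close> is of order \<open>\<eta>\<^sup>2\<close> and the growth factor of order 1, so
  both come out of order \<eta>. The 3 is the Cauchy-Schwarz constant for three summands.\<close>

lemma mult_le_weighted_squares:
  fixes \<eta> u v w :: real
  assumes "0 < \<eta>"
  shows "w * (1 + u + v) \<le> 1 / (2 * \<eta>) * w\<^sup>2 + 3 * \<eta> / 2 * (1 + u\<^sup>2 + v\<^sup>2)"
proof -
  let ?s = "1 + u + v"
  have "0 \<le> (w - \<eta> * ?s)\<^sup>2" by simp
  then have "w * ?s * (2 * \<eta>) \<le> w\<^sup>2 + \<eta>\<^sup>2 * ?s\<^sup>2"
    unfolding power2_diff power_mult_distrib by (simp add: mult_ac)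
  then have "w * ?s \<le> (w\<^sup>2 + \<eta>\<^sup>2 * ?s\<^sup>2) / (2 * \<eta>)"
    using assms by (subst pos_le_divide_eq) simp_all
  also have "\<dots> = 1 / (2 * \<eta>) * w\<^sup>2 + \<eta> / 2 * ?s\<^sup>2"
    using assms by (simp add: add_divide_distrib power2_eq_square)
  also have "\<dots> \<le> 1 / (2 * \<eta>) * w\<^sup>2 + \<eta> / 2 * (3 * (1 + u\<^sup>2 + v\<^sup>2))"
  proof (intro add_left_mono mult_left_mono)
    have "0 \<le> (1 - u)\<^sup>2 + (1 - v)\<^sup>2 + (u - v)\<^sup>2" by simp
    then show "?s\<^sup>2 \<le> 3 * (1 + u\<^sup>2 + v\<^sup>2)" by (simp add: power2_eq_square algebra_simps)
  qed (use assms in simp)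
  also have "\<eta> / 2 * (3 * (1 + u\<^sup>2 + v\<^sup>2)) = 3 * \<eta> / 2 * (1 + u\<^sup>2 + v\<^sup>2)"
    by (simp add: field_simps)
  finally show ?thesis .
qed

theorem proposition5p8:
  fixes \<PP> :: "'o measure" and F :: "real \<Rightarrow> 'o measure" and \<nu> :: "'z measure"
    and W :: "real \<Rightarrow> 'o \<Rightarrow> real" and M :: "'o \<Rightarrow> (real \<times> 'z \<times> real) measure"
    and act :: "(real \<times> real) set"
    and bcap bpol :: "real \<Rightarrow> real \<Rightarrow> real \<times> real \<Rightarrow> real"
    and om :: "real \<Rightarrow> real \<Rightarrow> 'z \<Rightarrow> real"
    and \<mu> :: "real \<Rightarrow> real" and a :: "'z \<Rightarrow> real"
    and \<sigma> b \<rho> k p \<eta>\<^sub>0 c\<^sub>y q :: real and y :: "real \<Rightarrow> real"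
    and K P Y :: "real \<Rightarrow> (real \<Rightarrow> 'o \<Rightarrow> real \<times> real) \<Rightarrow> real \<Rightarrow> 'o \<Rightarrow> real"
  defines "\<A> \<equiv> admissible_controls \<PP> F act"
  assumes basis: "stochastic_basis \<PP> F \<nu> W M"
    and constants: "\<sigma> > 0" "b > 0" "\<rho> > 0" "k > 0" "p > 0" "\<eta>\<^sub>0 > 0"
    and actions: "act \<subseteq> {0..} \<times> {0..1}"
    and mu: "intensity_coefficient \<mu>"
    and a: "excitation_coefficient \<nu> a"
    and drifts: "drift_coefficients act bcap bpol"
    and om: "damage_coefficient \<nu> om"
    and boundary: "boundary_not_attained \<PP> F W act bcap bpol \<sigma>"
    and y_nonneg: "\<And>\<eta>. \<eta> \<in> {0<..\<eta>\<^sub>0} \<Longrightarrow> y \<eta> \<ge> 0"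
    and solution: "\<And>\<eta> \<alpha>. \<eta> \<in> {0<..\<eta>\<^sub>0} \<Longrightarrow> \<alpha> \<in> \<A> \<Longrightarrow>
          unique_strong_solution \<PP> F \<nu> W M bcap bpol om \<sigma> b \<mu> (\<lambda>\<zeta>. \<eta> * a \<zeta>) \<alpha> k p (y \<eta>)
            (K \<eta> \<alpha>) (P \<eta> \<alpha>) (Y \<eta> \<alpha>)"
    and finite_activity: "\<And>\<eta> \<alpha> T. \<eta> \<in> {0<..\<eta>\<^sub>0} \<Longrightarrow> \<alpha> \<in> \<A> \<Longrightarrow> T > 0 \<Longrightarrow>
          AE \<omega> in \<PP>. emeasure (hawkes_jumps \<nu> M \<mu> (P \<eta> \<alpha>) (Y \<eta> \<alpha>) \<omega>) ({0<..T} \<times> space \<nu>) < \<infinity>"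
    and second_moments: "\<And>\<eta> \<alpha> T. \<eta> \<in> {0<..\<eta>\<^sub>0} \<Longrightarrow> \<alpha> \<in> \<A> \<Longrightarrow> T > 0 \<Longrightarrow>
          (\<integral>\<^sup>+\<omega>. (SUP t\<in>{0..T}. ennreal ((K \<eta> \<alpha> t \<omega>)\<^sup>2 + (P \<eta> \<alpha> t \<omega>)\<^sup>2 + (Y \<eta> \<alpha> t \<omega>)\<^sup>2)) \<partial>\<PP>) < \<infinity>"
    and initial: "c\<^sub>y > 0" "\<And>\<eta>. \<eta> \<in> {0<..\<eta>\<^sub>0} \<Longrightarrow> 0 \<le> y \<eta> \<and> y \<eta> \<le> c\<^sub>y * \<eta>"
    and subcritical: "\<eta>\<^sub>0 * (\<integral>\<zeta>. a \<zeta> \<partial>\<nu>) < b"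
    and baseline_bound: "\<exists>B\<^sub>\<mu>::real.
          (SUP \<eta>\<in>{0<..\<eta>\<^sub>0}. SUP \<alpha>\<in>\<A>. discounted_expectation \<PP> \<rho> (\<lambda>t \<omega>. (\<mu> (P \<eta> \<alpha> t \<omega>))\<^sup>2))
            \<le> ennreal B\<^sub>\<mu>"
    and q: "q \<ge> 0"
    and growth_bound: "\<exists>B\<^sub>q::real.
          (SUP \<eta>\<in>{0<..\<eta>\<^sub>0}. SUP \<alpha>\<in>\<A>. discounted_expectation \<PP> \<rho>
             (\<lambda>t \<omega>. 1 + K \<eta> \<alpha> t \<omega> powr (2 * q) + P \<eta> \<alpha> t \<omega> powr (2 * q)))
            \<le> ennreal B\<^sub>q"
  shows "(\<exists>A>0. \<forall>\<eta>\<in>{0<..\<eta>\<^sub>0}.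
            (SUP \<alpha>\<in>\<A>. discounted_expectation \<PP> \<rho>
               (\<lambda>t \<omega>. Y \<eta> \<alpha> t \<omega> * (1 + K \<eta> \<alpha> t \<omega> powr q + P \<eta> \<alpha> t \<omega> powr q)))
              \<le> ennreal (A * \<eta>)) \<and>
         ((\<lambda>\<eta>. SUP \<alpha>\<in>\<A>. discounted_expectation \<PP> \<rho>
               (\<lambda>t \<omega>. Y \<eta> \<alpha> t \<omega> * (1 + K \<eta> \<alpha> t \<omega> powr q + P \<eta> \<alpha> t \<omega> powr q))) \<longlongrightarrow> 0) (at_right 0)"
proof -
  note sb = stochastic_basisD[OF basis]
  let ?D = "discounted_expectation \<PP> \<rho>"
  let ?G = "\<lambda>\<eta> \<alpha> t \<omega>. Y \<eta> \<alpha> t \<omega> * (1 + K \<eta> \<alpha> t \<omega> powr q + P \<eta> \<alpha> t \<omega> powr q)"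
  obtain B\<^sub>\<mu> B\<^sub>q :: real where B\<^sub>\<mu>: "(SUP \<eta>\<in>{0<..\<eta>\<^sub>0}. SUP \<alpha>\<in>\<A>. ?D (\<lambda>t \<omega>. (\<mu> (P \<eta> \<alpha> t \<omega>))\<^sup>2)) \<le> ennreal B\<^sub>\<mu>"
    and B\<^sub>q: "(SUP \<eta>\<in>{0<..\<eta>\<^sub>0}. SUP \<alpha>\<in>\<A>. ?D (\<lambda>t \<omega>. 1 + K \<eta> \<alpha> t \<omega> powr (2 * q) + P \<eta> \<alpha> t \<omega> powr (2 * q))) \<le> ennreal B\<^sub>q"
    using baseline_bound growth_bound by blast
  \<comment> \<open>The given bounds are arbitrary reals; \<open>ennreal\<close> sends negative ones
    to 0, so positive parts may take their place.\<close>
  define B where "B = max 0 B\<^sub>\<mu>"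
  define B' where "B' = max 0 B\<^sub>q"
  define C where "C = absorption_const b \<eta>\<^sub>0 (\<integral>\<zeta>. a \<zeta> \<partial>\<nu>) (\<integral>\<zeta>. (a \<zeta>)\<^sup>2 \<partial>\<nu>)"
  define A where "A = c\<^sub>y\<^sup>2 / \<rho> + C / \<rho> * (1 / \<rho> + B)"
  \<comment> \<open>The first two summands are what the weights \<open>1 / (2 * \<eta>)\<close> and
    \<open>3 * \<eta> / 2\<close> leave after division by \<eta>, and the 1 makes the constant
    strictly positive. The \<open>max 0\<close> is there because \<open>0 \<le> A\<close> is derived
    below only once a control and its solution are fixed.\<close>
  define A' where "A' = max 0 A / 2 + 3 / 2 * B' + 1"
  have A': "0 < A'" unfolding A'_def B'_def by (simp add: add_nonneg_pos)
  have bound: "?D (?G \<eta> \<alpha>) \<le> ennreal (A' * \<eta>)" if \<eta>: "\<eta> \<in> {0<..\<eta>\<^sub>0}" and \<alpha>: "\<alpha> \<in> \<A>" for \<eta> \<alpha>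
  proof -
    have \<eta>': "0 < \<eta>" "\<eta> \<le> \<eta>\<^sub>0" using \<eta> by auto
    have sol: "strong_solution \<PP> F \<nu> W M bcap bpol om \<sigma> b \<mu> (\<lambda>\<zeta>. \<eta> * a \<zeta>) \<alpha> k p (y \<eta>) (K \<eta> \<alpha>) (P \<eta> \<alpha>) (Y \<eta> \<alpha>)"
      using solution[OF \<eta> \<alpha>] by (simp add: unique_strong_solution_def)
    have D\<mu>: "?D (\<lambda>t \<omega>. (\<mu> (P \<eta> \<alpha> t \<omega>))\<^sup>2) \<le> ennreal B"
      by (rule order_trans[OF SUP_upper2[OF \<eta> SUP_upper[OF \<alpha>]] order_trans[OF B\<^sub>\<mu>]])
        (simp add: B_def ennreal_leI)
    have Dq: "?D (\<lambda>t \<omega>. 1 + K \<eta> \<alpha> t \<omega> powr (2 * q) + P \<eta> \<alpha> t \<omega> powr (2 * q)) \<le> ennreal B'"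
      by (rule order_trans[OF SUP_upper2[OF \<eta> SUP_upper[OF \<alpha>]] order_trans[OF B\<^sub>q]])
        (simp add: B'_def ennreal_leI)
    have "?D (\<lambda>t \<omega>. (Y \<eta> \<alpha> t \<omega>)\<^sup>2) \<le> ennreal (\<eta>\<^sup>2 * A)" "0 \<le> A"
      unfolding A_def C_def
      using hawkes_discounted_second_moment_le[OF basis mu a less_imp_le[OF constants(2)] constants(3) \<eta>' subcritical sol
        finite_activity[OF \<eta> \<alpha>] second_moments[OF \<eta> \<alpha>] _ _ D\<mu>, of c\<^sub>y] initial(2)[OF \<eta>]
      by (simp_all add: B_def)
    note DY = this
    note jm[measurable] = strong_solution_joint_measurable(1-3)[OF basis sol]
    have "?D (?G \<eta> \<alpha>) \<le> ennreal (1 / (2 * \<eta>)) * ?D (\<lambda>t \<omega>. (Y \<eta> \<alpha> t \<omega>)\<^sup>2) +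
        ennreal (3 * \<eta> / 2) * ?D (\<lambda>t \<omega>. 1 + K \<eta> \<alpha> t \<omega> powr (2 * q) + P \<eta> \<alpha> t \<omega> powr (2 * q))"
    proof (rule discounted_expectation_le[OF sb(1)])
      show "0 \<le> 1 / (2 * \<eta>)" "0 \<le> 3 * \<eta> / 2" using \<eta>' by auto
      fix t :: real and \<omega>
      have sq: "x powr (2 * q) = (x powr q)\<^sup>2" for x :: real
        by (simp only: mult_2 powr_add power2_eq_square)
      show "0 \<le> (Y \<eta> \<alpha> t \<omega>)\<^sup>2 \<and> 0 \<le> 1 + K \<eta> \<alpha> t \<omega> powr (2 * q) + P \<eta> \<alpha> t \<omega> powr (2 * q) \<and>
          ?G \<eta> \<alpha> t \<omega> \<le> 1 / (2 * \<eta>) * (Y \<eta> \<alpha> t \<omega>)\<^sup>2 + 3 * \<eta> / 2 * (1 + K \<eta> \<alpha> t \<omega> powr (2 * q) + P \<eta> \<alpha> t \<omega> powr (2 * q))"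
        unfolding sq by (intro conjI mult_le_weighted_squares[OF \<eta>'(1)]) simp_all
    qed measurable
    also have "\<dots> \<le> ennreal (1 / (2 * \<eta>)) * ennreal (\<eta>\<^sup>2 * A) + ennreal (3 * \<eta> / 2) * ennreal B'"
      by (intro add_mono mult_left_mono DY(1) Dq) simp_all
    also have "\<dots> = ennreal (1 / (2 * \<eta>) * (\<eta>\<^sup>2 * A) + 3 * \<eta> / 2 * B')"
    proof -
      have "0 \<le> 1 / (2 * \<eta>)" "0 \<le> \<eta>\<^sup>2 * A" "0 \<le> 3 * \<eta> / 2" "0 \<le> B'"
        using \<eta>' DY(2) by (simp_all add: B'_def)
      then show ?thesis by (simp only: ennreal_plus ennreal_mult mult_nonneg_nonneg)
    qed
    also have "\<dots> \<le> ennreal (A' * \<eta>)"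
    proof (rule ennreal_leI)
      have "1 / (2 * \<eta>) * (\<eta>\<^sup>2 * A) = A / 2 * \<eta>" using \<eta>' by (simp add: power2_eq_square)
      then show "1 / (2 * \<eta>) * (\<eta>\<^sup>2 * A) + 3 * \<eta> / 2 * B' \<le> A' * \<eta>"
        using \<eta>' DY(2) by (simp add: A'_def algebra_simps)
    qed
    finally show ?thesis .
  qed
  have sup: "(SUP \<alpha>\<in>\<A>. ?D (?G \<eta> \<alpha>)) \<le> ennreal (A' * \<eta>)" if "\<eta> \<in> {0<..\<eta>\<^sub>0}" for \<eta>
    using bound[OF that] by (intro SUP_least)
  have "((\<lambda>\<eta>. SUP \<alpha>\<in>\<A>. ?D (?G \<eta> \<alpha>)) \<longlongrightarrow> 0) (at_right 0)"
  proof (rule tendsto_sandwich)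
    show "\<forall>\<^sub>F \<eta> in at_right 0. 0 \<le> (SUP \<alpha>\<in>\<A>. ?D (?G \<eta> \<alpha>))" by simp
    show "\<forall>\<^sub>F \<eta> in at_right 0. (SUP \<alpha>\<in>\<A>. ?D (?G \<eta> \<alpha>)) \<le> ennreal (A' * \<eta>)"
      using eventually_at_right_real[OF constants(6)] by eventually_elim (auto intro: sup)
    have "((\<lambda>\<eta>. ennreal (A' * \<eta>)) \<longlongrightarrow> ennreal (A' * 0)) (at_right 0)"
      by (intro tendsto_ennrealI tendsto_intros)
    then show "((\<lambda>\<eta>. ennreal (A' * \<eta>)) \<longlongrightarrow> 0) (at_right 0)" by simp
  qed simp
  with sup A' show ?thesis by blast
qed

end
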